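(* Let $X=(X_t)_{t\in[0,T]}$ be a solution of the stochastic Volterra equation $$X_t=x_0+\int_0^t k_1(t-s)\,b(s,X_s)\,\mathrm{d}s+\int_0^t k_2(t-s)\,\mathrm{d}W_s ,$$ and let $\phi\in H$ be the function identically equal to $x_0$. For every $t\in[0,T]$ let $$\theta_t(\xi)=x_0+\int_0^t k_1(\xi-s)\,b(s,X_s)\,\mathrm{d}s+\int_0^t k_2(\xi-s)\,\mathrm{d}W_s,\qquad \xi\in[t,T],$$ and let $w_t(\xi)=X_\xi$ if $\xi\le t$ and $w_t(\xi)=\theta_t(\xi)$ if $\xi>t$, $\xi\in[0,T]$. Then, for every $t\in[0,T]$, the following identity holds: $$w_t=\phi+\int_0^t B(s,w_t)\,\mathrm{d}s+\int_0^t\sigma(s)\,\mathrm{d}W_s,\qquad \mathbb{P}\text{-a.s.}$$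
   Context: Fix $T>0$, $d\in\mathbb{N}$, $x_0\in\mathbb{R}^d$. $(\Omega,\mathcal{F},\mathbb{P},\mathbb{F})$ is a complete filtered probability space, the filtration $\mathbb{F}=(\mathcal{F}_t)_{t\in[0,T]}$ satisfies the usual conditions, and $W=(W_t)_{t\ge0}$ is a standard $\mathbb{R}^d$-valued Brownian motion on it (with respect to $\mathbb{F}$). The kernel $k_2\colon(0,\infty)\to(0,\infty)$ is $k_2(t)=\frac{1}{\Gamma(\alpha)}t^{\alpha-1}$ for some $\alpha\in(\frac12,1)$. The kernel $k_1$ is real-valued, locally square-integrable, and continuous on $(0,\infty)$. The vector field $b\colon[0,T]\times\mathbb{R}^d\to\mathbb{R}^d$ is measurable and there is $L>0$ with $|b(t,x)|\le L(1+|x|)$ and $|b(t,x)-b(t,y)|\le L|x-y|$ for all $t\in[0,T]$, $x,y\in\mathbb{R}^d$. A solution of the stochastic Volterra equation is a continuous $\mathbb{F}$-adapted process satisfying the identity for every $t\in[0,T]$, $\mathbb{P}$-a.s. $H=L^2(0,T;\mathbb{R}^d)$ and $\Lambda=C([0,T];\mathbb{R}^d)$. The map $\sigma\colon[0,T]\to\mathcal{L}(\mathbb{R}^d;H)$ is $[\sigma(t)x](\xi)=k_2(\xi-t)1_{\{t<\xi\}}x$ for $x\in\mathbb{R}^d$, $t,\xi\in[0,T]$, and $\int_0^t\sigma(s)\,\mathrm{d}W_s$ is the corresponding $H$-valued stochastic integral. The map $B\colon[0,T]\times\Lambda\to H$ is $[B(t,w)](\xi)=k_1(\xi-t)1_{\{t<\xi\}}\,b(t,w(t))$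 for $t,\xi\in[0,T]$. The stochastic integral process $\big(\int_0^t k_2(\xi-s)\,\mathrm{d}W_s\big)_{\xi\in[t,T]}$ is taken in a version with trajectories continuous in $\xi$, so that $w_t$ has continuous trajectories and $B(s,w_t)$ is meaningful. The integral $\int_0^tB(s,w_t)\,\mathrm{d}s$ is a Bochner integral in $H$ (with the same $w_t$ for all $s\in[0,t]$). *)

theory Defs
  imports "HOL-Probability.Probability"
begin

section \<open>Square-integrable functions on the real line\<close>

definition square_integrable :: "(real \<Rightarrow> 'a::euclidean_space) \<Rightarrow> bool" where
  "square_integrable f \<longleftrightarrow> f \<in> borel_measurable lborel \<and> integrable lborel (\<lambda>x. (norm (f x))\<^sup>2)"

lemma square_integrable_measurable [measurable_dest]:
  "square_integrable f \<Longrightarrow> f \<in> borel_measurable lborel"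
  by (simp add: square_integrable_def)

lemma square_integrable_0: "square_integrable (\<lambda>_. 0)"
  by (simp add: square_integrable_def)

lemma square_integrable_add:
  assumes "square_integrable f" "square_integrable g"
  shows "square_integrable (\<lambda>x. f x + g x)"
proof -
  have [measurable]: "f \<in> borel_measurable lborel" "g \<in> borel_measurable lborel"
    using assms by (auto simp: square_integrable_def)
  have "(norm (f x + g x))\<^sup>2 \<le> 2 * (norm (f x))\<^sup>2 + 2 * (norm (g x))\<^sup>2" for x
  proof -
    have "(norm (f x + g x))\<^sup>2 \<le> (norm (f x) + norm (g x))\<^sup>2"
      by (intro power_mono norm_triangle_ineq) auto
    also have "\<dots> \<le> 2 * (norm (f x))\<^sup>2 + 2 * (norm (g x))\<^sup>2"
      using sum_squares_bound[of "norm (f x)" "norm (g x)"] by (simp add: power2_sum)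
    finally show ?thesis .
  qed
  then have bound: "norm ((norm (f x + g x))\<^sup>2) \<le> norm (2 * (norm (f x))\<^sup>2 + 2 * (norm (g x))\<^sup>2)" for x
    by simp
  have "integrable lborel (\<lambda>x. 2 * (norm (f x))\<^sup>2 + 2 * (norm (g x))\<^sup>2)"
    using assms by (intro Bochner_Integration.integrable_add integrable_mult_right) (simp_all add: square_integrable_def)
  then have "integrable lborel (\<lambda>x. (norm (f x + g x))\<^sup>2)"
    by (rule Bochner_Integration.integrable_bound) (measurable, rule AE_I2, rule bound)
  then show ?thesis by (simp add: square_integrable_def)
qed

lemma square_integrable_scaleR:
  assumes "square_integrable f"
  shows "square_integrable (\<lambda>x. c *\<^sub>R f x)"
  using assms by (auto simp: square_integrable_def power_mult_distrib)

lemma square_integrable_minus: "square_integrable f \<Longrightarrow> square_integrable (\<lambda>x. - f x)"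
  using square_integrable_scaleR[of f "-1"] by simp

lemma square_integrable_diff:
  "square_integrable f \<Longrightarrow> square_integrable g \<Longrightarrow> square_integrable (\<lambda>x. f x - g x)"
  using square_integrable_add[of f "\<lambda>x. - g x"] square_integrable_minus[of g] by simp

lemma integrable_inner_square_integrable:
  assumes "square_integrable f" "square_integrable g"
  shows "integrable lborel (\<lambda>x. f x \<bullet> g x)"
proof -
  have [measurable]: "f \<in> borel_measurable lborel" "g \<in> borel_measurable lborel"
    using assms by (auto simp: square_integrable_def)
  have bound: "norm (f x \<bullet> g x) \<le> norm ((norm (f x))\<^sup>2 + (norm (g x))\<^sup>2)" for x
  proof -
    have "norm (f x \<bullet> g x) \<le> norm (f x) * norm (g x)"
      by (simp add: Cauchy_Schwarz_ineq2)
    also have "\<dots> \<le> 2 * norm (f x) * norm (g x)"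
      by simp
    also have "\<dots> \<le> (norm (f x))\<^sup>2 + (norm (g x))\<^sup>2"
      by (rule sum_squares_bound)
    finally show ?thesis by simp
  qed
  have "integrable lborel (\<lambda>x. (norm (f x))\<^sup>2 + (norm (g x))\<^sup>2)"
    using assms by (intro Bochner_Integration.integrable_add) (simp_all add: square_integrable_def)
  then show ?thesis
    by (rule Bochner_Integration.integrable_bound) (measurable, rule AE_I2, rule bound)
qed

section \<open>The Hilbert space of square-integrable functions modulo equality almost everywhere\<close>

quotient_type (overloaded) 'a l2 = "real \<Rightarrow> 'a::euclidean_space" / partial:
  "\<lambda>f g. square_integrable f \<and> square_integrable g \<and> (AE x in lborel. f x = g x)"
proof (rule part_equivpI)
  show "\<exists>f :: real \<Rightarrow> 'a. square_integrable f \<and> square_integrable f \<and> (AE x in lborel. f x = f x)"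
    using square_integrable_0 by auto
  show "symp (\<lambda>f (g :: real \<Rightarrow> 'a). square_integrable f \<and> square_integrable g \<and> (AE x in lborel. f x = g x))"
    by (auto simp: symp_def)
  show "transp (\<lambda>f (g :: real \<Rightarrow> 'a). square_integrable f \<and> square_integrable g \<and> (AE x in lborel. f x = g x))"
    unfolding transp_def by (auto elim: eventually_elim2)
qed

instantiation l2 :: (euclidean_space) real_inner
begin

lift_definition zero_l2 :: "'a l2" is "\<lambda>_. 0"
  by (simp add: square_integrable_0)

lift_definition plus_l2 :: "'a l2 \<Rightarrow> 'a l2 \<Rightarrow> 'a l2" is "\<lambda>f g x. f x + g x"
  by (elim conjE, intro conjI square_integrable_add) (assumption | erule (1) eventually_elim2, simp)+

lift_definition minus_l2 :: "'a l2 \<Rightarrow> 'a l2 \<Rightarrow> 'a l2" is "\<lambda>f g x. f x - g x"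
  by (elim conjE, intro conjI square_integrable_diff) (assumption | erule (1) eventually_elim2, simp)+

lift_definition uminus_l2 :: "'a l2 \<Rightarrow> 'a l2" is "\<lambda>f x. - f x"
  by (elim conjE, intro conjI square_integrable_minus) (assumption | erule eventually_mono, simp)+

lift_definition scaleR_l2 :: "real \<Rightarrow> 'a l2 \<Rightarrow> 'a l2" is "\<lambda>c f x. c *\<^sub>R f x"
  by (elim conjE, intro conjI square_integrable_scaleR) (assumption | erule eventually_mono, simp)+

lift_definition inner_l2 :: "'a l2 \<Rightarrow> 'a l2 \<Rightarrow> real" is "\<lambda>f g. LINT x|lborel. f x \<bullet> g x"
proof (elim conjE)
  fix f f' g g' :: "real \<Rightarrow> 'a"
  assume sq: "square_integrable f" "square_integrable f'" "square_integrable g" "square_integrable g'"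
    and ae: "AE x in lborel. f x = f' x" "AE x in lborel. g x = g' x"
  have "AE x in lborel. f x \<bullet> g x = f' x \<bullet> g' x"
    using ae by eventually_elim simp
  then show "(LINT x|lborel. f x \<bullet> g x) = (LINT x|lborel. f' x \<bullet> g' x)"
    using borel_measurable_integrable[OF integrable_inner_square_integrable[OF sq(1,3)]]
      borel_measurable_integrable[OF integrable_inner_square_integrable[OF sq(2,4)]]
    by (rule integral_cong_AE[rotated 2])
qed

definition norm_l2 :: "'a l2 \<Rightarrow> real" where "norm_l2 f = sqrt (f \<bullet> f)"
definition sgn_l2 :: "'a l2 \<Rightarrow> 'a l2" where "sgn_l2 f = scaleR (inverse (norm f)) f"
definition dist_l2 :: "'a l2 \<Rightarrow> 'a l2 \<Rightarrow> real" where "dist_l2 f g = norm (f - g)"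
definition uniformity_l2 :: "('a l2 \<times> 'a l2) filter" where
  "uniformity_l2 = (INF e\<in>{0<..}. principal {(x, y). dist x y < e})"
definition open_l2 :: "'a l2 set \<Rightarrow> bool" where
  "open_l2 U \<longleftrightarrow> (\<forall>x\<in>U. eventually (\<lambda>(x', y). x' = x \<longrightarrow> y \<in> U) uniformity)"

instance
proof
  fix f g h :: "'a l2" and a b :: real
  show "f + g + h = f + (g + h)"
    by transfer (simp add: square_integrable_add add.assoc)
  show "f + g = g + f"
    by transfer (simp add: square_integrable_add add.commute)
  show "0 + f = f"
    by transfer simp
  show "- f + f = 0"
    by transfer (simp add: square_integrable_0)
  show "f - g = f + - g"
    by transfer (simp add: square_integrable_diff)
  show "a *\<^sub>R (f + g) = a *\<^sub>R f + a *\<^sub>R g"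
    by transfer (simp add: square_integrable_add square_integrable_scaleR scaleR_add_right)
  show "(a + b) *\<^sub>R f = a *\<^sub>R f + b *\<^sub>R f"
    by transfer (simp add: square_integrable_add square_integrable_scaleR scaleR_add_left)
  show "a *\<^sub>R b *\<^sub>R f = (a * b) *\<^sub>R f"
    by transfer (simp add: square_integrable_scaleR)
  show "1 *\<^sub>R f = f"
    by transfer simp
  show "f \<bullet> g = g \<bullet> f"
    by transfer (simp add: inner_commute)
  show "(f + g) \<bullet> h = f \<bullet> h + g \<bullet> h"
    by transfer (simp add: inner_add_left integrable_inner_square_integrable)
  show "(a *\<^sub>R f) \<bullet> g = a * (f \<bullet> g)"
    by transfer simp
  show "0 \<le> f \<bullet> f"
    by transfer simp
  show "f \<bullet> f = 0 \<longleftrightarrow> f = 0"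
  proof transfer
    fix f :: "real \<Rightarrow> 'a"
    assume "square_integrable f \<and> square_integrable f \<and> (AE x in lborel. f x = f x)"
    then show "(LINT x|lborel. f x \<bullet> f x) = 0 \<longleftrightarrow>
      (square_integrable f \<and> square_integrable (\<lambda>_. 0 :: 'a) \<and> (AE x in lborel. f x = 0))"
      using integral_nonneg_eq_0_iff_AE[of lborel "\<lambda>x. f x \<bullet> f x"]
      by (simp add: integrable_inner_square_integrable square_integrable_0)
  qed
qed (auto simp: norm_l2_def sgn_l2_def dist_l2_def uniformity_l2_def open_l2_def)

end

lift_definition l2_class :: "(real \<Rightarrow> 'a::euclidean_space) \<Rightarrow> 'a l2" is
  "\<lambda>f. if square_integrable f then f else (\<lambda>_. 0)"
  by (simp add: square_integrable_0)

lemma l2_exhaust: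
  obtains f where "square_integrable f" "x = l2_class f"
proof -
  have "\<exists>f. square_integrable f \<and> x = l2_class f"
  proof transfer
    fix f :: "real \<Rightarrow> 'a"
    assume "square_integrable f \<and> square_integrable f \<and> (AE x in lborel. f x = f x)"
    then show "\<exists>g. square_integrable g \<and> square_integrable f \<and>
        square_integrable (if square_integrable g then g else (\<lambda>_. 0)) \<and>
        (AE x in lborel. f x = (if square_integrable g then g else (\<lambda>_. 0)) x)"
      by (intro exI[of _ f]) simp
  qed
  then show ?thesis using that by blast
qed

lemma l2_class_eq_iff:
  "square_integrable f \<Longrightarrow> square_integrable g \<Longrightarrow>
    l2_class f = l2_class g \<longleftrightarrow> (AE x in lborel. f x = g x)"
  by transfer simp

lemma l2_class_zero: "l2_class (\<lambda>_. 0) = 0"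
  by transfer (simp add: square_integrable_0)

lemma l2_class_add:
  "square_integrable f \<Longrightarrow> square_integrable g \<Longrightarrow>
    l2_class (\<lambda>x. f x + g x) = l2_class f + l2_class g"
  by transfer (simp add: square_integrable_add)

lemma l2_class_diff:
  "square_integrable f \<Longrightarrow> square_integrable g \<Longrightarrow>
    l2_class (\<lambda>x. f x - g x) = l2_class f - l2_class g"
  by transfer (simp add: square_integrable_diff)

lemma l2_class_scaleR:
  "square_integrable f \<Longrightarrow> l2_class (\<lambda>x. c *\<^sub>R f x) = c *\<^sub>R l2_class f"
  by transfer (simp add: square_integrable_scaleR)

lemma norm_l2_class:
  "square_integrable f \<Longrightarrow> (norm (l2_class f))\<^sup>2 = (LINT x|lborel. (norm (f x))\<^sup>2)"
  unfolding power2_norm_eq_inner by transfer simp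

lemma nn_integral_l2_class:
  assumes "square_integrable f"
  shows "(\<integral>\<^sup>+x. ennreal ((norm (f x))\<^sup>2) \<partial>lborel) = ennreal ((norm (l2_class f))\<^sup>2)"
  using assms by (subst norm_l2_class) (auto simp: square_integrable_def intro!: nn_integral_eq_integral)

lemma square_integrableI_nn_integral:
  assumes "f \<in> borel_measurable lborel" "(\<integral>\<^sup>+x. ennreal ((norm (f x))\<^sup>2) \<partial>lborel) < \<infinity>"
  shows "square_integrable f"
proof -
  have "(\<lambda>x. (norm (f x))\<^sup>2) \<in> borel_measurable lborel"
    using assms(1) by measurable
  then show ?thesis
    using assms unfolding square_integrable_def by (simp add: integrable_iff_bounded)
qed

instance l2 :: (euclidean_space) banach
proof
  fix X :: "nat \<Rightarrow> 'a l2"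
  assume "Cauchy X"
  have "\<forall>n. \<exists>f. square_integrable f \<and> X n = l2_class f"
    by (metis l2_exhaust)
  then obtain f where sq: "\<And>n. square_integrable (f n)" and X: "\<And>n. X n = l2_class (f n)"
    by metis
  have [measurable]: "f n \<in> borel_measurable lborel" for n
    using sq by (simp add: square_integrable_def)
  have X_diff: "(\<integral>\<^sup>+x. ennreal ((norm (f m x - f n x))\<^sup>2) \<partial>lborel) = ennreal ((norm (X m - X n))\<^sup>2)" for m n
    unfolding X by (simp add: l2_class_diff[symmetric] nn_integral_l2_class sq square_integrable_diff)
  have "\<forall>k. \<exists>N. \<forall>m\<ge>N. \<forall>n\<ge>N. norm (X m - X n) < (1/2) ^ k"
    using \<open>Cauchy X\<close> by (simp add: Cauchy_iff)
  then obtain N where N: "\<And>k m n. N k \<le> m \<Longrightarrow> N k \<le> n \<Longrightarrow> norm (X m - X n) < (1/2) ^ k"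
    by metis
  define r where "r k = (\<Sum>i\<le>k. N i) + k" for k
  have r: "N k \<le> r k" "N k \<le> r (Suc k)" "k \<le> r k" for k
    using member_le_sum[of k "{..k}" N] by (auto simp: r_def)
  define g where "g k = f (r k)" for k
  define d where "d k x = g (Suc k) x - g k x" for k x
  have [measurable]: "g k \<in> borel_measurable lborel" "d k \<in> borel_measurable lborel" for k
    by (auto simp: g_def d_def[abs_def])
  have "(\<integral>\<^sup>+x. (\<Sum>k. ennreal (2 ^ k * (norm (d k x))\<^sup>2)) \<partial>lborel)
      = (\<Sum>k. \<integral>\<^sup>+x. ennreal (2 ^ k * (norm (d k x))\<^sup>2) \<partial>lborel)"
    by (rule nn_integral_suminf) measurable
  also have "\<dots> = (\<Sum>k. ennreal (2 ^ k * (norm (X (r (Suc k)) - X (r k)))\<^sup>2))"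
    by (simp add: ennreal_mult nn_integral_cmult d_def g_def X_diff)
  also have "\<dots> \<le> (\<Sum>k. ennreal ((1/2) ^ k))"
  proof (rule suminf_le)
    fix k
    have "(norm (X (r (Suc k)) - X (r k)))\<^sup>2 \<le> ((1/2) ^ k)\<^sup>2"
      by (intro power_mono less_imp_le[OF N]) (use r in auto)
    then have "2 ^ k * (norm (X (r (Suc k)) - X (r k)))\<^sup>2 \<le> 2 ^ k * ((1/2) ^ k)\<^sup>2"
      by simp
    also have "(2::real) ^ k * ((1/2) ^ k)\<^sup>2 = (1/2) ^ k"
      by (simp add: power2_eq_square power_divide)
    finally show "ennreal (2 ^ k * (norm (X (r (Suc k)) - X (r k)))\<^sup>2) \<le> ennreal ((1/2) ^ k)"
      by (rule ennreal_leI)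
  qed auto
  also have "\<dots> = ennreal 2"
    using geometric_sums[of "1/2 :: real"] by (intro suminf_ennreal_eq) auto
  finally have fin: "(\<integral>\<^sup>+x. (\<Sum>k. ennreal (2 ^ k * (norm (d k x))\<^sup>2)) \<partial>lborel) \<noteq> \<infinity>"
    by (auto simp: top_unique)
  have "AE x in lborel. (\<Sum>k. ennreal (2 ^ k * (norm (d k x))\<^sup>2)) \<noteq> \<infinity>"
    by (rule nn_integral_noteq_infinite[OF _ fin]) measurable
  then have conv: "AE x in lborel. convergent (\<lambda>k. g k x)"
  proof (rule eventually_mono)
    fix x
    assume "(\<Sum>k. ennreal (2 ^ k * (norm (d k x))\<^sup>2)) \<noteq> \<infinity>"
    then have "summable (\<lambda>k. 2 ^ k * (norm (d k x))\<^sup>2)"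
      by (intro summable_suminf_not_top) auto
    then have sm: "summable (\<lambda>k. (1/2) ^ k + 2 ^ k * (norm (d k x))\<^sup>2)"
      by (intro summable_add summable_geometric) auto
    have "norm (d k x) \<le> (1/2) ^ k + 2 ^ k * (norm (d k x))\<^sup>2" for k
    proof (cases "norm (d k x) \<le> (1/2) ^ k")
      case False
      then have "1 \<le> 2 ^ k * norm (d k x)"
        using mult_left_mono[of "(1/2) ^ k" "norm (d k x)" "2 ^ k"] by (simp add: power_one_over)
      then have "1 * norm (d k x) \<le> (2 ^ k * norm (d k x)) * norm (d k x)"
        by (intro mult_right_mono) auto
      then have "norm (d k x) \<le> 2 ^ k * (norm (d k x))\<^sup>2"
        by (simp add: power2_eq_square mult.assoc)
      then show ?thesis
        by (smt (verit) zero_le_power zero_le_divide_1_iff)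
    qed (simp add: add_increasing2)
    then have "summable (\<lambda>k. d k x)"
      by (intro summable_comparison_test'[OF sm]) auto
    then have "convergent (\<lambda>n. g 0 x + (\<Sum>k<n. d k x))"
      by (intro convergent_add convergent_const) (simp add: summable_iff_convergent)
    also have "(\<lambda>n. g 0 x + (\<Sum>k<n. d k x)) = (\<lambda>n. g n x)"
      by (simp add: d_def sum_lessThan_telescope[of "\<lambda>k. g k x"])
    finally show "convergent (\<lambda>k. g k x)" .
  qed
  define h where "h x = lim (\<lambda>k. g k x)" for x
  have [measurable]: "h \<in> borel_measurable lborel"
    unfolding h_def[abs_def] by (rule borel_measurable_lim_metric) measurable
  have key: "(\<integral>\<^sup>+x. ennreal ((norm (h x - f n x))\<^sup>2) \<partial>lborel) \<le> ennreal (((1/2) ^ j)\<^sup>2)"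
    if "N j \<le> n" for n j
  proof -
    have "AE x in lborel. ennreal ((norm (h x - f n x))\<^sup>2) = liminf (\<lambda>k. ennreal ((norm (g k x - f n x))\<^sup>2))"
      using conv
    proof (rule eventually_mono)
      fix x
      assume "convergent (\<lambda>k. g k x)"
      then have "(\<lambda>k. g k x) \<longlonglongrightarrow> h x"
        by (simp add: h_def convergent_LIMSEQ_iff)
      then have "(\<lambda>k. ennreal ((norm (g k x - f n x))\<^sup>2)) \<longlonglongrightarrow> ennreal ((norm (h x - f n x))\<^sup>2)"
        by (intro tendsto_intros)
      then show "ennreal ((norm (h x - f n x))\<^sup>2) = liminf (\<lambda>k. ennreal ((norm (g k x - f n x))\<^sup>2))"
        by (intro lim_imp_Liminf[symmetric]) auto
    qed
    then have "(\<integral>\<^sup>+x. ennreal ((norm (h x - f n x))\<^sup>2) \<partial>lborel)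
        = (\<integral>\<^sup>+x. liminf (\<lambda>k. ennreal ((norm (g k x - f n x))\<^sup>2)) \<partial>lborel)"
      by (rule nn_integral_cong_AE)
    also have "\<dots> \<le> liminf (\<lambda>k. \<integral>\<^sup>+x. ennreal ((norm (g k x - f n x))\<^sup>2) \<partial>lborel)"
      by (rule nn_integral_liminf) measurable
    also have "\<dots> \<le> limsup (\<lambda>k. \<integral>\<^sup>+x. ennreal ((norm (g k x - f n x))\<^sup>2) \<partial>lborel)"
      by (rule Liminf_le_Limsup) simp
    also have "\<dots> \<le> ennreal (((1/2) ^ j)\<^sup>2)"
    proof (rule Limsup_bounded)
      show "\<forall>\<^sub>F k in sequentially. (\<integral>\<^sup>+x. ennreal ((norm (g k x - f n x))\<^sup>2) \<partial>lborel) \<le> ennreal (((1/2) ^ j)\<^sup>2)"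
        using eventually_ge_at_top[of "N j"]
      proof (rule eventually_mono)
        fix k assume "N j \<le> k"
        then have "N j \<le> r k" using r(3)[of k] by simp
        then show "(\<integral>\<^sup>+x. ennreal ((norm (g k x - f n x))\<^sup>2) \<partial>lborel) \<le> ennreal (((1/2) ^ j)\<^sup>2)"
          unfolding g_def X_diff using N[of j "r k" n] that by (intro ennreal_leI power_mono) auto
      qed
    qed
    finally show ?thesis .
  qed
  have sq_diff: "square_integrable (\<lambda>x. h x - f n x)" if "N j \<le> n" for n j
    using le_less_trans[OF key[OF that] ennreal_less_top]
    by (intro square_integrableI_nn_integral) simp_all
  have sq_h: "square_integrable h"
    using square_integrable_add[OF sq_diff[OF order_refl[of "N 0"]] sq[of "N 0"]] by simp
  have "X \<longlonglongrightarrow> l2_class h"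
  proof (rule LIMSEQ_I)
    fix e :: real assume "0 < e"
    then obtain j where j: "(1/2 :: real) ^ j < e"
      using real_arch_pow_inv[of e "1/2"] by auto
    show "\<exists>n0. \<forall>n\<ge>n0. norm (X n - l2_class h) < e"
    proof (intro exI allI impI)
      fix n assume n: "N j \<le> n"
      have "ennreal ((norm (l2_class h - X n))\<^sup>2) \<le> ennreal (((1/2) ^ j)\<^sup>2)"
        using key[OF n] unfolding nn_integral_l2_class[OF sq_diff[OF n]] l2_class_diff[OF sq_h sq] X .
      then have "norm (l2_class h - X n) \<le> (1/2) ^ j"
        by (simp add: ennreal_le_iff power2_le_iff_abs_le)
      then show "norm (X n - l2_class h) < e"
        using j by (simp add: norm_minus_commute)
    qed
  qed
  then show "convergent X" by (rule convergentI)
qed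

lemma l2_class_dominated_convergence:
  assumes sq: "\<And>n. square_integrable (s n)" "square_integrable f"
    and lim: "\<And>x. (\<lambda>n. s n x) \<longlonglongrightarrow> f x"
    and w: "integrable lborel w" "\<And>n x. (norm (s n x - f x))\<^sup>2 \<le> w x"
  shows "(\<lambda>n. l2_class (s n)) \<longlonglongrightarrow> l2_class f"
proof -
  have [measurable]: "s n \<in> borel_measurable lborel" "f \<in> borel_measurable lborel" for n
    using sq by (auto simp: square_integrable_def)
  have "(\<lambda>n. LINT x|lborel. (norm (s n x - f x))\<^sup>2) \<longlonglongrightarrow> (LINT x|(lborel :: real measure). (0::real))"
  proof (rule integral_dominated_convergence[where w=w and M=lborel and s="\<lambda>n x. (norm (s n x - f x))\<^sup>2" and f="\<lambda>_. 0::real"])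
    show "AE x in lborel. (\<lambda>n. (norm (s n x - f x))\<^sup>2) \<longlonglongrightarrow> 0"
    proof (rule AE_I2)
      fix x
      have "(\<lambda>n. (norm (s n x - f x))\<^sup>2) \<longlonglongrightarrow> (norm (f x - f x))\<^sup>2"
        by (rule tendsto_power[OF tendsto_norm[OF tendsto_diff[OF lim tendsto_const]]])
      then show "(\<lambda>n. (norm (s n x - f x))\<^sup>2) \<longlonglongrightarrow> 0" by simp
    qed
    show "AE x in lborel. norm ((norm (s n x - f x))\<^sup>2) \<le> w x" for n
      by (rule AE_I2) (simp add: w(2))
  qed (measurable, rule w(1))
  then have "(\<lambda>n. (norm (l2_class (s n) - l2_class f))\<^sup>2) \<longlonglongrightarrow> 0"
    by (simp add: l2_class_diff[symmetric] norm_l2_class sq square_integrable_diff)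
  then have "(\<lambda>n. sqrt ((norm (l2_class (s n) - l2_class f))\<^sup>2)) \<longlonglongrightarrow> sqrt 0"
    by (rule tendsto_real_sqrt)
  then have "(\<lambda>n. norm (l2_class (s n) - l2_class f)) \<longlonglongrightarrow> 0"
    by simp
  then show ?thesis
    by (simp add: LIM_zero_iff tendsto_norm_zero_iff)
qed

lemma square_integrable_indicator:
  assumes "A \<in> sets borel" "emeasure lborel A < \<infinity>"
  shows "square_integrable (\<lambda>x. indicator A x *\<^sub>R v)"
proof -
  have "integrable lborel (\<lambda>x. (norm v)\<^sup>2 * indicator A x)"
    using assms by (intro integrable_mult_right integrable_real_indicator) auto
  also have "(\<lambda>x. (norm v)\<^sup>2 * indicator A x) = (\<lambda>x. (norm (indicator A x *\<^sub>R v))\<^sup>2)"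
    by (auto simp: indicator_def)
  finally show ?thesis
    using assms(1) by (simp add: square_integrable_def)
qed

lemma l2_countable_dense: "\<exists>D :: 'a::euclidean_space l2 set. countable D \<and> closure D = UNIV"
proof -
  obtain B :: "real set set" where B: "countable B" "topological_basis B"
    using ex_countable_basis by auto
  obtain Q :: "'a set" where Q: "countable Q" "\<And>X. open X \<Longrightarrow> X \<noteq> {} \<Longrightarrow> \<exists>q\<in>Q. q \<in> X"
    by (rule countable_dense_setE) blast
  define U where "U = Union ` {F. F \<subseteq> B \<and> finite F}"
  define S where "S = (\<lambda>(A, q). l2_class (\<lambda>x. indicator A x *\<^sub>R q)) ` (U \<times> Q)"
  define D where "D = sum_list ` lists S"
  have "countable U"
    unfolding U_def using countable_Collect_finite_subset[OF B(1)] by (simp add: conj_commute)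
  then have "countable D"
    unfolding D_def S_def using Q(1) by (intro countable_image countable_lists countable_SIGMA)
  have open_U: "open A" if "A \<in> U" for A
    using that topological_basis_open[OF B(2)] unfolding U_def by (auto intro!: open_Union)
  have S_sub: "S \<subseteq> D"
    unfolding D_def by (force intro!: image_eqI[where x="[_]"])
  have lim: "y \<in> closure D" if "\<And>n::nat. x n \<in> closure D" "x \<longlonglongrightarrow> y" for x y
    using closed_sequentially[OF closed_closure] that by blast
  have add: "x + y \<in> closure D" if "x \<in> closure D" "y \<in> closure D" for x y
  proof -
    obtain u v where "\<And>n. u n \<in> D" "u \<longlonglongrightarrow> x" "\<And>n. v n \<in> D" "v \<longlonglongrightarrow> y"
      using \<open>x \<in> closure D\<close> \<open>y \<in> closure D\<close> unfolding closure_sequential by blast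
    moreover have "a + b \<in> D" if "a \<in> D" "b \<in> D" for a b
      using that unfolding D_def by (force intro!: image_eqI[where x="_ @ _"])
    ultimately show ?thesis
      using closure_sequential[of "x + y" D] by (metis (no_types, lifting) tendsto_add)
  qed
  have zero: "0 \<in> closure D"
    using closure_subset[of D] unfolding D_def by (force intro!: image_eqI[where x="[]"])
  have ind_U: "l2_class (\<lambda>x. indicator A x *\<^sub>R v) \<in> closure D" if "A \<in> U" "emeasure lborel A < \<infinity>" for A v
  proof -
    have A: "A \<in> sets borel" using open_U[OF that(1)] by simp
    have "\<exists>q\<in>Q. q \<in> ball v (1 / Suc n)" for n
      by (rule Q(2)) auto
    then obtain q where q: "\<And>n. q n \<in> Q" "\<And>n. dist v (q n) < 1 / Suc n"
      by (metis mem_ball)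
    have "(\<lambda>n. dist (q n) v) \<longlonglongrightarrow> 0"
      by (rule tendsto_sandwich[OF _ _ tendsto_const LIMSEQ_Suc[OF lim_1_over_n]])
        (use q(2) in \<open>auto intro!: always_eventually less_imp_le simp: dist_commute\<close>)
    then have qv: "q \<longlonglongrightarrow> v" using tendsto_dist_iff by blast
    have "(\<lambda>n. l2_class (\<lambda>x. indicator A x *\<^sub>R q n)) \<longlonglongrightarrow> l2_class (\<lambda>x. indicator A x *\<^sub>R v)"
    proof (rule l2_class_dominated_convergence[where w="indicator A"])
      show "(norm (indicator A x *\<^sub>R q n - indicator A x *\<^sub>R v))\<^sup>2 \<le> indicator A x" for n x
      proof -
        have "norm (q n - v) < 1 / Suc n"
          using q(2)[of n] by (simp add: dist_norm norm_minus_commute)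
        also have "\<dots> \<le> 1" by simp
        finally have "(norm (q n - v))\<^sup>2 \<le> 1"
          by (intro power_le_one) auto
        then show ?thesis by (auto simp: indicator_def)
      qed
      show "integrable lborel (indicator A :: real \<Rightarrow> real)"
        using A that(2) by (intro integrable_real_indicator) auto
      show "(\<lambda>n. indicator A x *\<^sub>R q n) \<longlonglongrightarrow> indicator A x *\<^sub>R v" for x
        by (rule tendsto_scaleR[OF tendsto_const qv])
    qed (rule square_integrable_indicator[OF A that(2)])+
    moreover have "l2_class (\<lambda>x. indicator A x *\<^sub>R q n) \<in> closure D" for n
    proof -
      have "l2_class (\<lambda>x. indicator A x *\<^sub>R q n) \<in> S"
        unfolding S_def by (rule image_eqI[where x="(A, q n)"]) (simp_all add: that(1) q(1))
      then show ?thesis using S_sub closure_subset by blast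
    qed
    ultimately show ?thesis by (rule lim[rotated])
  qed
  have ind_open: "l2_class (\<lambda>x. indicator A x *\<^sub>R v) \<in> closure D" if "open A" "emeasure lborel A < \<infinity>" for A v
  proof -
    obtain B' where B': "B' \<subseteq> B" "A = \<Union>B'"
      using B(2) \<open>open A\<close> unfolding topological_basis_def by metis
    show ?thesis
    proof (cases "B' = {}")
      case True
      then show ?thesis using B' zero by (simp add: l2_class_zero)
    next
      case False
      have cB: "countable B'" using B' B(1) countable_subset by blast
      define V where "V n = (\<Union>i<n. from_nat_into B' i)" for n
      have sub: "V n \<subseteq> A" for n
        using from_nat_into[OF False] unfolding V_def B' by blast
      have VU: "V n \<in> U" for n
        unfolding V_def U_def using from_nat_into[OF False] B'(1) by (intro image_eqI[OF refl]) auto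
      have fin: "emeasure lborel (V n) < \<infinity>" for n
        using emeasure_mono[OF sub[of n], of lborel] that by (auto intro: le_less_trans)
      have ev: "(\<lambda>n. indicator (V n) x *\<^sub>R v) \<longlonglongrightarrow> indicator A x *\<^sub>R v" for x
      proof (cases "x \<in> A")
        case True
        then obtain i where i: "x \<in> from_nat_into B' i"
          using B'(2) from_nat_into_surj[OF cB] by blast
        have "\<forall>\<^sub>F n in sequentially. indicator (V n) x *\<^sub>R v = indicator A x *\<^sub>R v"
          using eventually_gt_at_top[of i]
        proof (rule eventually_mono)
          fix n assume "i < n"
          then have "x \<in> V n" using i by (auto simp: V_def)
          then show "indicator (V n) x *\<^sub>R v = indicator A x *\<^sub>R v" using True by simp
        qed
        then show ?thesis by (rule tendsto_eventually)
      next
        case False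
        then have "x \<notin> V n" for n using sub by blast
        with False show ?thesis by simp
      qed
      have "(\<lambda>n. l2_class (\<lambda>x. indicator (V n) x *\<^sub>R v)) \<longlonglongrightarrow> l2_class (\<lambda>x. indicator A x *\<^sub>R v)"
      proof (rule l2_class_dominated_convergence[where w="\<lambda>x. (norm v)\<^sup>2 * indicator A x"])
        show "integrable lborel (\<lambda>x. (norm v)\<^sup>2 * indicator A x)"
          using that by (intro integrable_mult_right integrable_real_indicator) auto
        show "(norm (indicator (V n) x *\<^sub>R v - indicator A x *\<^sub>R v))\<^sup>2 \<le> (norm v)\<^sup>2 * indicator A x" for n x
          using sub[of n] by (auto simp: indicator_def)
      qed (rule ev square_integrable_indicator borel_open that fin open_U[OF VU])+
      then show ?thesis by (rule lim[OF ind_U[OF VU fin]])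
    qed
  qed
  have ind: "l2_class (\<lambda>x. indicator A x *\<^sub>R v) \<in> closure D"
    if A: "A \<in> sets borel" "emeasure lborel A < \<infinity>" for A v
  proof -
    have "\<exists>G. open G \<and> A \<subseteq> G \<and> emeasure lborel (G - A) < ennreal (1 / Suc n)" for n
      by (rule outer_regular_lborel[OF A(1), of "1 / Suc n"]) auto
    then obtain V where V: "\<And>n. open (V n)" "\<And>n. A \<subseteq> V n"
        "\<And>n. emeasure lborel (V n - A) < ennreal (1 / Suc n)"
      by metis
    have diff: "emeasure lborel (V n - A) < \<infinity>" for n
      using V(3)[of n] by (auto intro: less_trans)
    have fin: "emeasure lborel (V n) < \<infinity>" for n
    proof -
      have "emeasure lborel (V n) \<le> emeasure lborel A + emeasure lborel (V n - A)"
        using emeasure_subadditive[of A lborel "V n - A"] A V(1)[of n] V(2)[of n]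
        by (auto simp: Un_absorb1)
      also have "\<dots> < \<infinity>" using A(2) diff[of n] by simp
      finally show ?thesis .
    qed
    have meas: "measure lborel (V n - A) \<le> 1 / Suc n" for n
      using V(3)[of n] diff[of n] by (auto simp: measure_def enn2real_leI less_imp_le)
    have sq: "(norm (l2_class (\<lambda>x. indicator (V n) x *\<^sub>R v) - l2_class (\<lambda>x. indicator A x *\<^sub>R v)))\<^sup>2
        = (norm v)\<^sup>2 * measure lborel (V n - A)" for n
    proof -
      have "(\<lambda>x. (norm (indicator (V n) x *\<^sub>R v - indicator A x *\<^sub>R v))\<^sup>2) = (\<lambda>x. (norm v)\<^sup>2 * indicator (V n - A) x)"
        using V(2)[of n] by (auto simp: fun_eq_iff indicator_def)
      then show ?thesis
        using A V(1)[of n] fin[of n]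
        by (subst l2_class_diff[symmetric])
          (auto simp: norm_l2_class square_integrable_diff square_integrable_indicator)
    qed
    have "(\<lambda>n. measure lborel (V n - A)) \<longlonglongrightarrow> 0"
      by (rule tendsto_sandwich[OF _ _ tendsto_const LIMSEQ_Suc[OF lim_1_over_n]])
        (simp_all only: meas measure_nonneg eventually_True)
    from tendsto_mult[OF tendsto_const this, of "(norm v)\<^sup>2"]
    have "(\<lambda>n. (norm v)\<^sup>2 * measure lborel (V n - A)) \<longlonglongrightarrow> 0"
      by simp
    then have "(\<lambda>n. sqrt ((norm (l2_class (\<lambda>x. indicator (V n) x *\<^sub>R v) - l2_class (\<lambda>x. indicator A x *\<^sub>R v)))\<^sup>2)) \<longlonglongrightarrow> sqrt 0"
      unfolding sq by (rule tendsto_real_sqrt)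
    then have "(\<lambda>n. l2_class (\<lambda>x. indicator (V n) x *\<^sub>R v)) \<longlonglongrightarrow> l2_class (\<lambda>x. indicator A x *\<^sub>R v)"
      by (simp add: LIM_zero_iff tendsto_norm_zero_iff)
    then show ?thesis by (rule lim[OF ind_open[OF V(1) fin]])
  qed
  have "y \<in> closure D" for y :: "'a l2"
  proof -
    obtain f where f: "square_integrable f" "y = l2_class f" by (rule l2_exhaust)
    have fm: "f \<in> borel_measurable lborel" using f by (simp add: square_integrable_def)
    obtain s where s: "\<And>i. simple_function lborel (s i)" "\<And>x. (\<lambda>i. s i x) \<longlonglongrightarrow> f x"
        "\<And>i x. norm (s i x) \<le> 2 * norm (f x)"
      using borel_measurable_implies_sequence_metric[OF fm, of 0] by (auto simp: dist_norm)
    have sm: "s i \<in> borel_measurable lborel" for i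
      using s(1) by (rule borel_measurable_simple_function)
    have f2: "integrable lborel (\<lambda>x. (norm (f x))\<^sup>2)" using f(1) by (simp add: square_integrable_def)
    have sqs: "square_integrable (s i)" for i
    proof -
      have "integrable lborel (\<lambda>x. (norm (s i x))\<^sup>2)"
      proof (rule Bochner_Integration.integrable_bound)
        show "integrable lborel (\<lambda>x. 4 * (norm (f x))\<^sup>2)" using f2 by simp
        show "(\<lambda>x. (norm (s i x))\<^sup>2) \<in> borel_measurable lborel" using sm[of i] by measurable
        show "AE x in lborel. norm ((norm (s i x))\<^sup>2) \<le> norm (4 * (norm (f x))\<^sup>2)"
        proof (rule AE_I2)
          fix x
          have "(norm (s i x))\<^sup>2 \<le> (2 * norm (f x))\<^sup>2"
            by (rule power_mono[OF s(3) norm_ge_zero])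
          then show "norm ((norm (s i x))\<^sup>2) \<le> norm (4 * (norm (f x))\<^sup>2)"
            by (simp add: power_mult_distrib)
        qed
      qed
      with sm show ?thesis by (simp add: square_integrable_def)
    qed
    have "(\<lambda>i. l2_class (s i)) \<longlonglongrightarrow> l2_class f"
    proof (rule l2_class_dominated_convergence[where w="\<lambda>x. 9 * (norm (f x))\<^sup>2"])
      show "(norm (s i x - f x))\<^sup>2 \<le> 9 * (norm (f x))\<^sup>2" for i x
      proof -
        have "norm (s i x - f x) \<le> 3 * norm (f x)"
          using norm_triangle_ineq4[of "s i x" "f x"] s(3)[of i x] by simp
        then have "(norm (s i x - f x))\<^sup>2 \<le> (3 * norm (f x))\<^sup>2"
          by (intro power_mono) auto
        then show ?thesis by (simp add: power_mult_distrib)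
      qed
      show "integrable lborel (\<lambda>x. 9 * (norm (f x))\<^sup>2)" using f2 by simp
    qed (rule sqs f(1) s(2))+
    moreover have "l2_class (s i) \<in> closure D" for i
    proof -
      define A where "A v = s i -` {v}" for v
      have Am: "A v \<in> sets borel" for v
        using measurable_sets[OF sm[of i], of "{v}"] by (simp add: A_def)
      have Af: "emeasure lborel (A v) < \<infinity>" if "v \<noteq> 0" for v
      proof -
        have "integrable lborel (\<lambda>x. (norm (s i x))\<^sup>2)" using sqs by (simp add: square_integrable_def)
        then have "integrable lborel (\<lambda>x. (norm v)\<^sup>2 * indicator (A v) x)"
        proof (rule Bochner_Integration.integrable_bound)
          show "(\<lambda>x. (norm v)\<^sup>2 * indicator (A v) x) \<in> borel_measurable lborel" using Am by measurable
        qed (auto simp: A_def indicator_def)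
        then have "integrable lborel (indicator (A v) :: real \<Rightarrow> real)"
          using that by simp
        then show ?thesis using Am by (simp add: integrable_indicator_iff)
      qed
      have fin: "finite (range (s i))" using s(1)[of i] by (simp add: simple_function_def)
      have part: "square_integrable (\<lambda>x. \<Sum>v\<in>G. indicator (A v) x *\<^sub>R v) \<and>
          l2_class (\<lambda>x. \<Sum>v\<in>G. indicator (A v) x *\<^sub>R v) \<in> closure D" if "finite G" for G
        using that
      proof induction
        case empty
        then show ?case by (simp add: square_integrable_0 l2_class_zero zero)
      next
        case (insert v G)
        then have IH: "square_integrable (\<lambda>x. \<Sum>v\<in>G. indicator (A v) x *\<^sub>R v)"
            "l2_class (\<lambda>x. \<Sum>v\<in>G. indicator (A v) x *\<^sub>R v) \<in> closure D"
          by blast+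
        have eq: "(\<lambda>x. \<Sum>w\<in>insert v G. indicator (A w) x *\<^sub>R w)
            = (\<lambda>x. indicator (A v) x *\<^sub>R v + (\<Sum>w\<in>G. indicator (A w) x *\<^sub>R w))"
          by (simp only: sum.insert[OF insert.hyps])
        show ?case
        proof (cases "v = 0")
          case True
          show ?thesis
            unfolding eq unfolding True scaleR_zero_right add_0_left using IH by (rule conjI)
        next
          case False
          note sqv = square_integrable_indicator[OF Am Af[OF False], of v]
          show ?thesis
            unfolding eq l2_class_add[OF sqv IH(1)]
            using square_integrable_add[OF sqv IH(1)] add[OF ind[OF Am Af[OF False]] IH(2)]
            by (rule conjI)
        qed
      qed
      have "(\<lambda>x. \<Sum>v\<in>range (s i). indicator (A v) x *\<^sub>R v) = s i"
      proof
        fix x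
        have "(\<Sum>v\<in>range (s i). indicator (A v) x *\<^sub>R v) = (\<Sum>v\<in>range (s i). if v = s i x then v else 0)"
          by (intro sum.cong) (auto simp: A_def indicator_def)
        also have "\<dots> = s i x" using fin by (simp add: sum.delta)
        finally show "(\<Sum>v\<in>range (s i). indicator (A v) x *\<^sub>R v) = s i x" .
      qed
      then show ?thesis using conjunct2[OF part[OF fin]] by (simp only:)
    qed
    ultimately show ?thesis unfolding f(2) by (rule lim[rotated])
  qed
  with \<open>countable D\<close> show ?thesis by auto
qed

instance l2 :: (euclidean_space) second_countable_topology
proof
  obtain D :: "'a l2 set" where D: "countable D" "closure D = UNIV"
    using l2_countable_dense by blast
  define B where "B = (\<lambda>(d, n). ball d (1 / real (Suc n))) ` (D \<times> UNIV)"
  have "topological_basis B"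
  proof (rule topological_basisI)
    fix V and x :: "'a l2"
    assume "open V" "x \<in> V"
    then obtain e where e: "0 < e" "ball x e \<subseteq> V" by (rule openE)
    obtain n where n: "1 / real (Suc n) < e / 2"
      using e(1) nat_approx_posE[of "e / 2"] by auto
    have "x \<in> closure D" using D by simp
    then obtain d where d: "d \<in> D" "dist d x < 1 / real (Suc n)"
      unfolding closure_approachable by (meson of_nat_0_less_iff zero_less_Suc zero_less_divide_1_iff)
    have "ball d (1 / real (Suc n)) \<subseteq> ball x e"
    proof
      fix y assume "y \<in> ball d (1 / real (Suc n))"
      then have "dist x y < e"
        using d(2) n dist_triangle[of x y d] by (simp add: dist_commute)
      then show "y \<in> ball x e" by simp
    qed
    then show "\<exists>B'\<in>B. x \<in> B' \<and> B' \<subseteq> V"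
      using d e unfolding B_def by (intro bexI[of _ "ball d (1 / real (Suc n))"]) auto
  qed (auto simp: B_def)
  moreover have "countable B"
    unfolding B_def using D(1) by (intro countable_image countable_SIGMA) auto
  ultimately show "\<exists>B :: 'a l2 set set. countable B \<and> open = generate_topology B"
    using topological_basis_imp_subbasis by blast
qed

section \<open>Stochastic basis\<close>

definition usual_filtration :: "'a measure \<Rightarrow> real \<Rightarrow> (real \<Rightarrow> 'a measure) \<Rightarrow> bool" where
  "usual_filtration M T F \<longleftrightarrow>
    (\<forall>t\<in>{0..T}. subalgebra M (F t)) \<and>
    (\<forall>s\<in>{0..T}. \<forall>t\<in>{s..T}. sets (F s) \<subseteq> sets (F t)) \<and>
    null_sets M \<subseteq> sets (F 0) \<and>
    (\<forall>t\<in>{0..<T}. sets (F t) = (\<Inter>s\<in>{t<..T}. sets (F s)))"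

text \<open>The filtration is indexed by $[0,T]$ while the Brownian motion lives on $[0,\infty)$. The last
  two conditions say that it is a Brownian motion with respect to the filtration.\<close>

definition brownian_motion ::
  "'a measure \<Rightarrow> real \<Rightarrow> (real \<Rightarrow> 'a measure) \<Rightarrow> (real \<Rightarrow> 'a \<Rightarrow> real ^ 'd) \<Rightarrow> bool" where
  "brownian_motion M T F W \<longleftrightarrow>
    (\<forall>t\<ge>0. W t \<in> borel_measurable M) \<and>
    (AE \<omega> in M. W 0 \<omega> = 0) \<and>
    (AE \<omega> in M. continuous_on {0..} (\<lambda>t. W t \<omega>)) \<and>
    (\<forall>s\<ge>0. \<forall>t>s.
      prob_space.indep_vars M (\<lambda>_. borel) (\<lambda>i \<omega>. (W t \<omega> - W s \<omega>) $ i) UNIV \<and>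
      (\<forall>i. distributed M lborel (\<lambda>\<omega>. (W t \<omega> - W s \<omega>) $ i) (normal_density 0 (sqrt (t - s))))) \<and>
    (\<forall>s\<ge>0. \<forall>t\<ge>s. prob_space.indep_set M
      (sigma_sets (space M) {W u -` A \<inter> space M |u A. u \<in> {0..s} \<and> A \<in> sets borel})
      (sets (vimage_algebra (space M) (\<lambda>\<omega>. W t \<omega> - W s \<omega>) borel))) \<and>
    (\<forall>t\<in>{0..T}. W t \<in> borel_measurable (F t)) \<and>
    (\<forall>s\<in>{0..T}. \<forall>t\<ge>s. prob_space.indep_set M
      (sets (F s)) (sets (vimage_algebra (space M) (\<lambda>\<omega>. W t \<omega> - W s \<omega>) borel)))"

section \<open>The stochastic integral with values in a separable Hilbert space\<close>

definition hilbert_schmidt_norm :: "((real ^ 'd) \<Rightarrow>\<^sub>L 'h::real_inner) \<Rightarrow> real" where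
  "hilbert_schmidt_norm A = sqrt (\<Sum>e\<in>Basis. (norm (blinfun_apply A e))\<^sup>2)"

text \<open>An elementary integrand on $[0,t]$ equals $A_i$ on $(\tau_i,\tau_{i+1}]$ for $i<n$, where $A_i$
  takes finitely many values and is measurable with respect to the filtration at time $\tau_i$.\<close>

definition elementary_integrand ::
  "(real \<Rightarrow> 'a measure) \<Rightarrow> real \<Rightarrow> nat \<Rightarrow> (nat \<Rightarrow> real) \<Rightarrow>
    (nat \<Rightarrow> 'a \<Rightarrow> (real ^ 'd) \<Rightarrow>\<^sub>L 'h::real_inner) \<Rightarrow> bool" where
  "elementary_integrand F t n \<tau> A \<longleftrightarrow>
    0 \<le> \<tau> 0 \<and> (\<forall>i<n. \<tau> i \<le> \<tau> (Suc i)) \<and> \<tau> n \<le> t \<and> (\<forall>i<n. simple_function (F (\<tau> i)) (A i))"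

definition elementary_process ::
  "nat \<Rightarrow> (nat \<Rightarrow> real) \<Rightarrow> (nat \<Rightarrow> 'a \<Rightarrow> (real ^ 'd) \<Rightarrow>\<^sub>L 'h::real_inner) \<Rightarrow>
    real \<Rightarrow> 'a \<Rightarrow> (real ^ 'd) \<Rightarrow>\<^sub>L 'h" where
  "elementary_process n \<tau> A s \<omega> = (\<Sum>i<n. indicator {\<tau> i<..\<tau> (Suc i)} s *\<^sub>R A i \<omega>)"

definition elementary_integral ::
  "(real \<Rightarrow> 'a \<Rightarrow> real ^ 'd) \<Rightarrow> nat \<Rightarrow> (nat \<Rightarrow> real) \<Rightarrow>
    (nat \<Rightarrow> 'a \<Rightarrow> (real ^ 'd) \<Rightarrow>\<^sub>L 'h::real_inner) \<Rightarrow> 'a \<Rightarrow> 'h" where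
  "elementary_integral W n \<tau> A \<omega> = (\<Sum>i<n. blinfun_apply (A i \<omega>) (W (\<tau> (Suc i)) \<omega> - W (\<tau> i) \<omega>))"

text \<open>\<open>Z\<close> is a version of the Ito integral of \<open>\<Phi>\<close> over $[0,t]$: there are elementary integrands
  converging to \<open>\<Phi>\<close> in the $L^2$-space of Hilbert-Schmidt-valued processes whose elementary integrals
  converge to \<open>Z\<close> in mean square.\<close>

definition has_ito_integral ::
  "'a measure \<Rightarrow> (real \<Rightarrow> 'a measure) \<Rightarrow> (real \<Rightarrow> 'a \<Rightarrow> real ^ 'd) \<Rightarrow> real \<Rightarrow>
    (real \<Rightarrow> 'a \<Rightarrow> (real ^ 'd) \<Rightarrow>\<^sub>L 'h::{real_inner, banach, second_countable_topology}) \<Rightarrow>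
    ('a \<Rightarrow> 'h) \<Rightarrow> bool" where
  "has_ito_integral M F W t \<Phi> Z \<longleftrightarrow>
    (\<forall>x. (\<lambda>(s, \<omega>). blinfun_apply (\<Phi> s \<omega>) x) \<in> borel_measurable (restrict_space lborel {0..t} \<Otimes>\<^sub>M M)) \<and>
    Z \<in> borel_measurable M \<and>
    (\<exists>n \<tau> A. (\<forall>k. elementary_integrand F t (n k) (\<tau> k) (A k)) \<and>
      (\<lambda>k. \<integral>\<^sup>+\<omega>. (\<integral>\<^sup>+s\<in>{0..t}.
        ennreal ((hilbert_schmidt_norm (\<Phi> s \<omega> - elementary_process (n k) (\<tau> k) (A k) s \<omega>))\<^sup>2) \<partial>lborel) \<partial>M)
        \<longlonglongrightarrow> 0 \<and>
      (\<lambda>k. \<integral>\<^sup>+\<omega>. ennreal ((norm (Z \<omega> - elementary_integral W (n k) (\<tau> k) (A k) \<omega>))\<^sup>2) \<partial>M) \<longlonglongrightarrow> 0)"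

definition ito_integrable ::
  "'a measure \<Rightarrow> (real \<Rightarrow> 'a measure) \<Rightarrow> (real \<Rightarrow> 'a \<Rightarrow> real ^ 'd) \<Rightarrow> real \<Rightarrow>
    (real \<Rightarrow> 'a \<Rightarrow> (real ^ 'd) \<Rightarrow>\<^sub>L 'h::{real_inner, banach, second_countable_topology}) \<Rightarrow> bool" where
  "ito_integrable M F W t \<Phi> \<longleftrightarrow> (\<exists>Z. has_ito_integral M F W t \<Phi> Z)"

definition ito_integral ::
  "'a measure \<Rightarrow> (real \<Rightarrow> 'a measure) \<Rightarrow> (real \<Rightarrow> 'a \<Rightarrow> real ^ 'd) \<Rightarrow> real \<Rightarrow>
    (real \<Rightarrow> 'a \<Rightarrow> (real ^ 'd) \<Rightarrow>\<^sub>L 'h::{real_inner, banach, second_countable_topology}) \<Rightarrow>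
    'a \<Rightarrow> 'h" where
  "ito_integral M F W t \<Phi> = (SOME Z. has_ito_integral M F W t \<Phi> Z)"

section \<open>The stochastic Volterra equation\<close>

definition fractional_kernel :: "real \<Rightarrow> real \<Rightarrow> real" where
  "fractional_kernel \<alpha> t = t powr (\<alpha> - 1) / Gamma \<alpha>"

definition volterra_solution ::
  "'a measure \<Rightarrow> (real \<Rightarrow> 'a measure) \<Rightarrow> (real \<Rightarrow> 'a \<Rightarrow> real ^ 'd) \<Rightarrow> real \<Rightarrow> real ^ 'd \<Rightarrow>
    (real \<Rightarrow> real ^ 'd \<Rightarrow> real ^ 'd) \<Rightarrow> (real \<Rightarrow> real) \<Rightarrow> (real \<Rightarrow> real) \<Rightarrow>
    (real \<Rightarrow> 'a \<Rightarrow> real ^ 'd) \<Rightarrow> bool" where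
  "volterra_solution M F W T x0 b k1 k2 X \<longleftrightarrow>
    (\<forall>t\<in>{0..T}. X t \<in> borel_measurable (F t)) \<and>
    (AE \<omega> in M. continuous_on {0..T} (\<lambda>t. X t \<omega>)) \<and>
    (\<forall>t\<in>{0..T}. AE \<omega> in M.
      X t \<omega> = x0 + (LINT s:{0..t}|lborel. k1 (t - s) *\<^sub>R b s (X s \<omega>))
        + ito_integral M F W t (\<lambda>s _. k2 (t - s) *\<^sub>R id_blinfun) \<omega>)"

text \<open>\<open>J t \<xi>\<close> stands for the chosen version of the stochastic integral of $k_2(\xi-\cdot)$ over
  $[0,t]$.\<close>

definition volterra_theta ::
  "real ^ 'd \<Rightarrow> (real \<Rightarrow> real ^ 'd \<Rightarrow> real ^ 'd) \<Rightarrow> (real \<Rightarrow> real) \<Rightarrow> (real \<Rightarrow> 'a \<Rightarrow> real ^ 'd) \<Rightarrow>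
    (real \<Rightarrow> real \<Rightarrow> 'a \<Rightarrow> real ^ 'd) \<Rightarrow> real \<Rightarrow> 'a \<Rightarrow> real \<Rightarrow> real ^ 'd" where
  "volterra_theta x0 b k1 X J t \<omega> \<xi> =
    x0 + (LINT s:{0..t}|lborel. k1 (\<xi> - s) *\<^sub>R b s (X s \<omega>)) + J t \<xi> \<omega>"

definition volterra_path ::
  "real ^ 'd \<Rightarrow> (real \<Rightarrow> real ^ 'd \<Rightarrow> real ^ 'd) \<Rightarrow> (real \<Rightarrow> real) \<Rightarrow> (real \<Rightarrow> 'a \<Rightarrow> real ^ 'd) \<Rightarrow>
    (real \<Rightarrow> real \<Rightarrow> 'a \<Rightarrow> real ^ 'd) \<Rightarrow> real \<Rightarrow> 'a \<Rightarrow> real \<Rightarrow> real ^ 'd" where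
  "volterra_path x0 b k1 X J t \<omega> \<xi> =
    (if \<xi> \<le> t then X \<xi> \<omega> else volterra_theta x0 b k1 X J t \<omega> \<xi>)"

section \<open>The lifted equation\<close>

text \<open>$L^2(0,T;\mathbb{R}^d)$ is identified with the closed subspace of those classes on the real line
  that vanish outside $[0,T]$: \<open>l2_on T f\<close> is the class of the restriction of \<open>f\<close> to $[0,T]$, extended
  by zero.\<close>

definition l2_on :: "real \<Rightarrow> (real \<Rightarrow> 'a::euclidean_space) \<Rightarrow> 'a l2" where
  "l2_on T f = l2_class (\<lambda>\<xi>. if \<xi> \<in> {0..T} then f \<xi> else 0)"

definition lifted_drift ::
  "real \<Rightarrow> (real \<Rightarrow> real) \<Rightarrow> (real \<Rightarrow> real ^ 'd \<Rightarrow> real ^ 'd) \<Rightarrow>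
    real \<Rightarrow> (real \<Rightarrow> real ^ 'd) \<Rightarrow> (real ^ 'd) l2" where
  "lifted_drift T k1 b t w = l2_on T (\<lambda>\<xi>. if t < \<xi> then k1 (\<xi> - t) *\<^sub>R b t (w t) else 0)"

definition lifted_diffusion ::
  "real \<Rightarrow> (real \<Rightarrow> real) \<Rightarrow> real \<Rightarrow> (real ^ 'd) \<Rightarrow>\<^sub>L (real ^ 'd) l2" where
  "lifted_diffusion T k2 t = Blinfun (\<lambda>x. l2_on T (\<lambda>\<xi>. if t < \<xi> then k2 (\<xi> - t) *\<^sub>R x else 0))"

text \<open>\<open>Blinfun\<close> is only meaningful on bounded linear maps; the following lemmas show that it is applied
  to one.\<close>

lemma integrable_powr_from_0:
  fixes a c :: real
  assumes "a > -1" "c \<ge> 0"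
  shows "integrable lborel (\<lambda>u. indicator {0..c} u * u powr a)"
proof -
  have "(\<lambda>u. u powr a) absolutely_integrable_on {0..c}"
    using has_integral_powr_from_0[OF assms]
    by (intro nonnegative_absolutely_integrable_1) (auto simp: integrable_on_def)
  then show ?thesis
    unfolding set_integrable_def by (subst (asm) integrable_completion) auto
qed

lemma square_integrable_fractional_kernel:
  fixes x :: "real ^ 'd"
  assumes "1/2 < \<alpha>"
  shows "square_integrable (\<lambda>\<xi>. if \<xi> \<in> {0..T} then if t < \<xi> then fractional_kernel \<alpha> (\<xi> - t) *\<^sub>R x else 0 else 0)"
    (is "square_integrable ?f")
proof -
  have meas [measurable]: "?f \<in> borel_measurable lborel"
    unfolding fractional_kernel_def by measurable
  define c where "c = max 0 (T - t)"
  define C where "C = (norm x / Gamma \<alpha>)\<^sup>2"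
  have "integrable lborel (\<lambda>u. indicator {0..c} u * u powr (2 * \<alpha> - 2))"
    using assms by (intro integrable_powr_from_0) (auto simp: c_def)
  from lborel_integrable_real_affine[OF this, of 1 "- t"]
  have "integrable lborel (\<lambda>\<xi>. C * (indicator {0..c} (\<xi> - t) * (\<xi> - t) powr (2 * \<alpha> - 2)))"
    by simp
  then have "integrable lborel (\<lambda>\<xi>. (norm (?f \<xi>))\<^sup>2)"
  proof (rule Bochner_Integration.integrable_bound)
    show "AE \<xi> in lborel. norm ((norm (?f \<xi>))\<^sup>2)
        \<le> norm (C * (indicator {0..c} (\<xi> - t) * (\<xi> - t) powr (2 * \<alpha> - 2)))"
    proof (rule AE_I2)
      fix \<xi>
      show "norm ((norm (?f \<xi>))\<^sup>2) \<le> norm (C * (indicator {0..c} (\<xi> - t) * (\<xi> - t) powr (2 * \<alpha> - 2)))"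
      proof (cases "\<xi> \<in> {0..T} \<and> t < \<xi>")
        case True
        have "((\<xi> - t) powr (\<alpha> - 1))\<^sup>2 = (\<xi> - t) powr (2 * \<alpha> - 2)"
          by (simp add: power2_eq_square powr_add[symmetric])
        then have "(norm (?f \<xi>))\<^sup>2 = C * (\<xi> - t) powr (2 * \<alpha> - 2)"
          using True by (simp add: fractional_kernel_def C_def power_mult_distrib power_divide)
        moreover have "indicator {0..c} (\<xi> - t) = (1::real)"
          using True by (auto simp: c_def)
        ultimately show ?thesis by simp
      qed auto
    qed
  qed measurable
  with meas show ?thesis unfolding square_integrable_def by (rule conjI)
qed

lemma bounded_linear_lifted_diffusion:
  assumes "1/2 < \<alpha>"
  shows "bounded_linear (\<lambda>x :: real ^ 'd. l2_on T (\<lambda>\<xi>. if t < \<xi> then fractional_kernel \<alpha> (\<xi> - t) *\<^sub>R x else 0))"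
    (is "bounded_linear ?S")
proof -
  define f where "f x \<xi> = (if \<xi> \<in> {0..T} then if t < \<xi> then fractional_kernel \<alpha> (\<xi> - t) *\<^sub>R x else 0 else 0)"
    for x :: "real ^ 'd" and \<xi>
  have sq: "square_integrable (f x)" for x
    unfolding f_def[abs_def] by (rule square_integrable_fractional_kernel[OF assms])
  have S: "?S x = l2_class (f x)" for x
    by (simp add: l2_on_def f_def[abs_def])
  have "linear ?S"
  proof (rule linearI)
    fix x y :: "real ^ 'd" and r :: real
    have "f (x + y) = (\<lambda>\<xi>. f x \<xi> + f y \<xi>)" "f (r *\<^sub>R x) = (\<lambda>\<xi>. r *\<^sub>R f x \<xi>)"
      by (auto simp: f_def scaleR_add_right)
    then show "?S (x + y) = ?S x + ?S y" "?S (r *\<^sub>R x) = r *\<^sub>R ?S x"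
      unfolding S by (simp_all only: l2_class_add[OF sq sq] l2_class_scaleR[OF sq])
  qed
  then show ?thesis by (rule linear_conv_bounded_linear[THEN iffD1])
qed

lemma lifted_diffusion_apply:
  "1/2 < \<alpha> \<Longrightarrow> blinfun_apply (lifted_diffusion T (fractional_kernel \<alpha>) t) x
    = l2_on T (\<lambda>\<xi>. if t < \<xi> then fractional_kernel \<alpha> (\<xi> - t) *\<^sub>R x else 0)"
  unfolding lifted_diffusion_def by (simp add: bounded_linear_Blinfun_apply bounded_linear_lifted_diffusion)

end

theory Submission
  imports Defs
begin

text \<open>Put \<open>G \<xi> = w\<^sub>t \<xi> - x0 - \<integral>\<^sub>0\<^sup>t k1(\<xi> - s) b(s, X\<^sub>s) ds\<close> with both kernels extended by zero to the negative half-line.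
  For every fixed \<open>\<xi>\<close>, \<open>G \<xi>\<close> is a version of the scalar-kernel integral \<open>\<integral>\<^sub>0\<^sup>t k2(\<xi> - s) dW\<^sub>s\<close>: for \<open>\<xi> \<le> t\<close> by
  the Volterra equation, for \<open>\<xi> > t\<close> by the definition of \<open>w\<^sub>t\<close>. Freezing the integrand at the left
  points of a grid, Tonelli and the Ito isometry for each \<open>\<xi>\<close> show that the elementary
  \<open>L\<^sup>2\<close>-valued integrals of the frozen integrand converge in mean square to the class of \<open>G\<close>, so this class
  is the integral of \<open>\<sigma>\<close>; no completeness of the space of square-integrable random variables is needed.
  The drift is treated by identifying a Bochner integral in \<open>L\<^sup>2\<close> with the pointwise integral
  through testing against elements of \<open>L\<^sup>2\<close>.\<close>

section \<open>Measurability and Bochner integrals in the space of square-integrable functions\<close>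

text \<open>For each \<xi> the Volterra identity holds off a null set that depends on \<xi>, and an
  uncountable union of such sets cannot be discarded. Mean-square distances integrated over \<xi> do
  not see these null sets, but they require \<open>G\<close> to be jointly measurable in \<xi> and
  \<omega>. For this reason \<open>X\<close> and \<open>J t\<close> are replaced by jointly
  measurable processes \<open>Y\<close> and \<open>I\<close> that agree with them on the whole time
  interval off a single null set. A second obstacle is that the definition of the integral supplies,
  for each \<xi>, only some approximating sequence, with no uniform rate and no measurable
  dependence on \<xi>. The isometry for differences of elementary integrals trades it for an
  explicit distance between the kernel and any chosen elementary integrand, so one grid can serve
  all \<xi>. Since the kernel is unbounded at 0, freezing it does not converge uniformly; what
  converges is its L^2 distance to a translate, averaged over \<xi>, with a bound that depends only
  on the size of the shift.\<close>

lemma borel_measurableI_dist: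
  fixes f :: "'a \<Rightarrow> 'b::{metric_space, second_countable_topology}"
  assumes "\<And>y. (\<lambda>x. dist y (f x)) \<in> borel_measurable M"
  shows "f \<in> borel_measurable M"
proof (rule borel_measurableI)
  fix S :: "'b set" assume "open S"
  \<comment> \<open>By the Lindelof property countably many of these balls already cover
    \<open>S\<close>, and the preimage of a ball is a sublevel set of a distance function.\<close>
  define B where "B = {ball y e |y e. ball y e \<subseteq> S}"
  have "\<And>U. U \<in> B \<Longrightarrow> open U" by (auto simp: B_def)
  then obtain B' where B': "B' \<subseteq> B" "countable B'" "\<Union>B' = \<Union>B"
    by (rule Lindelof) blast
  have "S \<subseteq> \<Union>B"
  proof
    fix x assume "x \<in> S"
    then obtain e where "0 < e" "ball x e \<subseteq> S" using \<open>open S\<close> by (meson open_contains_ball)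
    then show "x \<in> \<Union>B" unfolding B_def by (auto intro!: exI[of _ "ball x e"])
  qed
  then have "S = \<Union>B'" using B' by (auto simp: B_def)
  moreover have "f -` U \<inter> space M \<in> sets M" if "U \<in> B'" for U
  proof -
    have "U \<in> B" using that B'(1) by blast
    then obtain y e where U: "U = ball y e" unfolding B_def by blast
    have "{x \<in> space M. dist y (f x) < e} \<in> sets M"
      using assms[of y] by measurable
    also have "{x \<in> space M. dist y (f x) < e} = f -` U \<inter> space M" by (auto simp: U)
    finally show ?thesis .
  qed
  then have "(\<Union>U\<in>B'. f -` U \<inter> space M) \<in> sets M"
    using B'(2) by (intro sets.countable_UN'') auto
  moreover have "f -` (\<Union>B') \<inter> space M = (\<Union>U\<in>B'. f -` U \<inter> space M)" by auto
  ultimately show "f -` S \<inter> space M \<in> sets M" by simp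
qed

lemma l2_class_not_square_integrable: "\<not> square_integrable f \<Longrightarrow> l2_class f = 0"
  by transfer (simp add: square_integrable_0)

lemma square_integrable_iff_nn_integral:
  "f \<in> borel_measurable lborel \<Longrightarrow>
    square_integrable f \<longleftrightarrow> (\<integral>\<^sup>+x. ennreal ((norm (f x))\<^sup>2) \<partial>lborel) < \<infinity>"
  by (auto intro: square_integrableI_nn_integral simp: nn_integral_l2_class)

lemma norm_l2_class_nn:
  "square_integrable f \<Longrightarrow>
    norm (l2_class f) = sqrt (enn2real (\<integral>\<^sup>+x. ennreal ((norm (f x))\<^sup>2) \<partial>lborel))"
  by (simp add: nn_integral_l2_class)

text \<open>No integrability is assumed. Where a section is not square-integrable its class is the
  default value 0, and this happens on a measurable set of parameters because the integral of the
  squared norm is measurable. Elsewhere the distance to a fixed class is the root of a parameter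
  integral.\<close>

lemma measurable_l2_class:
  fixes f :: "'a \<Rightarrow> real \<Rightarrow> 'b::euclidean_space"
  assumes [measurable]: "(\<lambda>(x, \<xi>). f x \<xi>) \<in> borel_measurable (M \<Otimes>\<^sub>M lborel)"
  shows "(\<lambda>x. l2_class (f x)) \<in> borel_measurable M"
proof (rule borel_measurableI_dist)
  fix y :: "'b l2"
  obtain g where g: "square_integrable g" "y = l2_class g" by (rule l2_exhaust)
  have [measurable]: "g \<in> borel_measurable lborel" using g by (simp add: square_integrable_def)
  let ?I = "\<lambda>x. \<integral>\<^sup>+\<xi>. ennreal ((norm (f x \<xi>))\<^sup>2) \<partial>lborel"
  let ?J = "\<lambda>x. \<integral>\<^sup>+\<xi>. ennreal ((norm (f x \<xi> - g \<xi>))\<^sup>2) \<partial>lborel"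
  have "dist y (l2_class (f x)) = (if ?I x < \<infinity> then sqrt (enn2real (?J x)) else norm y)"
    if "x \<in> space M" for x
  proof -
    have fx: "f x \<in> borel_measurable lborel"
      using that by measurable
    show ?thesis
    proof (cases "square_integrable (f x)")
      case True
      then have "dist y (l2_class (f x)) = norm (l2_class (\<lambda>\<xi>. f x \<xi> - g \<xi>))"
        by (simp add: dist_norm norm_minus_commute l2_class_diff g)
      also have "\<dots> = sqrt (enn2real (?J x))"
        by (rule norm_l2_class_nn) (rule square_integrable_diff[OF True g(1)])
      finally show ?thesis
        using True by (simp only: square_integrable_iff_nn_integral[OF fx] if_True)
    next
      case False
      then show ?thesis
        unfolding square_integrable_iff_nn_integral[OF fx, symmetric]
        by (simp add: l2_class_not_square_integrable)
    qed
  qed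
  moreover have "(\<lambda>x. if ?I x < \<infinity> then sqrt (enn2real (?J x)) else norm y) \<in> borel_measurable M"
    by measurable
  ultimately show "(\<lambda>x. dist y (l2_class (f x))) \<in> borel_measurable M"
    by (subst measurable_cong) auto
qed

section \<open>Bochner integrals in L^2 and pointwise integrals\<close>

lemma l2_class_inner:
  "square_integrable f \<Longrightarrow> square_integrable g \<Longrightarrow>
    l2_class f \<bullet> l2_class g = (LINT x|lborel. f x \<bullet> g x)"
  by transfer simp

text \<open>Since \<open>N\<close> is finite, the uniform bound makes the squared norm integrable
  over the product space. This one fact yields both the Cauchy-Schwarz estimate for the pointwise
  integral and the integrability needed for Fubini.\<close>

lemma square_integrable_integral:
  fixes f :: "'a \<Rightarrow> real \<Rightarrow> 'b::euclidean_space"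
  assumes "finite_measure N"
    and [measurable]: "(\<lambda>(s, \<xi>). f s \<xi>) \<in> borel_measurable (N \<Otimes>\<^sub>M lborel)"
    and bound: "\<And>s. s \<in> space N \<Longrightarrow> (\<integral>\<^sup>+\<xi>. ennreal ((norm (f s \<xi>))\<^sup>2) \<partial>lborel) \<le> ennreal C"
  shows "square_integrable (\<lambda>\<xi>. LINT s|N. f s \<xi>)"
    and "integrable N (\<lambda>s. l2_class (f s))"
    and "(LINT s|N. l2_class (f s)) = l2_class (\<lambda>\<xi>. LINT s|N. f s \<xi>)"
proof -
  interpret N: finite_measure N by fact
  interpret P: pair_sigma_finite N lborel by standard
  have sqf: "square_integrable (f s)" if "s \<in> space N" for s
  proof (rule square_integrableI_nn_integral)
    show "f s \<in> borel_measurable lborel" using that by measurable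
    show "(\<integral>\<^sup>+\<xi>. ennreal ((norm (f s \<xi>))\<^sup>2) \<partial>lborel) < \<infinity>"
      using bound[OF that] by (auto intro: le_less_trans)
  qed
  have prod: "integrable (N \<Otimes>\<^sub>M lborel) (\<lambda>(s, \<xi>). (norm (f s \<xi>))\<^sup>2)"
  proof (rule integrableI_bounded)
    have "(\<integral>\<^sup>+ z. ennreal (norm (case z of (s, \<xi>) \<Rightarrow> (norm (f s \<xi>))\<^sup>2)) \<partial>(N \<Otimes>\<^sub>M lborel))
      = (\<integral>\<^sup>+ s. (\<integral>\<^sup>+\<xi>. ennreal ((norm (f s \<xi>))\<^sup>2) \<partial>lborel) \<partial>N)"
      by (subst lborel.nn_integral_fst[symmetric]) auto
    also have "\<dots> \<le> (\<integral>\<^sup>+ s. ennreal C \<partial>N)"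
      by (intro nn_integral_mono bound)
    also have "\<dots> < \<infinity>"
      by (simp add: ennreal_mult_less_top N.emeasure_finite less_top[symmetric] ennreal_mult_eq_top_iff)
    finally show "(\<integral>\<^sup>+ z. ennreal (norm (case z of (s, \<xi>) \<Rightarrow> (norm (f s \<xi>))\<^sup>2)) \<partial>(N \<Otimes>\<^sub>M lborel)) < \<infinity>" .
  qed measurable
  show sq: "square_integrable (\<lambda>\<xi>. LINT s|N. f s \<xi>)"
  proof -
    define m where "m = measure N (space N)"
    have "AE \<xi> in lborel. integrable N (\<lambda>s. (norm (f s \<xi>))\<^sup>2)"
      using P.AE_integrable_snd[of "\<lambda>s \<xi>. (norm (f s \<xi>))\<^sup>2"] prod by simp
    then have "AE \<xi> in lborel. norm ((norm (LINT s|N. f s \<xi>))\<^sup>2) \<le> norm (m * (LINT s|N. (norm (f s \<xi>))\<^sup>2))"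
    proof (rule eventually_mono)
      fix \<xi> assume int: "integrable N (\<lambda>s. (norm (f s \<xi>))\<^sup>2)"
      have fm: "(\<lambda>s. f s \<xi>) \<in> borel_measurable N" by measurable
      have intn: "integrable N (\<lambda>s. norm (f s \<xi>))"
        by (rule N.square_integrable_imp_integrable[OF _ int]) (use fm in measurable)
      have "norm (LINT s|N. f s \<xi>) \<le> (LINT s|N. norm (f s \<xi>))" by (rule integral_norm_bound)
      then have "(norm (LINT s|N. f s \<xi>))\<^sup>2 \<le> (LINT s|N. 1 * norm (f s \<xi>))\<^sup>2"
        by (intro power_mono) auto
      also have "\<dots> \<le> m * (LINT s|N. (norm (f s \<xi>))\<^sup>2)"
      proof -
        let ?v = "LINT s|N. norm (f s \<xi>)"
        \<comment> \<open>Cauchy-Schwarz against the constant 1. With \<open>m\<close> the total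
          mass, expanding this square gives a nonnegative product of \<open>m\<close> and the
          desired difference; \<open>m\<close> is cancelled when positive, and for
          \<open>m = 0\<close> both sides vanish.\<close>
        have "0 \<le> (LINT s|N. (m * norm (f s \<xi>) - ?v)\<^sup>2)" by simp
        also have "\<dots> = (LINT s|N. m\<^sup>2 * (norm (f s \<xi>))\<^sup>2 - 2 * m * ?v * norm (f s \<xi>) + ?v\<^sup>2)"
          by (intro Bochner_Integration.integral_cong refl) (simp add: power2_diff power_mult_distrib)
        also have "\<dots> = m\<^sup>2 * (LINT s|N. (norm (f s \<xi>))\<^sup>2) - 2 * m * ?v * ?v + m * ?v\<^sup>2"
          using int intn by (simp add: m_def)
        finally have *: "0 \<le> m * (m * (LINT s|N. (norm (f s \<xi>))\<^sup>2) - ?v\<^sup>2)"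
          by (simp add: algebra_simps power2_eq_square)
        show ?thesis
        proof (cases "m = 0")
          case True
          then have "space N \<in> null_sets N"
            by (auto simp: m_def null_sets_def N.emeasure_eq_measure)
          then have "AE s in N. norm (f s \<xi>) = 0" by (auto intro: AE_I')
          then have "?v = 0" by (rule integral_eq_zero_AE)
          with True show ?thesis by simp
        next
          case False
          then have "0 < m" by (simp add: m_def less_le)
          with * show ?thesis by (simp add: zero_le_mult_iff)
        qed
      qed
      finally show "norm ((norm (LINT s|N. f s \<xi>))\<^sup>2) \<le> norm (m * (LINT s|N. (norm (f s \<xi>))\<^sup>2))"
        by (simp add: m_def)
    qed
    moreover have "integrable lborel (\<lambda>\<xi>. m * (LINT s|N. (norm (f s \<xi>))\<^sup>2))"
      using P.integrable_snd[of "\<lambda>s \<xi>. (norm (f s \<xi>))\<^sup>2"] prod by (intro integrable_mult_right) simp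
    moreover have fm: "(\<lambda>\<xi>. LINT s|N. f s \<xi>) \<in> borel_measurable lborel" by measurable
    moreover have "(\<lambda>\<xi>. (norm (LINT s|N. f s \<xi>))\<^sup>2) \<in> borel_measurable lborel"
      using fm by measurable
    ultimately have "integrable lborel (\<lambda>\<xi>. (norm (LINT s|N. f s \<xi>))\<^sup>2)"
      by (elim Bochner_Integration.integrable_bound)
    with fm show ?thesis by (simp add: square_integrable_def)
  qed
  have meas: "(\<lambda>s. l2_class (f s)) \<in> borel_measurable N"
    by (rule measurable_l2_class) measurable
  have normle: "norm (l2_class (f s)) \<le> sqrt (max 0 C)" if "s \<in> space N" for s
  proof -
    have "ennreal ((norm (l2_class (f s)))\<^sup>2) \<le> ennreal C"
      using bound[OF that] unfolding nn_integral_l2_class[OF sqf[OF that]] .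
    \<comment> \<open>\<open>C\<close> carries no sign condition, and \<open>ennreal\<close>
      truncates it at 0.\<close>
    also have "\<dots> \<le> ennreal (max 0 C)" by (intro ennreal_leI) simp
    finally have "(norm (l2_class (f s)))\<^sup>2 \<le> max 0 C" by (subst (asm) ennreal_le_iff) simp_all
    then show ?thesis by (rule real_le_rsqrt)
  qed
  show int: "integrable N (\<lambda>s. l2_class (f s))"
    by (rule N.integrable_const_bound[OF _ meas]) (use normle in \<open>auto intro!: AE_I2\<close>)
  show "(LINT s|N. l2_class (f s)) = l2_class (\<lambda>\<xi>. LINT s|N. f s \<xi>)" (is "?x = ?y")
  proof -
    have "?x \<bullet> z = ?y \<bullet> z" for z
    proof -
      obtain g where g: "square_integrable g" "z = l2_class g" by (rule l2_exhaust)
      have [measurable]: "g \<in> borel_measurable lborel" using g by (simp add: square_integrable_def)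
      have g2: "integrable (N \<Otimes>\<^sub>M lborel) (\<lambda>(s, \<xi>). (norm (g \<xi>))\<^sup>2)"
      proof (rule integrableI_bounded)
        have "(\<integral>\<^sup>+ z. ennreal (norm (case z of (s, \<xi>) \<Rightarrow> (norm (g \<xi>))\<^sup>2)) \<partial>(N \<Otimes>\<^sub>M lborel))
          = (\<integral>\<^sup>+ s. (\<integral>\<^sup>+\<xi>. ennreal ((norm (g \<xi>))\<^sup>2) \<partial>lborel) \<partial>N)"
          by (subst lborel.nn_integral_fst[symmetric]) auto
        also have "\<dots> < \<infinity>"
          by (simp add: nn_integral_l2_class[OF g(1)] ennreal_mult_less_top N.emeasure_finite less_top[symmetric] ennreal_mult_eq_top_iff)
        finally show "(\<integral>\<^sup>+ z. ennreal (norm (case z of (s, \<xi>) \<Rightarrow> (norm (g \<xi>))\<^sup>2)) \<partial>(N \<Otimes>\<^sub>M lborel)) < \<infinity>" .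
      qed measurable
      have fg: "integrable (N \<Otimes>\<^sub>M lborel) (\<lambda>(s, \<xi>). f s \<xi> \<bullet> g \<xi>)"
      proof (rule Bochner_Integration.integrable_bound[OF Bochner_Integration.integrable_add[OF prod g2]])
        show "AE z in N \<Otimes>\<^sub>M lborel. norm (case z of (s, \<xi>) \<Rightarrow> f s \<xi> \<bullet> g \<xi>)
          \<le> norm ((case z of (s, \<xi>) \<Rightarrow> (norm (f s \<xi>))\<^sup>2) + (case z of (s, \<xi>) \<Rightarrow> (norm (g \<xi>))\<^sup>2))"
        proof (rule AE_I2, clarsimp)
          fix s \<xi>
          have "\<bar>f s \<xi> \<bullet> g \<xi>\<bar> \<le> norm (f s \<xi>) * norm (g \<xi>)"
            by (rule Cauchy_Schwarz_ineq2)
          also have "\<dots> \<le> (norm (f s \<xi>))\<^sup>2 + (norm (g \<xi>))\<^sup>2"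
            using sum_squares_bound[of "norm (f s \<xi>)" "norm (g \<xi>)"]
              mult_nonneg_nonneg[OF norm_ge_zero[of "f s \<xi>"] norm_ge_zero[of "g \<xi>"]] by linarith
          finally show "\<bar>f s \<xi> \<bullet> g \<xi>\<bar> \<le> (norm (f s \<xi>))\<^sup>2 + (norm (g \<xi>))\<^sup>2" .
        qed
      qed measurable
      have intf: "AE \<xi> in lborel. integrable N (\<lambda>s. f s \<xi>)"
        using P.AE_integrable_snd[OF prod]
      proof (rule eventually_mono)
        fix \<xi> assume int: "integrable N (\<lambda>s. (norm (f s \<xi>))\<^sup>2)"
        have fm: "(\<lambda>s. f s \<xi>) \<in> borel_measurable N" by measurable
        have "integrable N (\<lambda>s. norm (f s \<xi>))"
          by (rule N.square_integrable_imp_integrable[OF _ int]) (use fm in measurable)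
        then show "integrable N (\<lambda>s. f s \<xi>)" using fm by (simp add: integrable_norm_iff)
      qed
      have "?x \<bullet> z = (LINT s|N. l2_class (f s) \<bullet> z)"
        using int by simp
      also have "\<dots> = (LINT s|N. LINT \<xi>|lborel. f s \<xi> \<bullet> g \<xi>)"
        by (intro Bochner_Integration.integral_cong refl) (simp add: g(2) l2_class_inner sqf g(1))
      also have "\<dots> = (LINT \<xi>|lborel. LINT s|N. f s \<xi> \<bullet> g \<xi>)"
        using P.Fubini_integral[of "\<lambda>s \<xi>. f s \<xi> \<bullet> g \<xi>"] fg by simp
      also have "\<dots> = (LINT \<xi>|lborel. (LINT s|N. f s \<xi>) \<bullet> g \<xi>)"
      proof (rule integral_cong_AE)
        show "AE \<xi> in lborel. (LINT s|N. f s \<xi> \<bullet> g \<xi>) = (LINT s|N. f s \<xi>) \<bullet> g \<xi>"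
          using intf by (rule eventually_mono) simp
      qed measurable
      also have "\<dots> = ?y \<bullet> z"
        by (simp add: g(2) l2_class_inner sq g(1))
      finally show ?thesis .
    qed
    then show ?thesis by (metis inner_commute vector_eq_ldot)
  qed
qed

section \<open>Moments of Brownian increments\<close>

lemma borel_measurable_vec_nth [measurable]: "(\<lambda>x :: real ^ 'd. x $ i) \<in> borel_measurable borel"
  by (intro borel_measurable_continuous_onI continuous_intros)

locale brownian_basis = prob_space M for M :: "'a measure" +
  fixes T :: real and F :: "real \<Rightarrow> 'a measure" and W :: "real \<Rightarrow> 'a \<Rightarrow> real ^ 'd"
  assumes usual_filtration: "usual_filtration M T F"
    and brownian_motion: "brownian_motion M T F W"
begin

lemma subalgebra_F: "t \<in> {0..T} \<Longrightarrow> subalgebra M (F t)"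
  using usual_filtration by (simp add: usual_filtration_def)

lemma space_F [simp]: "t \<in> {0..T} \<Longrightarrow> space (F t) = space M"
  using subalgebra_F[of t] by (simp add: subalgebra_def)

lemma sets_F_mono: "0 \<le> s \<Longrightarrow> s \<le> t \<Longrightarrow> t \<le> T \<Longrightarrow> sets (F s) \<subseteq> sets (F t)"
  using usual_filtration by (auto simp: usual_filtration_def)

lemma measurable_F_mono:
  assumes "f \<in> measurable (F s) N" "0 \<le> s" "s \<le> t" "t \<le> T"
  shows "f \<in> measurable (F t) N"
  using assms sets_F_mono[OF assms(2-4)] by (auto simp: measurable_def)

lemma measurable_F_M: "f \<in> measurable (F t) N \<Longrightarrow> t \<in> {0..T} \<Longrightarrow> f \<in> measurable M N"
  by (rule measurable_from_subalg[OF subalgebra_F])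

lemma measurable_W: "0 \<le> t \<Longrightarrow> W t \<in> borel_measurable M"
  using brownian_motion by (simp add: brownian_motion_def)

lemma measurable_W_F:
  assumes "0 \<le> s" "s \<le> t" "t \<le> T"
  shows "W s \<in> borel_measurable (F t)"
  using assms brownian_motion by (intro measurable_F_mono[OF _ assms]) (simp add: brownian_motion_def)

lemma distributed_increment:
  "0 \<le> s \<Longrightarrow> s < t \<Longrightarrow>
    distributed M lborel (\<lambda>\<omega>. (W t \<omega> - W s \<omega>) $ i) (normal_density 0 (sqrt (t - s)))"
  using brownian_motion by (simp add: brownian_motion_def)

text \<open>The definition of Brownian motion describes only increments over intervals of positive
  length, while partitions may repeat a point; the degenerate case is added here. Otherwise these
  are the moments of a centred normal variable.\<close>

lemma increment_moments:
  assumes "0 \<le> s" "s \<le> t"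
  shows "integrable M (\<lambda>\<omega>. ((W t \<omega> - W s \<omega>) $ i)\<^sup>2)"
    and "expectation (\<lambda>\<omega>. ((W t \<omega> - W s \<omega>) $ i)\<^sup>2) = t - s"
    and "integrable M (\<lambda>\<omega>. (W t \<omega> - W s \<omega>) $ i)"
    and "expectation (\<lambda>\<omega>. (W t \<omega> - W s \<omega>) $ i) = 0"
proof -
  have *: "integrable M (\<lambda>\<omega>. ((W t \<omega> - W s \<omega>) $ i)\<^sup>2) \<and>
    expectation (\<lambda>\<omega>. ((W t \<omega> - W s \<omega>) $ i)\<^sup>2) = t - s \<and>
    integrable M (\<lambda>\<omega>. (W t \<omega> - W s \<omega>) $ i) \<and>
    expectation (\<lambda>\<omega>. (W t \<omega> - W s \<omega>) $ i) = 0"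
  proof (cases "s = t")
    case False
    then have lt: "s < t" using assms by simp
    note d = distributed_increment[OF assms(1) lt, of i]
    have pos: "0 < sqrt (t - s)" using lt by simp
    have e: "expectation (\<lambda>\<omega>. (W t \<omega> - W s \<omega>) $ i) = 0"
      by (rule normal_distributed_expectation[OF pos d])
    have "variance (\<lambda>\<omega>. (W t \<omega> - W s \<omega>) $ i) = (sqrt (t - s))\<^sup>2"
      by (rule normal_distributed_variance[OF pos d])
    then have v: "expectation (\<lambda>\<omega>. ((W t \<omega> - W s \<omega>) $ i)\<^sup>2) = t - s"
      using lt by (simp add: e[simplified])
    have i1: "integrable M (\<lambda>\<omega>. (W t \<omega> - W s \<omega>) $ i)"
      using distributed_integrable[OF d, of "\<lambda>x. x"] integrable_normal_moment_nz_1[OF pos, of 0] by simp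
    have "integrable M (\<lambda>\<omega>. ((W t \<omega> - W s \<omega>) $ i)\<^sup>2)"
      using distributed_integrable[OF d, of "\<lambda>x. x\<^sup>2"] integrable_normal_moment[OF pos, of 0 2]
      by (simp add: mult.commute)
    with e v i1 show ?thesis by blast
  qed simp
  show "integrable M (\<lambda>\<omega>. ((W t \<omega> - W s \<omega>) $ i)\<^sup>2)" using * by blast
  show "expectation (\<lambda>\<omega>. ((W t \<omega> - W s \<omega>) $ i)\<^sup>2) = t - s" using * by blast
  show "integrable M (\<lambda>\<omega>. (W t \<omega> - W s \<omega>) $ i)" using * by blast
  show "expectation (\<lambda>\<omega>. (W t \<omega> - W s \<omega>) $ i) = 0" using * by blast
qed

lemma increment_product_moments:
  assumes "0 \<le> s" "s \<le> t"
  shows "integrable M (\<lambda>\<omega>. (W t \<omega> - W s \<omega>) $ p * (W t \<omega> - W s \<omega>) $ q)" (is "integrable M ?f")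
    and "expectation (\<lambda>\<omega>. (W t \<omega> - W s \<omega>) $ p * (W t \<omega> - W s \<omega>) $ q) = (if p = q then t - s else 0)"
proof -
  have "integrable M ?f \<and> expectation ?f = (if p = q then t - s else 0)"
  proof (cases "p = q \<or> s = t")
    case True
    then show ?thesis
      using increment_moments[OF assms, of p] by (auto simp: power2_eq_square)
  next
    case False
    then have "s < t" using assms by simp
    then have "indep_vars (\<lambda>_. borel) (\<lambda>i \<omega>. (W t \<omega> - W s \<omega>) $ i) UNIV"
      using brownian_motion assms by (auto simp: brownian_motion_def)
    \<comment> \<open>Two coordinates are extracted from the independent family by restricting it to
      the singletons \<open>{p}\<close> and \<open>{q}\<close> and evaluating there. Their
      expectations vanish, hence so does that of the product.\<close>
    from indep_var_compose[OF indep_var_restrict[OF this, of "{p}" "{q}"],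
        of "\<lambda>x. x p" borel "\<lambda>x. x q" borel]
    have "indep_var borel (\<lambda>\<omega>. (W t \<omega> - W s \<omega>) $ p) borel (\<lambda>\<omega>. (W t \<omega> - W s \<omega>) $ q)"
      using False by (auto simp: comp_def eq_commute[of q p] simp del: vector_minus_component)
    from indep_var_integrable[OF this increment_moments(3)[OF assms] increment_moments(3)[OF assms]]
      indep_var_lebesgue_integral[OF this increment_moments(3)[OF assms] increment_moments(3)[OF assms]]
    show ?thesis using False increment_moments(4)[OF assms] by simp
  qed
  then show "integrable M ?f" "expectation ?f = (if p = q then t - s else 0)" by blast+
qed

text \<open>Independence passes to smaller sigma-algebras: the one generated by \<open>Y\<close>
  lies in \<open>F s\<close>, and the one generated by \<open>g\<close> of the increment lies in
  that of the increment.\<close>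

lemma indep_increment:
  fixes Y :: "'a \<Rightarrow> real" and g :: "real ^ 'd \<Rightarrow> real"
  assumes "0 \<le> s" "s \<le> T" "s \<le> t" and Y: "Y \<in> borel_measurable (F s)"
    and g: "g \<in> borel_measurable borel"
  shows "indep_var borel Y borel (\<lambda>\<omega>. g (W t \<omega> - W s \<omega>))"
proof -
  let ?D = "\<lambda>\<omega>. W t \<omega> - W s \<omega>"
  have ind: "indep_set (sets (F s)) (sets (vimage_algebra (space M) ?D borel))"
    using brownian_motion assms by (simp add: brownian_motion_def)
  have [measurable]: "W t \<in> borel_measurable M" "W s \<in> borel_measurable M" "g \<in> borel_measurable borel"
    using assms by (auto intro: measurable_W)
  have rv: "(\<lambda>\<omega>. g (?D \<omega>)) \<in> borel_measurable M" "Y \<in> borel_measurable M"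
    using measurable_F_M[OF Y] assms by auto
  have "sigma_sets (space M) {Y -` A \<inter> space M |A. A \<in> sets borel} \<subseteq> sets (F s)"
  proof -
    have "{Y -` A \<inter> space M |A. A \<in> sets borel} \<subseteq> sets (F s)"
      using measurable_sets[OF Y] space_F[of s] assms by auto
    from sets.sigma_sets_subset[OF this] show ?thesis using assms by simp
  qed
  moreover have "sigma_sets (space M) {(\<lambda>\<omega>. g (?D \<omega>)) -` A \<inter> space M |A. A \<in> sets borel}
      \<subseteq> sets (vimage_algebra (space M) ?D borel)"
  proof -
    have "(\<lambda>\<omega>. g (?D \<omega>)) -` A \<inter> space M \<in> sets (vimage_algebra (space M) ?D borel)"
      if "A \<in> sets borel" for A
    proof -
      have "(\<lambda>\<omega>. g (?D \<omega>)) -` A = ?D -` (g -` A)" by auto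
      moreover have "g -` A \<in> sets borel" using measurable_sets[OF g that] by simp
      ultimately show ?thesis by (auto intro: in_vimage_algebra)
    qed
    then have "{(\<lambda>\<omega>. g (?D \<omega>)) -` A \<inter> space M |A. A \<in> sets borel} \<subseteq> sets (vimage_algebra (space M) ?D borel)"
      by blast
    from sets.sigma_sets_subset[OF this] show ?thesis by simp
  qed
  ultimately have "indep_set (sigma_sets (space M) {Y -` A \<inter> space M |A. A \<in> sets borel})
     (sigma_sets (space M) {(\<lambda>\<omega>. g (?D \<omega>)) -` A \<inter> space M |A. A \<in> sets borel})"
    using ind unfolding indep_sets2_eq by (meson subset_eq)
  with rv show ?thesis by (simp add: indep_var_eq)
qed

lemma expectation_mult_increment:
  fixes Y :: "'a \<Rightarrow> real" and g :: "real ^ 'd \<Rightarrow> real"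
  assumes "0 \<le> s" "s \<le> T" "s \<le> t" and "Y \<in> borel_measurable (F s)" "integrable M Y"
    and "g \<in> borel_measurable borel" "integrable M (\<lambda>\<omega>. g (W t \<omega> - W s \<omega>))"
  shows "expectation (\<lambda>\<omega>. Y \<omega> * g (W t \<omega> - W s \<omega>))
      = expectation Y * expectation (\<lambda>\<omega>. g (W t \<omega> - W s \<omega>))"
  using assms by (intro indep_var_lebesgue_integral indep_increment)

lemma integrable_bounded_mult_increment:
  fixes C :: "'a \<Rightarrow> real"
  assumes "0 \<le> s" "s \<le> t" and C: "C \<in> borel_measurable M" "\<And>\<omega>. \<omega> \<in> space M \<Longrightarrow> \<bar>C \<omega>\<bar> \<le> K"
  shows "integrable M (\<lambda>\<omega>. C \<omega> * (W t \<omega> - W s \<omega>) $ p)"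
proof (rule Bochner_Integration.integrable_bound)
  show "integrable M (\<lambda>\<omega>. K * (W t \<omega> - W s \<omega>) $ p)"
    using increment_moments(3)[OF assms(1,2)] by (rule integrable_mult_right)
  have [measurable]: "W t \<in> borel_measurable M" "W s \<in> borel_measurable M"
    using assms by (auto intro: measurable_W)
  show "(\<lambda>\<omega>. C \<omega> * (W t \<omega> - W s \<omega>) $ p) \<in> borel_measurable M"
    using C(1) by measurable
  show "AE \<omega> in M. norm (C \<omega> * (W t \<omega> - W s \<omega>) $ p) \<le> norm (K * (W t \<omega> - W s \<omega>) $ p)"
  proof (rule AE_I2)
    fix \<omega> assume "\<omega> \<in> space M"
    then have "norm (C \<omega>) \<le> norm K" using C(2)[of \<omega>] by simp
    then show "norm (C \<omega> * (W t \<omega> - W s \<omega>) $ p) \<le> norm (K * (W t \<omega> - W s \<omega>) $ p)"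
      unfolding norm_mult by (rule mult_right_mono) simp
  qed
qed

lemma integrable_bounded_mult_increments:
  fixes C :: "'a \<Rightarrow> real"
  assumes "0 \<le> a" "a \<le> b" "0 \<le> c" "c \<le> d"
    and C: "C \<in> borel_measurable M" "\<And>\<omega>. \<omega> \<in> space M \<Longrightarrow> \<bar>C \<omega>\<bar> \<le> K"
  shows "integrable M (\<lambda>\<omega>. C \<omega> * (W b \<omega> - W a \<omega>) $ p * (W d \<omega> - W c \<omega>) $ q)"
proof (rule Bochner_Integration.integrable_bound)
  show "integrable M (\<lambda>\<omega>. K * (((W b \<omega> - W a \<omega>) $ p)\<^sup>2 + ((W d \<omega> - W c \<omega>) $ q)\<^sup>2))"
    using increment_moments(1)[OF assms(1,2), of p] increment_moments(1)[OF assms(3,4), of q]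
    by (intro integrable_mult_right Bochner_Integration.integrable_add)
  have [measurable]: "W a \<in> borel_measurable M" "W b \<in> borel_measurable M" "W c \<in> borel_measurable M"
    "W d \<in> borel_measurable M" using assms by (auto intro: measurable_W)
  show "(\<lambda>\<omega>. C \<omega> * (W b \<omega> - W a \<omega>) $ p * (W d \<omega> - W c \<omega>) $ q) \<in> borel_measurable M"
    using C(1) by measurable
  show "AE \<omega> in M. norm (C \<omega> * (W b \<omega> - W a \<omega>) $ p * (W d \<omega> - W c \<omega>) $ q)
      \<le> norm (K * (((W b \<omega> - W a \<omega>) $ p)\<^sup>2 + ((W d \<omega> - W c \<omega>) $ q)\<^sup>2))"
  proof (rule AE_I2)
    fix \<omega> assume \<omega>: "\<omega> \<in> space M"
    define x where "x = (W b \<omega> - W a \<omega>) $ p"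
    define y where "y = (W d \<omega> - W c \<omega>) $ q"
    have "\<bar>x * y\<bar> \<le> x\<^sup>2 + y\<^sup>2"
      using sum_squares_bound[of "\<bar>x\<bar>" "\<bar>y\<bar>"] mult_nonneg_nonneg[OF abs_ge_zero[of x] abs_ge_zero[of y]]
      unfolding abs_mult power2_abs by linarith
    then have "\<bar>C \<omega>\<bar> * \<bar>x * y\<bar> \<le> \<bar>K\<bar> * (x\<^sup>2 + y\<^sup>2)"
      using C(2)[OF \<omega>] by (intro mult_mono) auto
    then show "norm (C \<omega> * x * y) \<le> norm (K * (x\<^sup>2 + y\<^sup>2))"
      by (simp add: abs_mult mult.assoc)
  qed
qed

text \<open>The coefficient and the earlier increment are both known at time \<open>c\<close>, so
  their product is independent of the later increment, which has mean zero. The coefficient need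
  only be known at \<open>c\<close>, not at \<open>a\<close>.\<close>

lemma increment_orthogonal:
  fixes C :: "'a \<Rightarrow> real"
  assumes "0 \<le> a" "a \<le> b" "b \<le> c" "c \<le> d" "c \<le> T"
    and C: "C \<in> borel_measurable (F c)" "\<And>\<omega>. \<omega> \<in> space M \<Longrightarrow> \<bar>C \<omega>\<bar> \<le> K"
  shows "expectation (\<lambda>\<omega>. C \<omega> * (W b \<omega> - W a \<omega>) $ p * (W d \<omega> - W c \<omega>) $ q) = 0"
proof -
  have [measurable]: "W a \<in> borel_measurable (F c)" "W b \<in> borel_measurable (F c)"
    using assms by (auto intro: measurable_W_F)
  have "(\<lambda>\<omega>. C \<omega> * (W b \<omega> - W a \<omega>) $ p) \<in> borel_measurable (F c)"
    using C(1) by measurable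
  moreover have "C \<in> borel_measurable M"
    using measurable_F_M[OF C(1)] assms by auto
  then have "integrable M (\<lambda>\<omega>. C \<omega> * (W b \<omega> - W a \<omega>) $ p)"
    using C(2) assms by (intro integrable_bounded_mult_increment) auto
  ultimately have "expectation (\<lambda>\<omega>. C \<omega> * (W b \<omega> - W a \<omega>) $ p * (W d \<omega> - W c \<omega>) $ q)
     = expectation (\<lambda>\<omega>. C \<omega> * (W b \<omega> - W a \<omega>) $ p) * expectation (\<lambda>\<omega>. (W d \<omega> - W c \<omega>) $ q)"
    using assms by (intro expectation_mult_increment[where g="\<lambda>x. x $ q"] increment_moments(3)) auto
  then show ?thesis using assms by (simp add: increment_moments(4) del: vector_minus_component)
qed

lemma increment_square_product:
  fixes C :: "'a \<Rightarrow> real"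
  assumes "0 \<le> s" "s \<le> t" "s \<le> T"
    and C: "C \<in> borel_measurable (F s)" "\<And>\<omega>. \<omega> \<in> space M \<Longrightarrow> \<bar>C \<omega>\<bar> \<le> K"
  shows "expectation (\<lambda>\<omega>. C \<omega> * (W t \<omega> - W s \<omega>) $ p * (W t \<omega> - W s \<omega>) $ q)
    = expectation C * (if p = q then t - s else 0)"
proof -
  have "C \<in> borel_measurable M"
    using measurable_F_M[OF C(1)] assms by auto
  then have "integrable M C"
    by (rule integrable_const_bound[rotated]) (use C(2) in \<open>auto intro: AE_I2\<close>)
  then have "expectation (\<lambda>\<omega>. C \<omega> * ((W t \<omega> - W s \<omega>) $ p * (W t \<omega> - W s \<omega>) $ q))
    = expectation C * expectation (\<lambda>\<omega>. (W t \<omega> - W s \<omega>) $ p * (W t \<omega> - W s \<omega>) $ q)"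
    using assms
    by (intro expectation_mult_increment[where g="\<lambda>x. x $ p * x $ q"] increment_product_moments(1)) auto
  then show ?thesis using assms by (simp add: increment_product_moments(2) mult.assoc del: vector_minus_component)
qed

text \<open>Both increments are cut at the ends of the overlap of the two intervals. Pieces over
  disjoint intervals are orthogonal, so only the square over the overlap survives.\<close>

lemma increment_covariance_ordered:
  fixes C :: "'a \<Rightarrow> real"
  assumes "0 \<le> a" "a \<le> b" "a \<le> c" "c \<le> d" "b \<le> T" "d \<le> T"
    and C: "C \<in> borel_measurable (F c)" "\<And>\<omega>. \<omega> \<in> space M \<Longrightarrow> \<bar>C \<omega>\<bar> \<le> K"
  shows "expectation (\<lambda>\<omega>. C \<omega> * (W b \<omega> - W a \<omega>) $ p * (W d \<omega> - W c \<omega>) $ q)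
    = expectation C * (if p = q then measure lborel ({a<..b} \<inter> {c<..d}) else 0)"
proof -
  have CM: "C \<in> borel_measurable M"
    using measurable_F_M[OF C(1)] assms by auto
  let ?D = "\<lambda>u v \<omega>. W v \<omega> - W u \<omega>"
  have int: "integrable M (\<lambda>\<omega>. C \<omega> * ?D u v \<omega> $ p * ?D u' v' \<omega> $ q)"
    if "0 \<le> u" "u \<le> v" "0 \<le> u'" "u' \<le> v'" for u v u' v'
    using that CM C(2) by (rule integrable_bounded_mult_increments)
  have swap: "(\<lambda>\<omega>. C \<omega> * ?D u v \<omega> $ p * ?D u' v' \<omega> $ q) = (\<lambda>\<omega>. C \<omega> * ?D u' v' \<omega> $ q * ?D u v \<omega> $ p)"
    for u v u' v' by (simp add: mult_ac)
  have Cmono: "C \<in> borel_measurable (F r)" if "c \<le> r" "r \<le> T" for r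
    using measurable_F_mono[OF C(1)] that assms by auto
  show ?thesis
  proof (cases "b \<le> c")
    case True
    then have "{a<..b} \<inter> {c<..d} = {}" by auto
    with True show ?thesis
      using increment_orthogonal[of a b c d C K p q] assms by auto
  next
    case False
    \<comment> \<open>The overlap is \<open>{c<..e}\<close>. As \<open>e\<close> is \<open>b\<close>
      or \<open>d\<close>, one of the increments beyond \<open>e\<close> is zero, and their product
      does not show up in the expansion below.\<close>
    define e where "e = min b d"
    have e: "c \<le> e" "e \<le> b" "e \<le> d" "e = b \<or> e = d" using False assms by (auto simp: e_def)
    have "{a<..b} \<inter> {c<..d} = {c<..e}" using assms by (auto simp: e_def)
    then have m: "measure lborel ({a<..b} \<inter> {c<..d}) = e - c" using e by simp
    have "(\<lambda>\<omega>. C \<omega> * ?D a b \<omega> $ p * ?D c d \<omega> $ q) = (\<lambda>\<omega>. C \<omega> * ?D a c \<omega> $ p * ?D c d \<omega> $ q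
        + (C \<omega> * ?D c e \<omega> $ p * ?D c e \<omega> $ q + (C \<omega> * ?D c e \<omega> $ p * ?D e d \<omega> $ q
        + C \<omega> * ?D e b \<omega> $ p * ?D c e \<omega> $ q)))"
      using e(4) by (elim disjE) (simp_all add: fun_eq_iff algebra_simps)
    then have "expectation (\<lambda>\<omega>. C \<omega> * ?D a b \<omega> $ p * ?D c d \<omega> $ q)
      = expectation (\<lambda>\<omega>. C \<omega> * ?D a c \<omega> $ p * ?D c d \<omega> $ q)
        + (expectation (\<lambda>\<omega>. C \<omega> * ?D c e \<omega> $ p * ?D c e \<omega> $ q)
        + (expectation (\<lambda>\<omega>. C \<omega> * ?D c e \<omega> $ p * ?D e d \<omega> $ q)
        + expectation (\<lambda>\<omega>. C \<omega> * ?D e b \<omega> $ p * ?D c e \<omega> $ q)))"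
      using assms e by (simp add: int del: vector_minus_component)
    also have "expectation (\<lambda>\<omega>. C \<omega> * ?D a c \<omega> $ p * ?D c d \<omega> $ q) = 0"
      using assms by (intro increment_orthogonal) auto
    also have "expectation (\<lambda>\<omega>. C \<omega> * ?D c e \<omega> $ p * ?D e d \<omega> $ q) = 0"
      using assms e Cmono[of e] by (intro increment_orthogonal) auto
    also have "expectation (\<lambda>\<omega>. C \<omega> * ?D e b \<omega> $ p * ?D c e \<omega> $ q) = 0"
      unfolding swap using assms e Cmono[of e] by (intro increment_orthogonal) auto
    also have "expectation (\<lambda>\<omega>. C \<omega> * ?D c e \<omega> $ p * ?D c e \<omega> $ q)
        = expectation C * (if p = q then e - c else 0)"
      using assms e by (intro increment_square_product) auto
    finally show ?thesis unfolding m by (simp only: add_0_left add_0_right)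
  qed
qed

text \<open>The order of the left ends is removed by symmetry. At time \<open>max a c\<close> a
  product of two coefficients, each known at its own left end, is known.\<close>

lemma increment_covariance:
  fixes C :: "'a \<Rightarrow> real"
  assumes "0 \<le> a" "a \<le> b" "0 \<le> c" "c \<le> d" "b \<le> T" "d \<le> T"
    and C: "C \<in> borel_measurable (F (max a c))" "\<And>\<omega>. \<omega> \<in> space M \<Longrightarrow> \<bar>C \<omega>\<bar> \<le> K"
  shows "expectation (\<lambda>\<omega>. C \<omega> * (W b \<omega> - W a \<omega>) $ p * (W d \<omega> - W c \<omega>) $ q)
    = expectation C * (if p = q then measure lborel ({a<..b} \<inter> {c<..d}) else 0)"
proof (cases "a \<le> c")
  case True
  with assms show ?thesis by (intro increment_covariance_ordered) (auto simp: max_def)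
next
  case False
  then have *: "expectation (\<lambda>\<omega>. C \<omega> * (W d \<omega> - W c \<omega>) $ q * (W b \<omega> - W a \<omega>) $ p)
    = expectation C * (if q = p then measure lborel ({c<..d} \<inter> {a<..b}) else 0)"
    using assms by (intro increment_covariance_ordered) (auto simp: max_def)
  have "(\<lambda>\<omega>. C \<omega> * (W d \<omega> - W c \<omega>) $ q * (W b \<omega> - W a \<omega>) $ p)
      = (\<lambda>\<omega>. C \<omega> * (W b \<omega> - W a \<omega>) $ p * (W d \<omega> - W c \<omega>) $ q)"
    by (simp add: mult_ac)
  from *[unfolded this] show ?thesis by (simp only: Int_commute[of "{c<..d}"] eq_commute[of q p])
qed

end

section \<open>The Ito isometry\<close>

lemma sum_Basis_vec: "(\<Sum>e\<in>(Basis :: (real ^ 'd) set). f e) = (\<Sum>i\<in>UNIV. f (axis i 1))"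
proof -
  have "(Basis :: (real ^ 'd) set) = range (\<lambda>i. axis i 1)"
    by (auto simp: Basis_vec_def)
  moreover have "inj (\<lambda>i :: 'd. axis i (1::real))"
    by (auto simp: inj_def axis_eq_axis)
  ultimately show ?thesis
    using sum.reindex_cong[of "\<lambda>i :: 'd. axis i (1::real)" UNIV Basis f] by auto
qed

lemma blinfun_apply_vec:
  fixes A :: "(real ^ 'd) \<Rightarrow>\<^sub>L 'h::real_normed_vector"
  shows "blinfun_apply A x = (\<Sum>i\<in>UNIV. (x $ i) *\<^sub>R blinfun_apply A (axis i 1))"
proof -
  have "blinfun_apply A (\<Sum>i\<in>UNIV. (x $ i) *\<^sub>R axis i 1) = (\<Sum>i\<in>UNIV. (x $ i) *\<^sub>R blinfun_apply A (axis i 1))"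
    by (simp add: blinfun.sum_right blinfun.scaleR_right)
  then show ?thesis
    using basis_expansion[of x] by (simp add: scalar_mult_eq_scaleR)
qed

lemma hilbert_schmidt_norm_square:
  "(hilbert_schmidt_norm A)\<^sup>2 = (\<Sum>i\<in>UNIV. (norm (blinfun_apply A (axis i 1)))\<^sup>2)"
  unfolding hilbert_schmidt_norm_def sum_Basis_vec by (simp add: sum_nonneg)

lemma norm_sum_square: "(norm (\<Sum>i\<in>I. x i))\<^sup>2 = (\<Sum>i\<in>I. \<Sum>j\<in>I. x i \<bullet> x j)"
  by (simp only: power2_norm_eq_inner inner_sum_left inner_sum_right) (rule sum.swap)

lemma simple_function_bounded:
  fixes f :: "'a \<Rightarrow> real"
  assumes "simple_function N f"
  obtains K where "\<And>\<omega>. \<omega> \<in> space N \<Longrightarrow> \<bar>f \<omega>\<bar> \<le> K"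
proof
  have "finite ((\<lambda>\<omega>. \<bar>f \<omega>\<bar>) ` space N)"
    using assms by (auto simp: simple_function_def image_image[symmetric, of abs f])
  then show "\<omega> \<in> space N \<Longrightarrow> \<bar>f \<omega>\<bar> \<le> Max ((\<lambda>\<omega>. \<bar>f \<omega>\<bar>) ` space N)" for \<omega>
    by (intro Max_ge) auto
qed

context brownian_basis
begin

lemma simple_function_F_mono:
  assumes "simple_function (F s) f" "0 \<le> s" "s \<le> t" "t \<le> T"
  shows "simple_function (F t) f"
  using assms sets_F_mono[OF assms(2-4)] by (auto simp: simple_function_def)

text \<open>In the standard basis the inner product becomes a double sum of scalar coefficients
  \<open>C p q\<close> times products of coordinate increments. The covariance formula removes the
  terms with \<open>p\<close> different from \<open>q\<close> and produces the length of the overlap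
  as a common factor. The coefficients are bounded because simple functions take finitely many
  values.\<close>

lemma
  fixes A B :: "'a \<Rightarrow> (real ^ 'd) \<Rightarrow>\<^sub>L 'h::real_inner"
  assumes "0 \<le> a" "a \<le> b" "0 \<le> c" "c \<le> d" "b \<le> T" "d \<le> T"
    and A: "simple_function (F a) A" and B: "simple_function (F c) B"
  shows integrable_inner_increments:
      "integrable M (\<lambda>\<omega>. blinfun_apply (A \<omega>) (W b \<omega> - W a \<omega>) \<bullet> blinfun_apply (B \<omega>) (W d \<omega> - W c \<omega>))" (is ?int)
    and expectation_inner_increments:
      "expectation (\<lambda>\<omega>. blinfun_apply (A \<omega>) (W b \<omega> - W a \<omega>) \<bullet> blinfun_apply (B \<omega>) (W d \<omega> - W c \<omega>))
        = measure lborel ({a<..b} \<inter> {c<..d}) *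
          expectation (\<lambda>\<omega>. \<Sum>p\<in>UNIV. blinfun_apply (A \<omega>) (axis p 1) \<bullet> blinfun_apply (B \<omega>) (axis p 1))" (is ?eq)
    and integrable_inner_simple:
      "integrable M (\<lambda>\<omega>. \<Sum>p\<in>UNIV. blinfun_apply (A \<omega>) (axis p 1) \<bullet> blinfun_apply (B \<omega>) (axis p 1))" (is ?int')
proof -
  define C where "C p q \<omega> = blinfun_apply (A \<omega>) (axis p 1) \<bullet> blinfun_apply (B \<omega>) (axis q 1)" for p q \<omega>
  have sC: "simple_function (F (max a c)) (C p q)" for p q
  proof -
    have "simple_function (F (max a c)) A" "simple_function (F (max a c)) B"
      using assms by (auto intro: simple_function_F_mono)
    then show ?thesis unfolding C_def[abs_def]
      by (rule simple_function_compose2[where h="\<lambda>u v. blinfun_apply u (axis p 1) \<bullet> blinfun_apply v (axis q 1)"])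
  qed
  have mC: "C p q \<in> borel_measurable (F (max a c))" for p q
    using sC by (rule borel_measurable_simple_function)
  then have mCM: "C p q \<in> borel_measurable M" for p q
    by (rule measurable_F_M) (use assms in auto)
  have "\<exists>K. \<forall>\<omega>\<in>space M. \<bar>C p q \<omega>\<bar> \<le> K" for p q
    using simple_function_bounded[OF sC[of p q]] assms by (metis (no_types, lifting) atLeastAtMost_iff max.coboundedI1 max_def order_trans space_F)
  then obtain K where K: "\<And>p q \<omega>. \<omega> \<in> space M \<Longrightarrow> \<bar>C p q \<omega>\<bar> \<le> K p q" by metis
  have expand: "blinfun_apply (A \<omega>) (W b \<omega> - W a \<omega>) \<bullet> blinfun_apply (B \<omega>) (W d \<omega> - W c \<omega>)
      = (\<Sum>p\<in>UNIV. \<Sum>q\<in>UNIV. C p q \<omega> * (W b \<omega> - W a \<omega>) $ p * (W d \<omega> - W c \<omega>) $ q)" for \<omega>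
    unfolding blinfun_apply_vec[of "A \<omega>" "W b \<omega> - W a \<omega>"] blinfun_apply_vec[of "B \<omega>" "W d \<omega> - W c \<omega>"]
    by (simp add: inner_sum_left inner_sum_right C_def mult_ac sum_distrib_left del: vector_minus_component)
      (rule sum.swap)
  have int: "integrable M (\<lambda>\<omega>. C p q \<omega> * (W b \<omega> - W a \<omega>) $ p * (W d \<omega> - W c \<omega>) $ q)" for p q
    by (rule integrable_bounded_mult_increments[OF assms(1-4) mCM K])
  show ?int unfolding expand using int by (intro Bochner_Integration.integrable_sum)
  have intC: "integrable M (C p q)" for p q
    by (rule integrable_const_bound[OF _ mCM]) (use K in \<open>auto intro!: AE_I2\<close>)
  then show ?int' unfolding C_def by (intro Bochner_Integration.integrable_sum)
  have "expectation (\<lambda>\<omega>. blinfun_apply (A \<omega>) (W b \<omega> - W a \<omega>) \<bullet> blinfun_apply (B \<omega>) (W d \<omega> - W c \<omega>))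
    = (\<Sum>p\<in>UNIV. \<Sum>q\<in>UNIV. expectation (\<lambda>\<omega>. C p q \<omega> * (W b \<omega> - W a \<omega>) $ p * (W d \<omega> - W c \<omega>) $ q))"
    unfolding expand using int by (simp del: vector_minus_component)
  also have "\<dots> = (\<Sum>p\<in>UNIV. \<Sum>q\<in>UNIV. expectation (C p q) *
      (if p = q then measure lborel ({a<..b} \<inter> {c<..d}) else 0))"
    by (intro sum.cong refl increment_covariance[OF assms(1-6) mC K])
  also have "\<dots> = (\<Sum>p\<in>UNIV. \<Sum>q\<in>UNIV. if p = q then expectation (C p q) * measure lborel ({a<..b} \<inter> {c<..d}) else 0)"
    by (intro sum.cong refl) (simp split: if_split)
  also have "\<dots> = (\<Sum>p\<in>UNIV. expectation (C p p)) * measure lborel ({a<..b} \<inter> {c<..d})"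
    by (simp only: sum.delta[OF finite] if_True UNIV_I sum_distrib_right sum.delta'[OF finite])
  also have "(\<Sum>p\<in>UNIV. expectation (C p p)) = expectation (\<lambda>\<omega>. \<Sum>p\<in>UNIV. C p p \<omega>)"
    using intC by simp
  finally show ?eq by (simp only: C_def mult.commute)
qed

text \<open>The intervals may overlap. Hence the difference of two elementary integrals over different partitions
  is covered without passing to a common refinement.\<close>

lemma ito_isometry_sum:
  fixes A :: "'i \<Rightarrow> 'a \<Rightarrow> (real ^ 'd) \<Rightarrow>\<^sub>L 'h::real_inner"
  assumes "finite I" and ab: "\<And>i. i \<in> I \<Longrightarrow> 0 \<le> a i \<and> a i \<le> b i \<and> b i \<le> t" and "t \<le> T"
    and A: "\<And>i. i \<in> I \<Longrightarrow> simple_function (F (a i)) (A i)"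
  shows "(\<integral>\<^sup>+\<omega>. ennreal ((norm (\<Sum>i\<in>I. blinfun_apply (A i \<omega>) (W (b i) \<omega> - W (a i) \<omega>)))\<^sup>2) \<partial>M)
    = (\<integral>\<^sup>+\<omega>. (\<integral>\<^sup>+s\<in>{0..t}.
        ennreal ((hilbert_schmidt_norm (\<Sum>i\<in>I. indicator {a i<..b i} s *\<^sub>R A i \<omega>))\<^sup>2) \<partial>lborel) \<partial>M)"
proof -
  define G where "G i j \<omega> = (\<Sum>p\<in>UNIV. blinfun_apply (A i \<omega>) (axis p 1) \<bullet> blinfun_apply (A j \<omega>) (axis p 1))" for i j \<omega>
  define m where "m i j = measure lborel ({a i<..b i} \<inter> {a j<..b j})" for i j
  let ?Y = "\<lambda>i \<omega>. blinfun_apply (A i \<omega>) (W (b i) \<omega> - W (a i) \<omega>)"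
  have ab': "0 \<le> a i" "a i \<le> b i" "b i \<le> T" if "i \<in> I" for i
    using ab[OF that] assms by auto
  note pair = ab'(1,2) ab'(1,2) ab'(3) ab'(3) A A
  have intG: "integrable M (G i j)" if "i \<in> I" "j \<in> I" for i j
    unfolding G_def[abs_def] using that
    by (intro integrable_inner_simple[where a="a i" and c="a j" and b="b i" and d="b j"] pair)
  have intY: "integrable M (\<lambda>\<omega>. ?Y i \<omega> \<bullet> ?Y j \<omega>)" if "i \<in> I" "j \<in> I" for i j
    using that by (intro integrable_inner_increments pair)
  have EY: "expectation (\<lambda>\<omega>. ?Y i \<omega> \<bullet> ?Y j \<omega>) = m i j * expectation (G i j)" if "i \<in> I" "j \<in> I" for i j
    unfolding G_def[abs_def] m_def using that by (intro expectation_inner_increments pair)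
  have nY: "(norm (\<Sum>i\<in>I. ?Y i \<omega>))\<^sup>2 = (\<Sum>i\<in>I. \<Sum>j\<in>I. ?Y i \<omega> \<bullet> ?Y j \<omega>)" for \<omega>
    by (rule norm_sum_square)
  have "(\<integral>\<^sup>+\<omega>. ennreal ((norm (\<Sum>i\<in>I. ?Y i \<omega>))\<^sup>2) \<partial>M) = ennreal (expectation (\<lambda>\<omega>. (norm (\<Sum>i\<in>I. ?Y i \<omega>))\<^sup>2))"
  proof (intro nn_integral_eq_integral)
    show "integrable M (\<lambda>\<omega>. (norm (\<Sum>i\<in>I. ?Y i \<omega>))\<^sup>2)"
      unfolding nY using intY by (intro Bochner_Integration.integrable_sum)
  qed simp
  also have "\<dots> = ennreal (\<Sum>i\<in>I. \<Sum>j\<in>I. m i j * expectation (G i j))"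
    unfolding nY using intY by (subst Bochner_Integration.integral_sum) (auto simp: EY intro!: arg_cong[where f=ennreal] sum.cong)
  also have "\<dots> = ennreal (expectation (\<lambda>\<omega>. \<Sum>i\<in>I. \<Sum>j\<in>I. m i j * G i j \<omega>))"
    using intG by (subst Bochner_Integration.integral_sum) (auto intro!: arg_cong[where f=ennreal] sum.cong)
  finally have lhs: "(\<integral>\<^sup>+\<omega>. ennreal ((norm (\<Sum>i\<in>I. ?Y i \<omega>))\<^sup>2) \<partial>M)
      = ennreal (expectation (\<lambda>\<omega>. \<Sum>i\<in>I. \<Sum>j\<in>I. m i j * G i j \<omega>))" .
  \<comment> \<open>Both sides of the isometry expand into the same quadratic form:
    \<open>m i j\<close> arose above as a covariance of increments and arises here as the integral
    of a product of two indicators.\<close>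
  let ?h = "\<lambda>\<omega> s. (hilbert_schmidt_norm (\<Sum>i\<in>I. indicator {a i<..b i} s *\<^sub>R A i \<omega>))\<^sup>2"
  have h: "?h \<omega> s = (\<Sum>i\<in>I. \<Sum>j\<in>I. indicator ({a i<..b i} \<inter> {a j<..b j}) s * G i j \<omega>)" for \<omega> s
  proof -
    have "?h \<omega> s = (\<Sum>p\<in>UNIV. \<Sum>i\<in>I. \<Sum>j\<in>I. indicator ({a i<..b i} \<inter> {a j<..b j}) s
        * (blinfun_apply (A i \<omega>) (axis p 1) \<bullet> blinfun_apply (A j \<omega>) (axis p 1)))"
      unfolding hilbert_schmidt_norm_square
      by (simp add: norm_sum_square blinfun.sum_left blinfun.scaleR_left
          indicator_inter_arith mult_ac del: Int_greaterThanAtMost)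
    also have "\<dots> = (\<Sum>i\<in>I. \<Sum>j\<in>I. indicator ({a i<..b i} \<inter> {a j<..b j}) s * G i j \<omega>)"
      unfolding G_def sum_distrib_left
      by (subst sum.swap) (intro sum.cong refl sum.swap)
    finally show ?thesis .
  qed
  have inter: "{a i<..b i} \<inter> {a j<..b j} = {max (a i) (a j)<..min (b i) (b j)}" for i j by auto
  have int_ind: "integrable lborel (\<lambda>s. indicator ({a i<..b i} \<inter> {a j<..b j}) s * x)" for i j and x :: real
  proof -
    have "emeasure lborel {u<..v} < \<infinity>" for u v :: real
      by (cases "u \<le> v") auto
    then show ?thesis
      unfolding inter by (intro integrable_mult_left integrable_real_indicator) auto
  qed
  \<comment> \<open>All intervals lie in \<open>{0..t}\<close>, so restricting the time integral
    changes nothing. Nonnegativity of the quadratic form is read off from the integral that it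
    represents.\<close>
  have path: "(\<integral>\<^sup>+s\<in>{0..t}. ennreal (?h \<omega> s) \<partial>lborel) = ennreal (\<Sum>i\<in>I. \<Sum>j\<in>I. m i j * G i j \<omega>)" 
    and pos: "0 \<le> (\<Sum>i\<in>I. \<Sum>j\<in>I. m i j * G i j \<omega>)" for \<omega>
  proof -
    have "(\<integral>\<^sup>+s\<in>{0..t}. ennreal (?h \<omega> s) \<partial>lborel) = (\<integral>\<^sup>+s. ennreal (?h \<omega> s) \<partial>lborel)"
    proof (rule nn_integral_cong)
      fix s
      show "ennreal (?h \<omega> s) * indicator {0..t} s = ennreal (?h \<omega> s)"
      proof (cases "s \<in> {0..t}")
        case False
        then have "indicator ({a i<..b i} \<inter> {a j<..b j}) s = (0::real)" if "i \<in> I" for i j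
          using ab[OF that] by (auto simp: indicator_def)
        then have "?h \<omega> s = 0" unfolding h by (intro sum.neutral ballI) simp
        then show ?thesis by simp
      qed simp
    qed
    also have "\<dots> = ennreal (LINT s|lborel. ?h \<omega> s)"
    proof (intro nn_integral_eq_integral)
      show "integrable lborel (?h \<omega>)"
        unfolding h using int_ind by (intro Bochner_Integration.integrable_sum)
    qed simp
    also have eq: "(LINT s|lborel. ?h \<omega> s) = (\<Sum>i\<in>I. \<Sum>j\<in>I. m i j * G i j \<omega>)"
      unfolding h using int_ind by (simp add: m_def inter)
    finally show "(\<integral>\<^sup>+s\<in>{0..t}. ennreal (?h \<omega> s) \<partial>lborel) = ennreal (\<Sum>i\<in>I. \<Sum>j\<in>I. m i j * G i j \<omega>)" .
    show "0 \<le> (\<Sum>i\<in>I. \<Sum>j\<in>I. m i j * G i j \<omega>)"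
      unfolding eq[symmetric] by (intro Bochner_Integration.integral_nonneg) simp
  qed
  show ?thesis
    unfolding lhs path using pos intG
    by (intro nn_integral_eq_integral[symmetric]) auto
qed

end

section \<open>Comparison and uniqueness of stochastic integrals\<close>

lemma norm_diff_square_le:
  fixes x y z :: "'b::real_normed_vector"
  shows "(norm (x - z))\<^sup>2 \<le> 2 * (norm (x - y))\<^sup>2 + 2 * (norm (y - z))\<^sup>2"
proof -
  have "norm (x - z) \<le> norm (x - y) + norm (y - z)"
    using norm_triangle_ineq[of "x - y" "y - z"] by simp
  then have "(norm (x - z))\<^sup>2 \<le> (norm (x - y) + norm (y - z))\<^sup>2"
    by (intro power_mono) auto
  also have "\<dots> \<le> 2 * (norm (x - y))\<^sup>2 + 2 * (norm (y - z))\<^sup>2"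
    using sum_squares_bound[of "norm (x - y)" "norm (y - z)"] by (simp add: power2_sum)
  finally show ?thesis .
qed

lemma hilbert_schmidt_norm_diff_square_le:
  "(hilbert_schmidt_norm (A - C))\<^sup>2 \<le> 2 * (hilbert_schmidt_norm (A - B))\<^sup>2 + 2 * (hilbert_schmidt_norm (B - C))\<^sup>2"
  unfolding hilbert_schmidt_norm_square sum_distrib_left sum.distrib[symmetric] blinfun.diff_left
  by (intro sum_mono norm_diff_square_le)

lemma hilbert_schmidt_norm_minus_commute: "hilbert_schmidt_norm (A - B) = hilbert_schmidt_norm (B - A)"
  by (simp add: hilbert_schmidt_norm_def blinfun.diff_left norm_minus_commute)

lemma elementary_integrandD:
  assumes "elementary_integrand F t n \<tau> A" "i < n"
  shows "0 \<le> \<tau> i" "\<tau> i \<le> \<tau> (Suc i)" "\<tau> (Suc i) \<le> t" "simple_function (F (\<tau> i)) (A i)"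
proof -
  have mono: "\<tau> j \<le> \<tau> k" if "j \<le> k" "k \<le> n" for j k
    using that
  proof (induction k)
    case (Suc k)
    then show ?case
      using assms(1) unfolding elementary_integrand_def
      by (metis Suc_leD Suc_le_lessD le_SucE order_refl order_trans)
  qed simp
  show "0 \<le> \<tau> i" using mono[of 0 i] assms by (auto simp: elementary_integrand_def)
  show "\<tau> i \<le> \<tau> (Suc i)" using assms by (auto simp: elementary_integrand_def)
  show "\<tau> (Suc i) \<le> t" using mono[of "Suc i" n] assms by (auto simp: elementary_integrand_def)
  show "simple_function (F (\<tau> i)) (A i)" using assms by (auto simp: elementary_integrand_def)
qed

lemma elementary_process_eq_0:
  assumes "elementary_integrand F t n \<tau> A" "s \<notin> {0<..t}"
  shows "elementary_process n \<tau> A s \<omega> = 0"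
  unfolding elementary_process_def
proof (rule sum.neutral, rule ballI)
  fix i assume "i \<in> {..<n}"
  then show "indicator {\<tau> i<..\<tau> (Suc i)} s *\<^sub>R A i \<omega> = 0"
    using elementary_integrandD[OF assms(1), of i] assms(2) by (auto simp: indicator_def)
qed

lemma elementary_integrand_mono:
  "elementary_integrand F s n \<tau> A \<Longrightarrow> s \<le> t \<Longrightarrow> elementary_integrand F t n \<tau> A"
  by (auto simp: elementary_integrand_def)

text \<open>The same elementary integrands serve on the longer interval: they vanish after
  \<open>s\<close>, as does the extended integrand, so both error terms are unchanged. This carries
  the integral over \<open>{0..\<xi>}\<close> from the Volterra equation to \<open>{0..t}\<close>
  when \<xi> \<le> \<open>t\<close>.\<close>

lemma has_ito_integral_extend:
  fixes \<Phi> :: "real \<Rightarrow> 'a \<Rightarrow> (real ^ 'd) \<Rightarrow>\<^sub>L 'h::{real_inner, banach, second_countable_topology}"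
  assumes "has_ito_integral M F W s \<Phi> Z" "s \<le> t"
  shows "has_ito_integral M F W t (\<lambda>u \<omega>. if u \<le> s then \<Phi> u \<omega> else 0) Z"
proof -
  let ?\<Psi> = "\<lambda>u \<omega>. if u \<le> s then \<Phi> u \<omega> else 0"
  obtain n \<tau> A where e: "\<And>k. elementary_integrand F s (n k) (\<tau> k) (A k)"
    and \<Phi>: "(\<lambda>k. \<integral>\<^sup>+\<omega>. (\<integral>\<^sup>+u\<in>{0..s}.
        ennreal ((hilbert_schmidt_norm (\<Phi> u \<omega> - elementary_process (n k) (\<tau> k) (A k) u \<omega>))\<^sup>2) \<partial>lborel) \<partial>M)
        \<longlonglongrightarrow> 0"
    and Z: "(\<lambda>k. \<integral>\<^sup>+\<omega>. ennreal ((norm (Z \<omega> - elementary_integral W (n k) (\<tau> k) (A k) \<omega>))\<^sup>2) \<partial>M) \<longlonglongrightarrow> 0"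
    using assms(1) unfolding has_ito_integral_def by blast
  have "(\<lambda>(u, \<omega>). blinfun_apply (?\<Psi> u \<omega>) x) \<in> borel_measurable (restrict_space lborel {0..t} \<Otimes>\<^sub>M M)" for x
  proof -
    have 1: "(\<lambda>(u, \<omega>). blinfun_apply (\<Phi> u \<omega>) x) \<in> borel_measurable (restrict_space lborel {0..s} \<Otimes>\<^sub>M M)"
      using assms(1) by (simp add: has_ito_integral_def)
    let ?N = "restrict_space lborel {0..t} \<Otimes>\<^sub>M M"
    have [measurable]: "{..s} \<times> space M \<inter> space ?N \<in> sets ?N"
    proof -
      have "{..s} \<inter> {0..t} \<in> sets (restrict_space lborel {0..t})"
        by (auto simp: sets_restrict_space)
      then have "({..s} \<inter> {0..t}) \<times> space M \<in> sets ?N" by auto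
      also have "({..s} \<inter> {0..t}) \<times> space M = {..s} \<times> space M \<inter> space ?N"
        by (auto simp: space_pair_measure space_restrict_space)
      finally show ?thesis .
    qed
    \<comment> \<open>Measurability is checked on two pieces. On the part with time at most
      \<open>s\<close> the identity maps into the product space over \<open>{0..s}\<close>, where
      \<Phi> is measurable; on the other part the function is 0.\<close>
    have "(\<lambda>z. if z \<in> {..s} \<times> space M then (case z of (u, \<omega>) \<Rightarrow> blinfun_apply (\<Phi> u \<omega>) x) else 0) \<in> borel_measurable ?N"
    proof (subst measurable_If_restrict_space_iff)
      show "{z \<in> space ?N. z \<in> {..s} \<times> space M} \<in> sets ?N"
        using \<open>{..s} \<times> space M \<inter> space ?N \<in> sets ?N\<close> by (simp add: Int_def conj_commute)
      have "(\<lambda>z. z) \<in> measurable (restrict_space ?N {z. z \<in> {..s} \<times> space M}) (restrict_space lborel {0..s} \<Otimes>\<^sub>M M)"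
      proof (rule measurable_pair)
        show "fst \<circ> (\<lambda>z. z) \<in> measurable (restrict_space ?N {z. z \<in> {..s} \<times> space M}) (restrict_space lborel {0..s})"
          unfolding measurable_restrict_space2_iff
        proof
          have "fst \<in> measurable ?N lborel"
            by (rule measurable_compose[OF measurable_fst]) (rule measurable_restrict_space1, simp)
          then show "fst \<circ> (\<lambda>z. z) \<in> measurable (restrict_space ?N {z. z \<in> {..s} \<times> space M}) lborel"
            by (simp add: comp_def measurable_restrict_space1)
          show "fst \<circ> (\<lambda>z. z) \<in> space (restrict_space ?N {z. z \<in> {..s} \<times> space M}) \<rightarrow> {0..s}"
            by (auto simp: space_restrict_space space_pair_measure)
        qed
        show "snd \<circ> (\<lambda>z. z) \<in> measurable (restrict_space ?N {z. z \<in> {..s} \<times> space M}) M"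
          by (simp add: comp_def measurable_restrict_space1)
      qed
      from measurable_compose[OF this 1]
      show "(\<lambda>z. case z of (u, \<omega>) \<Rightarrow> blinfun_apply (\<Phi> u \<omega>) x) \<in> borel_measurable (restrict_space ?N {z. z \<in> {..s} \<times> space M}) \<and>
         (\<lambda>z. 0) \<in> borel_measurable (restrict_space ?N {z. z \<notin> {..s} \<times> space M})"
        by simp
    qed
    then show ?thesis
      by (rule measurable_cong[THEN iffD1, rotated]) (auto simp: space_pair_measure split: if_splits)
  qed
  moreover have "(\<integral>\<^sup>+\<omega>. (\<integral>\<^sup>+u\<in>{0..t}.
        ennreal ((hilbert_schmidt_norm (?\<Psi> u \<omega> - elementary_process (n k) (\<tau> k) (A k) u \<omega>))\<^sup>2) \<partial>lborel) \<partial>M)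
     = (\<integral>\<^sup>+\<omega>. (\<integral>\<^sup>+u\<in>{0..s}.
        ennreal ((hilbert_schmidt_norm (\<Phi> u \<omega> - elementary_process (n k) (\<tau> k) (A k) u \<omega>))\<^sup>2) \<partial>lborel) \<partial>M)" for k
  proof (intro nn_integral_cong)
    fix \<omega> u
    show "ennreal ((hilbert_schmidt_norm (?\<Psi> u \<omega> - elementary_process (n k) (\<tau> k) (A k) u \<omega>))\<^sup>2) * indicator {0..t} u
      = ennreal ((hilbert_schmidt_norm (\<Phi> u \<omega> - elementary_process (n k) (\<tau> k) (A k) u \<omega>))\<^sup>2) * indicator {0..s} u"
      using assms(2) elementary_process_eq_0[OF e, of u k \<omega>]
      by (cases "u \<le> s") (auto simp: indicator_def hilbert_schmidt_norm_def)
  qed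
  ultimately show ?thesis
    unfolding has_ito_integral_def using assms e \<Phi> Z
    by (intro conjI allI exI[of _ n] exI[of _ \<tau>] exI[of _ A])
      (auto simp: has_ito_integral_def intro: elementary_integrand_mono)
qed

lemma has_ito_integral_cong:
  fixes \<Phi> :: "real \<Rightarrow> 'a \<Rightarrow> (real ^ 'd) \<Rightarrow>\<^sub>L 'h::{real_inner, banach, second_countable_topology}"
  assumes "has_ito_integral M F W t \<Phi> Z" "\<And>s \<omega>. s \<in> {0..t} \<Longrightarrow> \<Psi> s \<omega> = \<Phi> s \<omega>"
  shows "has_ito_integral M F W t \<Psi> Z"
proof -
  have 1: "(\<lambda>(s, \<omega>). blinfun_apply (\<Psi> s \<omega>) x) \<in> borel_measurable (restrict_space lborel {0..t} \<Otimes>\<^sub>M M) \<longleftrightarrow>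
    (\<lambda>(s, \<omega>). blinfun_apply (\<Phi> s \<omega>) x) \<in> borel_measurable (restrict_space lborel {0..t} \<Otimes>\<^sub>M M)" for x
    by (intro measurable_cong) (auto simp: space_pair_measure space_restrict_space assms(2))
  have 2: "(\<integral>\<^sup>+\<omega>. (\<integral>\<^sup>+s\<in>{0..t}. ennreal ((hilbert_schmidt_norm (\<Psi> s \<omega> - E s \<omega>))\<^sup>2) \<partial>lborel) \<partial>M)
    = (\<integral>\<^sup>+\<omega>. (\<integral>\<^sup>+s\<in>{0..t}. ennreal ((hilbert_schmidt_norm (\<Phi> s \<omega> - E s \<omega>))\<^sup>2) \<partial>lborel) \<partial>M)" for E
    by (intro nn_integral_cong) (auto simp: indicator_def assms(2))
  show ?thesis
    using assms(1) unfolding has_ito_integral_def 1 2 .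
qed

text \<open>Only the values of the operators at fixed vectors are known to be measurable. This is
  enough, since the squared Hilbert-Schmidt norm is a finite sum of squared norms of such
  values.\<close>

lemma measurable_hilbert_schmidt_diff:
  fixes \<Phi> :: "real \<Rightarrow> 'a \<Rightarrow> (real ^ 'd) \<Rightarrow>\<^sub>L 'h::{real_inner, second_countable_topology}"
  assumes "\<And>x. (\<lambda>(s, \<omega>). blinfun_apply (\<Phi> s \<omega>) x) \<in> borel_measurable (N \<Otimes>\<^sub>M M)"
    and "\<And>x. (\<lambda>(s, \<omega>). blinfun_apply (\<Psi> s \<omega>) x) \<in> borel_measurable (N \<Otimes>\<^sub>M M)"
  shows "(\<lambda>(s, \<omega>). (hilbert_schmidt_norm (\<Phi> s \<omega> - \<Psi> s \<omega>))\<^sup>2) \<in> borel_measurable (N \<Otimes>\<^sub>M M)"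
  unfolding hilbert_schmidt_norm_square blinfun.diff_left using assms by measurable

lemma nn_integral_diff_square_le:
  fixes X Y Z :: "'a \<Rightarrow> 'h::{real_normed_vector, second_countable_topology}"
  assumes [measurable]: "X \<in> borel_measurable M" "Y \<in> borel_measurable M" "Z \<in> borel_measurable M"
  shows "(\<integral>\<^sup>+\<omega>. ennreal ((norm (X \<omega> - Z \<omega>))\<^sup>2) \<partial>M)
    \<le> 2 * (\<integral>\<^sup>+\<omega>. ennreal ((norm (X \<omega> - Y \<omega>))\<^sup>2) \<partial>M) + 2 * (\<integral>\<^sup>+\<omega>. ennreal ((norm (Y \<omega> - Z \<omega>))\<^sup>2) \<partial>M)"
proof -
  have "(\<integral>\<^sup>+\<omega>. ennreal ((norm (X \<omega> - Z \<omega>))\<^sup>2) \<partial>M)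
    \<le> (\<integral>\<^sup>+\<omega>. 2 * ennreal ((norm (X \<omega> - Y \<omega>))\<^sup>2) + 2 * ennreal ((norm (Y \<omega> - Z \<omega>))\<^sup>2) \<partial>M)"
  proof (intro nn_integral_mono)
    fix \<omega>
    have "ennreal ((norm (X \<omega> - Z \<omega>))\<^sup>2) \<le> ennreal (2 * (norm (X \<omega> - Y \<omega>))\<^sup>2 + 2 * (norm (Y \<omega> - Z \<omega>))\<^sup>2)"
      by (intro ennreal_leI norm_diff_square_le)
    then show "ennreal ((norm (X \<omega> - Z \<omega>))\<^sup>2) \<le> 2 * ennreal ((norm (X \<omega> - Y \<omega>))\<^sup>2) + 2 * ennreal ((norm (Y \<omega> - Z \<omega>))\<^sup>2)"
      by (simp add: ennreal_plus ennreal_mult)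
  qed
  also have "\<dots> = 2 * (\<integral>\<^sup>+\<omega>. ennreal ((norm (X \<omega> - Y \<omega>))\<^sup>2) \<partial>M) + 2 * (\<integral>\<^sup>+\<omega>. ennreal ((norm (Y \<omega> - Z \<omega>))\<^sup>2) \<partial>M)"
    by (subst nn_integral_add) (measurable, simp add: nn_integral_cmult)
  finally show ?thesis .
qed

text \<open>Mean-square limits are compared in the extended nonnegative reals, so neither limit has
  to be square-integrable itself.\<close>

lemma nn_integral_limit_unique:
  fixes Z Z' :: "'a \<Rightarrow> 'h::{real_normed_vector, second_countable_topology}"
  assumes [measurable]: "Z \<in> borel_measurable M" "Z' \<in> borel_measurable M" "\<And>k. Y k \<in> borel_measurable M"
    and Z: "(\<lambda>k. \<integral>\<^sup>+\<omega>. ennreal ((norm (Z \<omega> - Y k \<omega>))\<^sup>2) \<partial>M) \<longlonglongrightarrow> 0"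
    and Z': "(\<lambda>k. \<integral>\<^sup>+\<omega>. ennreal ((norm (Z' \<omega> - Y k \<omega>))\<^sup>2) \<partial>M) \<longlonglongrightarrow> 0"
  shows "AE \<omega> in M. Z \<omega> = Z' \<omega>"
proof -
  have "(\<lambda>k. 2 * (\<integral>\<^sup>+\<omega>. ennreal ((norm (Z \<omega> - Y k \<omega>))\<^sup>2) \<partial>M)
      + 2 * (\<integral>\<^sup>+\<omega>. ennreal ((norm (Y k \<omega> - Z' \<omega>))\<^sup>2) \<partial>M)) \<longlonglongrightarrow> 2 * 0 + 2 * 0"
    unfolding norm_minus_commute[of "Y _ _" "Z' _"]
    by (intro tendsto_add ennreal_tendsto_cmult tendsto_const Z Z') auto
  then have "(\<integral>\<^sup>+\<omega>. ennreal ((norm (Z \<omega> - Z' \<omega>))\<^sup>2) \<partial>M) \<le> 2 * 0 + 2 * 0"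
    by (rule LIMSEQ_le_const) (auto intro!: exI[of _ 0] nn_integral_diff_square_le)
  then have "(\<integral>\<^sup>+\<omega>. ennreal ((norm (Z \<omega> - Z' \<omega>))\<^sup>2) \<partial>M) = 0"
    by simp
  then have "AE \<omega> in M. ennreal ((norm (Z \<omega> - Z' \<omega>))\<^sup>2) = 0"
    by (subst (asm) nn_integral_0_iff_AE) measurable
  then show ?thesis by (rule eventually_mono) simp
qed

section \<open>Comparison of an integral with arbitrary elementary integrals\<close>

context brownian_basis
begin

lemma elementary_integral_diff_isometry:
  fixes A B :: "nat \<Rightarrow> 'a \<Rightarrow> (real ^ 'd) \<Rightarrow>\<^sub>L 'h::real_inner"
  assumes A: "elementary_integrand F t n \<tau> A" and B: "elementary_integrand F t m \<rho> B" and "t \<le> T"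
  shows "(\<integral>\<^sup>+\<omega>. ennreal ((norm (elementary_integral W n \<tau> A \<omega> - elementary_integral W m \<rho> B \<omega>))\<^sup>2) \<partial>M)
    = (\<integral>\<^sup>+\<omega>. (\<integral>\<^sup>+s\<in>{0..t}. ennreal ((hilbert_schmidt_norm
        (elementary_process n \<tau> A s \<omega> - elementary_process m \<rho> B s \<omega>))\<^sup>2) \<partial>lborel) \<partial>M)"
proof -
  \<comment> \<open>The two partitions are placed side by side in a disjoint sum, the second family
    with negated coefficients, so that the difference is a single sum over possibly overlapping
    intervals.\<close>
  define I where "I = {..<n} <+> {..<m}"
  define a where "a = case_sum \<tau> \<rho>"
  define b where "b = case_sum (\<lambda>i. \<tau> (Suc i)) (\<lambda>i. \<rho> (Suc i))"
  define D where "D = case_sum A (\<lambda>i \<omega>. - B i \<omega>)"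
  have "finite I" by (simp add: I_def)
  moreover have "0 \<le> a i \<and> a i \<le> b i \<and> b i \<le> t" if "i \<in> I" for i
    using that elementary_integrandD[OF A] elementary_integrandD[OF B] by (auto simp: I_def a_def b_def)
  moreover have "simple_function (F (a i)) (D i)" if "i \<in> I" for i
    using that elementary_integrandD(4)[OF A] simple_function_compose1[OF elementary_integrandD(4)[OF B], of _ uminus]
    by (auto simp: I_def a_def D_def)
  moreover have "(\<Sum>i\<in>I. blinfun_apply (D i \<omega>) (W (b i) \<omega> - W (a i) \<omega>))
    = elementary_integral W n \<tau> A \<omega> - elementary_integral W m \<rho> B \<omega>" for \<omega>
    unfolding I_def by (subst sum.Plus)
      (auto simp: elementary_integral_def D_def a_def b_def comp_def blinfun.minus_left sum_negf)
  moreover have "(\<Sum>i\<in>I. indicator {a i<..b i} s *\<^sub>R D i \<omega>)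
    = elementary_process n \<tau> A s \<omega> - elementary_process m \<rho> B s \<omega>" for s \<omega>
    unfolding I_def by (subst sum.Plus)
      (auto simp: elementary_process_def D_def a_def b_def comp_def sum_negf)
  ultimately show ?thesis
    using ito_isometry_sum[of I a b t D] \<open>t \<le> T\<close> by simp
qed

lemma measurable_elementary_coefficient:
  fixes A :: "nat \<Rightarrow> 'a \<Rightarrow> (real ^ 'd) \<Rightarrow>\<^sub>L 'h::{real_inner, second_countable_topology}"
  assumes "elementary_integrand F t n \<tau> A" "t \<le> T" "i < n"
  shows "(\<lambda>\<omega>. blinfun_apply (A i \<omega>) x) \<in> borel_measurable M"
proof -
  note D = elementary_integrandD[OF assms(1,3)]
  have "(\<lambda>\<omega>. blinfun_apply (A i \<omega>) x) \<in> borel_measurable (F (\<tau> i))"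
    by (rule borel_measurable_simple_function) (rule simple_function_compose1[OF D(4)])
  then show ?thesis
    by (rule measurable_F_M) (use D assms in auto)
qed

lemma measurable_elementary_process:
  fixes A :: "nat \<Rightarrow> 'a \<Rightarrow> (real ^ 'd) \<Rightarrow>\<^sub>L 'h::{real_inner, second_countable_topology}"
  assumes "elementary_integrand F t n \<tau> A" "t \<le> T"
  shows "(\<lambda>(s, \<omega>). blinfun_apply (elementary_process n \<tau> A s \<omega>) x) \<in> borel_measurable (borel \<Otimes>\<^sub>M M)"
proof -
  have [measurable]: "(\<lambda>\<omega>. blinfun_apply (A i \<omega>) x) \<in> borel_measurable M" if "i \<in> {..<n}" for i
    using that by (intro measurable_elementary_coefficient[OF assms]) simp
  show ?thesis
    unfolding elementary_process_def blinfun.sum_left blinfun.scaleR_left by measurable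
qed

lemma measurable_elementary_integral:
  fixes A :: "nat \<Rightarrow> 'a \<Rightarrow> (real ^ 'd) \<Rightarrow>\<^sub>L 'h::{real_inner, second_countable_topology}"
  assumes "elementary_integrand F t n \<tau> A" "t \<le> T"
  shows "elementary_integral W n \<tau> A \<in> borel_measurable M"
proof -
  have [measurable]: "(\<lambda>\<omega>. blinfun_apply (A i \<omega>) x) \<in> borel_measurable M" if "i \<in> {..<n}" for i x
    using that by (intro measurable_elementary_coefficient[OF assms]) simp
  have [measurable]: "W (\<tau> i) \<in> borel_measurable M" "W (\<tau> (Suc i)) \<in> borel_measurable M" if "i \<in> {..<n}" for i
    using elementary_integrandD[OF assms(1), of i] that by (auto intro: measurable_W)
  show ?thesis
    unfolding elementary_integral_def[abs_def] blinfun_apply_vec[of _ "W _ _ - W _ _"] by measurable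
qed

lemma hilbert_schmidt_distance_triangle:
  fixes \<Phi> :: "real \<Rightarrow> 'a \<Rightarrow> (real ^ 'd) \<Rightarrow>\<^sub>L 'h::{real_inner, second_countable_topology}"
  assumes A: "elementary_integrand F t n \<tau> A" and B: "elementary_integrand F t m \<rho> B" and "t \<le> T"
    and \<Phi>: "\<And>x. (\<lambda>(s, \<omega>). blinfun_apply (\<Phi> s \<omega>) x) \<in> borel_measurable (restrict_space lborel {0..t} \<Otimes>\<^sub>M M)"
  shows "(\<integral>\<^sup>+\<omega>. (\<integral>\<^sup>+s\<in>{0..t}. ennreal ((hilbert_schmidt_norm
        (elementary_process n \<tau> A s \<omega> - elementary_process m \<rho> B s \<omega>))\<^sup>2) \<partial>lborel) \<partial>M)
    \<le> 2 * (\<integral>\<^sup>+\<omega>. (\<integral>\<^sup>+s\<in>{0..t}. ennreal ((hilbert_schmidt_norm (\<Phi> s \<omega> - elementary_process n \<tau> A s \<omega>))\<^sup>2) \<partial>lborel) \<partial>M)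
      + 2 * (\<integral>\<^sup>+\<omega>. (\<integral>\<^sup>+s\<in>{0..t}. ennreal ((hilbert_schmidt_norm (\<Phi> s \<omega> - elementary_process m \<rho> B s \<omega>))\<^sup>2) \<partial>lborel) \<partial>M)"
proof -
  let ?N = "restrict_space lborel {0..t}"
  interpret N: finite_measure ?N
    by (intro finite_measureI) (simp add: emeasure_restrict_space space_restrict_space emeasure_lborel_Icc_eq)
  have eq: "(\<integral>\<^sup>+s\<in>{0..t}. f s \<partial>lborel) = (\<integral>\<^sup>+s. f s \<partial>?N)" for f
    by (simp add: nn_integral_restrict_space)
  have E: "(\<lambda>(s, \<omega>). blinfun_apply (elementary_process n \<tau> A s \<omega>) x) \<in> borel_measurable (?N \<Otimes>\<^sub>M M)"
    if "elementary_integrand F t n \<tau> A" for n \<tau> x and A :: "nat \<Rightarrow> 'a \<Rightarrow> (real ^ 'd) \<Rightarrow>\<^sub>L 'h"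
  proof -
    have [measurable]: "fst \<in> borel_measurable (?N \<Otimes>\<^sub>M M)"
      by (rule measurable_compose[OF measurable_fst]) (rule measurable_restrict_space1, simp)
    have "(\<lambda>z. (fst z, snd z)) \<in> measurable (?N \<Otimes>\<^sub>M M) (borel \<Otimes>\<^sub>M M)"
      by measurable
    from measurable_compose[OF this measurable_elementary_process[OF that \<open>t \<le> T\<close>]] show ?thesis by simp
  qed
  have [measurable]: "(\<lambda>(\<omega>, s). (hilbert_schmidt_norm (\<Phi> s \<omega> - elementary_process n \<tau> A s \<omega>))\<^sup>2) \<in> borel_measurable (M \<Otimes>\<^sub>M ?N)"
    if "elementary_integrand F t n \<tau> A" for n \<tau> A
    using measurable_compose[OF measurable_pair_swap' measurable_hilbert_schmidt_diff[OF \<Phi> E[OF that]]]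
    by (simp add: case_prod_unfold)
  note [measurable] = this[OF A] this[OF B]
  have "(\<integral>\<^sup>+\<omega>. (\<integral>\<^sup>+s. ennreal ((hilbert_schmidt_norm
        (elementary_process n \<tau> A s \<omega> - elementary_process m \<rho> B s \<omega>))\<^sup>2) \<partial>?N) \<partial>M)
     \<le> (\<integral>\<^sup>+\<omega>. (\<integral>\<^sup>+s. 2 * ennreal ((hilbert_schmidt_norm (\<Phi> s \<omega> - elementary_process n \<tau> A s \<omega>))\<^sup>2)
       + 2 * ennreal ((hilbert_schmidt_norm (\<Phi> s \<omega> - elementary_process m \<rho> B s \<omega>))\<^sup>2) \<partial>?N) \<partial>M)"
  proof (intro nn_integral_mono)
    fix \<omega> s
    let ?a = "elementary_process n \<tau> A s \<omega>" and ?b = "elementary_process m \<rho> B s \<omega>"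
    have "ennreal ((hilbert_schmidt_norm (?a - ?b))\<^sup>2)
      \<le> ennreal (2 * (hilbert_schmidt_norm (\<Phi> s \<omega> - ?a))\<^sup>2 + 2 * (hilbert_schmidt_norm (\<Phi> s \<omega> - ?b))\<^sup>2)"
      using hilbert_schmidt_norm_diff_square_le[of ?a ?b "\<Phi> s \<omega>"]
      by (intro ennreal_leI) (simp add: hilbert_schmidt_norm_minus_commute[of ?a "\<Phi> s \<omega>"])
    then show "ennreal ((hilbert_schmidt_norm (?a - ?b))\<^sup>2)
      \<le> 2 * ennreal ((hilbert_schmidt_norm (\<Phi> s \<omega> - ?a))\<^sup>2) + 2 * ennreal ((hilbert_schmidt_norm (\<Phi> s \<omega> - ?b))\<^sup>2)"
      by (simp add: ennreal_plus ennreal_mult)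
  qed
  also have "\<dots> = 2 * (\<integral>\<^sup>+\<omega>. (\<integral>\<^sup>+s. ennreal ((hilbert_schmidt_norm (\<Phi> s \<omega> - elementary_process n \<tau> A s \<omega>))\<^sup>2) \<partial>?N) \<partial>M)
      + 2 * (\<integral>\<^sup>+\<omega>. (\<integral>\<^sup>+s. ennreal ((hilbert_schmidt_norm (\<Phi> s \<omega> - elementary_process m \<rho> B s \<omega>))\<^sup>2) \<partial>?N) \<partial>M)"
  proof -
    have "(\<integral>\<^sup>+\<omega>. (\<integral>\<^sup>+s. 2 * ennreal ((hilbert_schmidt_norm (\<Phi> s \<omega> - elementary_process n \<tau> A s \<omega>))\<^sup>2)
       + 2 * ennreal ((hilbert_schmidt_norm (\<Phi> s \<omega> - elementary_process m \<rho> B s \<omega>))\<^sup>2) \<partial>?N) \<partial>M)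
      = (\<integral>\<^sup>+\<omega>. 2 * (\<integral>\<^sup>+s. ennreal ((hilbert_schmidt_norm (\<Phi> s \<omega> - elementary_process n \<tau> A s \<omega>))\<^sup>2) \<partial>?N)
       + 2 * (\<integral>\<^sup>+s. ennreal ((hilbert_schmidt_norm (\<Phi> s \<omega> - elementary_process m \<rho> B s \<omega>))\<^sup>2) \<partial>?N) \<partial>M)"
      by (intro nn_integral_cong) (subst nn_integral_add, measurable, simp add: nn_integral_cmult)
    also have "\<dots> = 2 * (\<integral>\<^sup>+\<omega>. (\<integral>\<^sup>+s. ennreal ((hilbert_schmidt_norm (\<Phi> s \<omega> - elementary_process n \<tau> A s \<omega>))\<^sup>2) \<partial>?N) \<partial>M)
      + 2 * (\<integral>\<^sup>+\<omega>. (\<integral>\<^sup>+s. ennreal ((hilbert_schmidt_norm (\<Phi> s \<omega> - elementary_process m \<rho> B s \<omega>))\<^sup>2) \<partial>?N) \<partial>M)"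
      by (subst nn_integral_add) (measurable, simp add: nn_integral_cmult)
    finally show ?thesis .
  qed
  finally show ?thesis unfolding eq .
qed

text \<open>The constant 4 is 2 times 2: the inequality for squares of sums is used once to pass
  from \<open>Z\<close> to its approximations and once, after the isometry, to pass from the
  approximations to \<Phi>. The error terms of the approximating sequence vanish in the limit, so
  the sequence no longer appears in the result. Uniqueness and the grid estimate both rest on this
  bound.\<close>

lemma has_ito_integral_bound:
  fixes \<Phi> :: "real \<Rightarrow> 'a \<Rightarrow> (real ^ 'd) \<Rightarrow>\<^sub>L 'h::{real_inner, banach, second_countable_topology}"
  assumes "has_ito_integral M F W t \<Phi> Z" and B: "elementary_integrand F t m \<rho> B" and "t \<le> T"
  shows "(\<integral>\<^sup>+\<omega>. ennreal ((norm (Z \<omega> - elementary_integral W m \<rho> B \<omega>))\<^sup>2) \<partial>M)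
    \<le> 4 * (\<integral>\<^sup>+\<omega>. (\<integral>\<^sup>+s\<in>{0..t}. ennreal ((hilbert_schmidt_norm (\<Phi> s \<omega> - elementary_process m \<rho> B s \<omega>))\<^sup>2) \<partial>lborel) \<partial>M)"
    (is "?l \<le> 4 * ?Q")
proof -
  let ?y = "\<lambda>n \<tau> A. \<integral>\<^sup>+\<omega>. (\<integral>\<^sup>+u\<in>{0..t}. ennreal ((hilbert_schmidt_norm (\<Phi> u \<omega> - elementary_process n \<tau> A u \<omega>))\<^sup>2) \<partial>lborel) \<partial>M"
  let ?z = "\<lambda>n \<tau> A. \<integral>\<^sup>+\<omega>. ennreal ((norm (Z \<omega> - elementary_integral W n \<tau> A \<omega>))\<^sup>2) \<partial>M"
  obtain n \<tau> A where e: "\<And>k. elementary_integrand F t (n k) (\<tau> k) (A k)"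
    and y: "(\<lambda>k. ?y (n k) (\<tau> k) (A k)) \<longlonglongrightarrow> 0" and z: "(\<lambda>k. ?z (n k) (\<tau> k) (A k)) \<longlonglongrightarrow> 0"
    using assms(1) unfolding has_ito_integral_def by blast
  have Z: "Z \<in> borel_measurable M" and \<Phi>: "\<And>x. (\<lambda>(s, \<omega>). blinfun_apply (\<Phi> s \<omega>) x)
      \<in> borel_measurable (restrict_space lborel {0..t} \<Otimes>\<^sub>M M)"
    using assms(1) by (auto simp: has_ito_integral_def)
  have le: "?l \<le> 2 * ?z (n k) (\<tau> k) (A k) + 2 * (2 * ?y (n k) (\<tau> k) (A k) + 2 * ?Q)" for k
  proof -
    note [measurable] = measurable_elementary_integral[OF e \<open>t \<le> T\<close>] measurable_elementary_integral[OF B \<open>t \<le> T\<close>] Z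
    have "?l \<le> 2 * ?z (n k) (\<tau> k) (A k) + 2 * (\<integral>\<^sup>+\<omega>. ennreal ((norm
        (elementary_integral W (n k) (\<tau> k) (A k) \<omega> - elementary_integral W m \<rho> B \<omega>))\<^sup>2) \<partial>M)"
      by (rule nn_integral_diff_square_le) measurable
    also have "\<dots> \<le> 2 * ?z (n k) (\<tau> k) (A k) + 2 * (2 * ?y (n k) (\<tau> k) (A k) + 2 * ?Q)"
      unfolding elementary_integral_diff_isometry[OF e B \<open>t \<le> T\<close>]
      by (intro add_left_mono mult_left_mono hilbert_schmidt_distance_triangle[OF e B \<open>t \<le> T\<close> \<Phi>]) simp
    finally show ?thesis .
  qed
  have "(\<lambda>k. 2 * ?z (n k) (\<tau> k) (A k) + 2 * (2 * ?y (n k) (\<tau> k) (A k) + 2 * ?Q)) \<longlonglongrightarrow> 2 * 0 + 2 * (2 * 0 + 2 * ?Q)"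
    by (intro tendsto_add ennreal_tendsto_cmult tendsto_const y z) auto
  then have "?l \<le> 2 * 0 + 2 * (2 * 0 + 2 * ?Q)"
    by (rule LIMSEQ_le_const) (use le in blast)
  also have "\<dots> = 4 * ?Q"
    by (simp add: mult.assoc[symmetric])
  finally show ?thesis .
qed

text \<open>By the preceding bound, the sequence that approximates \<open>Z'\<close> also
  approximates \<open>Z\<close>.\<close>

lemma has_ito_integral_unique:
  fixes \<Phi> :: "real \<Rightarrow> 'a \<Rightarrow> (real ^ 'd) \<Rightarrow>\<^sub>L 'h::{real_inner, banach, second_countable_topology}"
  assumes 1: "has_ito_integral M F W t \<Phi> Z" and 2: "has_ito_integral M F W t \<Phi> Z'" and "t \<le> T"
  shows "AE \<omega> in M. Z \<omega> = Z' \<omega>"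
proof -
  let ?y = "\<lambda>n \<tau> A. \<integral>\<^sup>+\<omega>. (\<integral>\<^sup>+u\<in>{0..t}. ennreal ((hilbert_schmidt_norm (\<Phi> u \<omega> - elementary_process n \<tau> A u \<omega>))\<^sup>2) \<partial>lborel) \<partial>M"
  obtain n \<tau> A where e: "\<And>k. elementary_integrand F t (n k) (\<tau> k) (A k)"
    and y: "(\<lambda>k. ?y (n k) (\<tau> k) (A k)) \<longlonglongrightarrow> 0"
    and z: "(\<lambda>k. \<integral>\<^sup>+\<omega>. ennreal ((norm (Z' \<omega> - elementary_integral W (n k) (\<tau> k) (A k) \<omega>))\<^sup>2) \<partial>M) \<longlonglongrightarrow> 0"
    using 2 unfolding has_ito_integral_def by blast
  have "(\<lambda>k. 4 * ?y (n k) (\<tau> k) (A k)) \<longlonglongrightarrow> 4 * 0"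
    by (intro ennreal_tendsto_cmult y) simp
  then have "(\<lambda>k. 4 * ?y (n k) (\<tau> k) (A k)) \<longlonglongrightarrow> 0"
    by simp
  then have "(\<lambda>k. \<integral>\<^sup>+\<omega>. ennreal ((norm (Z \<omega> - elementary_integral W (n k) (\<tau> k) (A k) \<omega>))\<^sup>2) \<partial>M) \<longlonglongrightarrow> 0"
    by (rule tendsto_sandwich[OF _ _ tendsto_const, rotated 2])
      (auto intro!: always_eventually has_ito_integral_bound[OF 1 e \<open>t \<le> T\<close>])
  moreover have "Z \<in> borel_measurable M" "Z' \<in> borel_measurable M"
    using 1 2 by (auto simp: has_ito_integral_def)
  ultimately show ?thesis
    using z by (intro nn_integral_limit_unique[OF _ _ measurable_elementary_integral[OF e \<open>t \<le> T\<close>]])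
qed

text \<open>\<open>ito_integral\<close> selects one version by choice, so it can be identified with
  a given version only almost everywhere, for one integrand and one upper limit at a time.\<close>

lemma ito_integral_eq:
  fixes \<Phi> :: "real \<Rightarrow> 'a \<Rightarrow> (real ^ 'd) \<Rightarrow>\<^sub>L 'h::{real_inner, banach, second_countable_topology}"
  assumes "has_ito_integral M F W t \<Phi> Z" "t \<le> T"
  shows "AE \<omega> in M. ito_integral M F W t \<Phi> \<omega> = Z \<omega>"
  using someI[of "has_ito_integral M F W t \<Phi>", OF assms(1)] assms
  unfolding ito_integral_def by (intro has_ito_integral_unique) auto

end

section \<open>The fractional kernel\<close>

text \<open>With the kernel extended by zero, a single integrand on the full interval
  \<open>{0..t}\<close> covers the positions \<xi> on both sides of \<open>t\<close>, and the
  indicator of \<open>t < \<xi>\<close> in the lifted coefficients is built in.\<close>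

definition causal_kernel :: "(real \<Rightarrow> real) \<Rightarrow> real \<Rightarrow> real" where
  "causal_kernel k u = (if 0 < u then k u else 0)"

lemma measurable_causal_fractional_kernel [measurable]:
  "causal_kernel (fractional_kernel \<alpha>) \<in> borel_measurable borel"
  unfolding causal_kernel_def[abs_def] fractional_kernel_def by measurable

text \<open>The integral of the squared fractional kernel over an interval from 0 to
  \<open>h\<close>; it is finite because the exponent \<open>2 * \<alpha> - 2\<close> exceeds
  -1.\<close>

definition fractional_energy :: "real \<Rightarrow> real \<Rightarrow> real" where
  "fractional_energy \<alpha> h = h powr (2 * \<alpha> - 1) / ((Gamma \<alpha>)\<^sup>2 * (2 * \<alpha> - 1))"

lemma fractional_energy_nonneg: "1/2 < \<alpha> \<Longrightarrow> 0 \<le> fractional_energy \<alpha> h"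
  by (simp add: fractional_energy_def)

lemma fractional_energy_mono: "1/2 < \<alpha> \<Longrightarrow> 0 \<le> g \<Longrightarrow> g \<le> h \<Longrightarrow> fractional_energy \<alpha> g \<le> fractional_energy \<alpha> h"
  unfolding fractional_energy_def by (intro divide_right_mono powr_mono2) auto

lemma nn_integral_causal_fractional_kernel_square:
  assumes "1/2 < \<alpha>" "0 \<le> r" "r \<le> T"
  shows "(\<integral>\<^sup>+\<xi>\<in>{0..T}. ennreal ((causal_kernel (fractional_kernel \<alpha>) (\<xi> - r))\<^sup>2) \<partial>lborel)
    = ennreal (fractional_energy \<alpha> (T - r))"
proof -
  define c where "c = 1 / (Gamma \<alpha>)\<^sup>2"
  have "((\<lambda>x. c * x powr (2 * \<alpha> - 2)) has_integral c * ((T - r) powr (2 * \<alpha> - 2 + 1) / (2 * \<alpha> - 2 + 1))) {0..T - r}"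
    using assms by (intro has_integral_mult_right has_integral_powr_from_0) auto
  also have "c * ((T - r) powr (2 * \<alpha> - 2 + 1) / (2 * \<alpha> - 2 + 1)) = fractional_energy \<alpha> (T - r)"
    by (simp add: c_def fractional_energy_def)
  finally have I: "((\<lambda>x. c * x powr (2 * \<alpha> - 2)) has_integral fractional_energy \<alpha> (T - r)) {0..T - r}" .
  have "(\<integral>\<^sup>+\<xi>\<in>{0..T}. ennreal ((causal_kernel (fractional_kernel \<alpha>) (\<xi> - r))\<^sup>2) \<partial>lborel)
    = (\<integral>\<^sup>+x. ennreal ((causal_kernel (fractional_kernel \<alpha>) (r + 1 * x - r))\<^sup>2) * indicator {0..T} (r + 1 * x) \<partial>lborel)"
    by (subst nn_integral_real_affine[where c=1 and t=r]) auto
  also have "\<dots> = (\<integral>\<^sup>+x. ennreal (indicator {0..T - r} x * (c * x powr (2 * \<alpha> - 2))) \<partial>lborel)"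
  proof (rule nn_integral_cong)
    fix x :: real
    have "((x powr (\<alpha> - 1)))\<^sup>2 = x powr (2 * \<alpha> - 2)" if "0 < x"
      by (simp add: power2_eq_square powr_add[symmetric])
    \<comment> \<open>At \<open>x = 0\<close> both sides are 0, since 0 to any \<open>powr\<close>
      is 0.\<close>
    then have "(causal_kernel (fractional_kernel \<alpha>) x)\<^sup>2 = c * x powr (2 * \<alpha> - 2)" if "0 \<le> x"
      using that by (cases "x = 0") (simp_all add: causal_kernel_def fractional_kernel_def power_divide c_def)
    moreover have "causal_kernel (fractional_kernel \<alpha>) x = 0" if "x < 0"
      using that by (simp add: causal_kernel_def)
    ultimately show "ennreal ((causal_kernel (fractional_kernel \<alpha>) (r + 1 * x - r))\<^sup>2) * indicator {0..T} (r + 1 * x)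
      = ennreal (indicator {0..T - r} x * (c * x powr (2 * \<alpha> - 2)))"
      using assms by (cases "0 \<le> x") (auto simp: indicator_def)
  qed
  also have "\<dots> = ennreal (fractional_energy \<alpha> (T - r))"
    by (rule nn_integral_has_integral_lebesgue[OF _ I]) (auto simp: c_def)
  finally show ?thesis .
qed

lemma causal_fractional_kernel_antimono:
  assumes "1/2 < \<alpha>" "\<alpha> < 1" "0 < u" "u \<le> v"
  shows "causal_kernel (fractional_kernel \<alpha>) v \<le> causal_kernel (fractional_kernel \<alpha>) u"
  using assms unfolding causal_kernel_def fractional_kernel_def
  by (auto intro!: divide_right_mono powr_mono2' less_imp_le[OF Gamma_real_pos])

lemma causal_fractional_kernel_nonneg:
  "1/2 < \<alpha> \<Longrightarrow> 0 \<le> causal_kernel (fractional_kernel \<alpha>) v"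
  unfolding causal_kernel_def fractional_kernel_def
  by (auto intro!: divide_nonneg_nonneg less_imp_le[OF Gamma_real_pos])

text \<open>For \<open>0 \<le> a \<le> b\<close> one has $(b-a)^2\le b^2-a^2$, so monotonicity of the kernel replaces the usual
  density argument for the continuity of translations in $L^2$.\<close>

lemma fractional_kernel_translation:
  assumes "1/2 < \<alpha>" "\<alpha> < 1" "0 \<le> r" "r \<le> s" "s \<le> T"
  shows "(\<integral>\<^sup>+\<xi>\<in>{0..T}. ennreal ((causal_kernel (fractional_kernel \<alpha>) (\<xi> - s)
      - causal_kernel (fractional_kernel \<alpha>) (\<xi> - r))\<^sup>2) \<partial>lborel) \<le> ennreal (2 * fractional_energy \<alpha> (s - r))"
    (is "?L \<le> _")
proof -
  let ?k = "causal_kernel (fractional_kernel \<alpha>)"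
  let ?e = "fractional_energy \<alpha>"
  \<comment> \<open>The energy of the earlier kernel is added on the left to avoid subtraction in
    \<open>ennreal\<close>. Up to \<open>s\<close> the later kernel vanishes and the earlier one is
    counted twice, giving twice the energy of length \<open>s - r\<close>; beyond \<open>s\<close>
    the sum is at most the square of the later kernel. The energy is monotone, so the added finite
    term can be cancelled at the end.\<close>
  have "?L + ennreal (?e (T - r))
    = (\<integral>\<^sup>+\<xi>. ennreal ((?k (\<xi> - s) - ?k (\<xi> - r))\<^sup>2) * indicator {0..T} \<xi>
        + ennreal ((?k (\<xi> - r))\<^sup>2) * indicator {0..T} \<xi> \<partial>lborel)"
    using assms by (subst nn_integral_add) (auto simp: nn_integral_causal_fractional_kernel_square)
  also have "\<dots> \<le> (\<integral>\<^sup>+\<xi>. ennreal ((?k (\<xi> - s))\<^sup>2) * indicator {0..T} \<xi>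
      + 2 * (ennreal ((?k (\<xi> - r))\<^sup>2) * indicator {0..s} \<xi>) \<partial>lborel)"
  proof (rule nn_integral_mono)
    fix \<xi> :: real
    define a where "a = ?k (\<xi> - r)"
    define b where "b = ?k (\<xi> - s)"
    have ab: "0 \<le> a" "0 \<le> b" using assms by (auto simp: a_def b_def causal_fractional_kernel_nonneg)
    show "ennreal ((b - a)\<^sup>2) * indicator {0..T} \<xi> + ennreal (a\<^sup>2) * indicator {0..T} \<xi>
      \<le> ennreal (b\<^sup>2) * indicator {0..T} \<xi> + 2 * (ennreal (a\<^sup>2) * indicator {0..s} \<xi>)"
    proof (cases "\<xi> \<in> {0..T}")
      case in_T: True
      show ?thesis
      proof (cases "\<xi> \<le> s")
        case True
        then have "b = 0" by (simp add: b_def causal_kernel_def)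
        then show ?thesis using True in_T by (simp add: mult_2)
      next
        case False
        then have "a \<le> b" using assms unfolding a_def b_def by (intro causal_fractional_kernel_antimono) auto
        then have "(b - a)\<^sup>2 + a\<^sup>2 \<le> b\<^sup>2"
          using mult_left_mono[OF \<open>a \<le> b\<close> ab(1)] by (simp add: power2_eq_square algebra_simps)
        then show ?thesis using in_T False by (simp add: ennreal_plus[symmetric] del: ennreal_plus)
      qed
    qed (auto simp: indicator_def)
  qed
  also have "\<dots> = ennreal (?e (T - s)) + 2 * ennreal (?e (s - r))"
    using assms by (subst nn_integral_add)
      (auto simp: nn_integral_cmult nn_integral_causal_fractional_kernel_square)
  also have "\<dots> \<le> ennreal (?e (T - r)) + 2 * ennreal (?e (s - r))"
    using assms by (intro add_right_mono ennreal_leI fractional_energy_mono) auto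
  finally have "ennreal (?e (T - r)) + ?L \<le> ennreal (?e (T - r)) + 2 * ennreal (?e (s - r))"
    by (simp only: add.commute)
  then have "?L \<le> 2 * ennreal (?e (s - r))"
    by (simp only: ennreal_add_left_cancel_le) simp
  also have "\<dots> = ennreal (2 * ?e (s - r))"
    using assms by (simp add: ennreal_mult fractional_energy_nonneg)
  finally show ?thesis .
qed

text \<open>For \<open>s\<close> in \<open>{0<..t}\<close> this is the left end of the grid interval
  containing \<open>s\<close>. The ceiling, rather than the floor, matches the left-open intervals
  of elementary integrands, and the closed form makes measurability in \<open>s\<close>
  immediate.\<close>

definition grid_left :: "real \<Rightarrow> nat \<Rightarrow> real \<Rightarrow> real" where
  "grid_left t n s = (real_of_int \<lceil>s * real n / t\<rceil> - 1) * t / real n"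

lemma measurable_grid_left [measurable]: "grid_left t n \<in> borel_measurable borel"
  unfolding grid_left_def by measurable

text \<open>The point \<open>s = 0\<close> lies in none of the left-open grid intervals and is
  excluded; wherever the lemma is applied under a time integral this point is a null set.\<close>

lemma grid_left:
  assumes "0 < n" "0 < s" "s \<le> t"
  shows "0 \<le> grid_left t n s" "grid_left t n s \<le> s" "s - grid_left t n s \<le> t / n"
    and "elementary_process n (\<lambda>i. real i * t / real n) (\<lambda>i \<omega>. \<phi> (real i * t / real n)) s \<omega> = \<phi> (grid_left t n s)"
proof -
  have t: "0 < t" using assms by simp
  define c where "c = \<lceil>s * real n / t\<rceil>"
  have c: "real_of_int c - 1 < s * real n / t" "s * real n / t \<le> real_of_int c"
    unfolding c_def by linarith+
  have "0 < s * real n / t" using assms t by simp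
  with c have "0 < real_of_int c" by linarith
  then have c0: "1 \<le> c" by linarith
  have "s * real n / t \<le> real n" using assms t by (simp add: field_simps)
  with c have "real_of_int c - 1 < real n" by linarith
  then have cn: "c \<le> int n" by linarith
  define i where "i = nat (c - 1)"
  have i: "real i = real_of_int c - 1" "i < n" using c0 cn assms by (auto simp: i_def)
  have g: "grid_left t n s = real i * t / real n" by (simp add: grid_left_def c_def[symmetric] i)
  show "0 \<le> grid_left t n s" using t by (simp add: g)
  have less: "real i * t / real n < s" using c(1) t assms by (simp add: i field_simps)
  then show "grid_left t n s \<le> s" by (simp add: g)
  have le: "s \<le> real (Suc i) * t / real n" using c(2) t assms by (simp add: i field_simps)
  also have "real (Suc i) * t / real n = grid_left t n s + t / real n" by (simp add: g add_divide_distrib distrib_right)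
  finally show "s - grid_left t n s \<le> t / n" by simp
  have "indicator {real j * t / real n<..real (Suc j) * t / real n} s = (if j = i then 1 else 0 :: real)" for j
  proof (cases "j = i")
    case False
    have "real j * t / real n < s \<and> s \<le> real (Suc j) * t / real n \<Longrightarrow> j = i"
    proof -
      assume j: "real j * t / real n < s \<and> s \<le> real (Suc j) * t / real n"
      have "real j * t / real n < real (Suc i) * t / real n" using j le by linarith
      then have "real j < real (Suc i)" using t assms by (simp add: divide_less_cancel mult_less_cancel_right)
      moreover have "real i * t / real n < real (Suc j) * t / real n" using j less by linarith
      then have "real i < real (Suc j)" using t assms by (simp add: divide_less_cancel mult_less_cancel_right)
      ultimately show "j = i" by linarith
    qed
    with False show ?thesis by (auto simp: indicator_def)
  qed (use less le in \<open>auto simp: indicator_def\<close>)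
  then have "elementary_process n (\<lambda>i. real i * t / real n) (\<lambda>i \<omega>. \<phi> (real i * t / real n)) s \<omega>
    = (\<Sum>j<n. if j = i then \<phi> (real j * t / real n) else 0)"
    unfolding elementary_process_def by (intro sum.cong refl) simp
  also have "\<dots> = \<phi> (grid_left t n s)" using i by (simp add: g)
  finally show "elementary_process n (\<lambda>i. real i * t / real n) (\<lambda>i \<omega>. \<phi> (real i * t / real n)) s \<omega> = \<phi> (grid_left t n s)" .
qed

lemma elementary_integrand_grid:
  assumes "0 < n" "0 \<le> t"
  shows "elementary_integrand F t n (\<lambda>i. real i * t / real n) (\<lambda>i \<omega>. \<phi> i)"
  using assms by (auto simp: elementary_integrand_def divide_right_mono mult_right_mono)

section \<open>The stochastic integral of the lifted diffusion\<close>

lemma scaleR_causal_kernel: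
  fixes x :: "'b::real_vector"
  shows "causal_kernel k (\<xi> - t) *\<^sub>R x = (if t < \<xi> then k (\<xi> - t) *\<^sub>R x else 0)"
  by (simp add: causal_kernel_def)

lemma square_integrable_causal_fractional_kernel:
  fixes x :: "real ^ 'd"
  assumes "1/2 < \<alpha>"
  shows "square_integrable (\<lambda>\<xi>. if \<xi> \<in> {0..T} then causal_kernel (fractional_kernel \<alpha>) (\<xi> - t) *\<^sub>R x else 0)"
  unfolding scaleR_causal_kernel by (rule square_integrable_fractional_kernel[OF assms])

lemma lifted_diffusion_causal:
  assumes "1/2 < \<alpha>"
  shows "blinfun_apply (lifted_diffusion T (fractional_kernel \<alpha>) t) x
    = l2_on T (\<lambda>\<xi>. causal_kernel (fractional_kernel \<alpha>) (\<xi> - t) *\<^sub>R x)"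
  unfolding scaleR_causal_kernel by (rule lifted_diffusion_apply[OF assms])

section \<open>Classes of functions restricted to the time interval\<close>

lemma nn_integral_l2_on:
  assumes "square_integrable (\<lambda>\<xi>. if \<xi> \<in> {0..T} then f \<xi> else 0)"
  shows "ennreal ((norm (l2_on T f))\<^sup>2) = (\<integral>\<^sup>+\<xi>\<in>{0..T}. ennreal ((norm (f \<xi>))\<^sup>2) \<partial>lborel)"
  unfolding l2_on_def nn_integral_l2_class[OF assms, symmetric]
  by (intro nn_integral_cong) (simp add: indicator_def)

lemma l2_on_diff:
  assumes "square_integrable (\<lambda>\<xi>. if \<xi> \<in> {0..T} then f \<xi> else 0)"
    and "square_integrable (\<lambda>\<xi>. if \<xi> \<in> {0..T} then g \<xi> else 0)"
  shows "l2_on T (\<lambda>\<xi>. f \<xi> - g \<xi>) = l2_on T f - l2_on T g"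
  unfolding l2_on_def l2_class_diff[OF assms, symmetric] by (intro arg_cong[where f=l2_class]) auto

lemma l2_on_add:
  assumes "square_integrable (\<lambda>\<xi>. if \<xi> \<in> {0..T} then f \<xi> else 0)"
    and "square_integrable (\<lambda>\<xi>. if \<xi> \<in> {0..T} then g \<xi> else 0)"
  shows "l2_on T (\<lambda>\<xi>. f \<xi> + g \<xi>) = l2_on T f + l2_on T g"
  unfolding l2_on_def l2_class_add[OF assms, symmetric] by (intro arg_cong[where f=l2_class]) auto

lemma l2_on_sum:
  assumes "finite I"
    and "\<And>i. i \<in> I \<Longrightarrow> square_integrable (\<lambda>\<xi>. if \<xi> \<in> {0..T} then f i \<xi> else 0)"
  shows "square_integrable (\<lambda>\<xi>. if \<xi> \<in> {0..T} then (\<Sum>i\<in>I. f i \<xi>) else 0)"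
    and "l2_on T (\<lambda>\<xi>. \<Sum>i\<in>I. f i \<xi>) = (\<Sum>i\<in>I. l2_on T (f i))"
proof -
  have "square_integrable (\<lambda>\<xi>. if \<xi> \<in> {0..T} then (\<Sum>i\<in>I. f i \<xi>) else 0)
    \<and> l2_on T (\<lambda>\<xi>. \<Sum>i\<in>I. f i \<xi>) = (\<Sum>i\<in>I. l2_on T (f i))"
    using assms
  proof (induction I)
    case empty
    have "(\<lambda>\<xi>. if \<xi> \<in> {0..T} then (\<Sum>i\<in>{}. f i \<xi>) else 0) = (\<lambda>_. 0)" by auto
    then show ?case by (simp only: square_integrable_0 l2_on_def l2_class_zero sum.empty simp_thms)
  next
    case (insert i I)
    have eq: "(\<lambda>\<xi>. if \<xi> \<in> {0..T} then (\<Sum>i\<in>insert i I. f i \<xi>) else 0) = (\<lambda>\<xi>. (if \<xi> \<in> {0..T} then f i \<xi> else 0)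
        + (if \<xi> \<in> {0..T} then (\<Sum>i\<in>I. f i \<xi>) else 0))"
      using insert.hyps by auto
    have "square_integrable (\<lambda>\<xi>. if \<xi> \<in> {0..T} then (\<Sum>i\<in>insert i I. f i \<xi>) else 0)"
      unfolding eq by (rule square_integrable_add) (use insert in auto)
    moreover have "l2_on T (\<lambda>\<xi>. \<Sum>i\<in>insert i I. f i \<xi>) = l2_on T (f i) + l2_on T (\<lambda>\<xi>. \<Sum>i\<in>I. f i \<xi>)"
      unfolding sum.insert[OF insert.hyps] by (rule l2_on_add) (use insert in auto)
    ultimately show ?case using insert by simp
  qed
  then show "square_integrable (\<lambda>\<xi>. if \<xi> \<in> {0..T} then (\<Sum>i\<in>I. f i \<xi>) else 0)"
    "l2_on T (\<lambda>\<xi>. \<Sum>i\<in>I. f i \<xi>) = (\<Sum>i\<in>I. l2_on T (f i))" by blast+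
qed

text \<open>If the difference is not square-integrable the right side is infinite; otherwise
  \<open>f\<close> inherits square-integrability from \<open>g\<close>. The process \<open>G\<close>
  can therefore be inserted for every outcome before anything is known about the size of its
  trajectories.\<close>

lemma norm_l2_on_diff_le:
  assumes [measurable]: "f \<in> borel_measurable borel"
    and g: "square_integrable (\<lambda>\<xi>. if \<xi> \<in> {0..T} then g \<xi> else 0)"
  shows "ennreal ((norm (l2_on T f - l2_on T g))\<^sup>2) \<le> (\<integral>\<^sup>+\<xi>\<in>{0..T}. ennreal ((norm (f \<xi> - g \<xi>))\<^sup>2) \<partial>lborel)"
proof -
  let ?f = "\<lambda>\<xi>. if \<xi> \<in> {0..T} then f \<xi> else 0" and ?g = "\<lambda>\<xi>. if \<xi> \<in> {0..T} then g \<xi> else 0"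
  have R: "(\<integral>\<^sup>+\<xi>\<in>{0..T}. ennreal ((norm (f \<xi> - g \<xi>))\<^sup>2) \<partial>lborel) = (\<integral>\<^sup>+\<xi>. ennreal ((norm (?f \<xi> - ?g \<xi>))\<^sup>2) \<partial>lborel)"
    by (intro nn_integral_cong) (simp add: indicator_def)
  have [measurable]: "?g \<in> borel_measurable lborel" using g by (simp add: square_integrable_def)
  show ?thesis
  proof (cases "square_integrable (\<lambda>\<xi>. ?f \<xi> - ?g \<xi>)")
    case True
    have f: "square_integrable ?f"
      using square_integrable_add[OF True g] by simp
    show ?thesis
      unfolding R nn_integral_l2_class[OF True] l2_class_diff[OF f g] l2_on_def by simp
  next
    case False
    then have "\<not> (\<integral>\<^sup>+\<xi>. ennreal ((norm (?f \<xi> - ?g \<xi>))\<^sup>2) \<partial>lborel) < \<infinity>"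
      by (subst (asm) square_integrable_iff_nn_integral) measurable
    then show ?thesis unfolding R by (simp add: less_top[symmetric])
  qed
qed

text \<open>Every basis vector contributes the same L^2 distance between two translated kernels,
  whence the dimension as a factor.\<close>

lemma hilbert_schmidt_norm_lifted_diffusion_diff:
  assumes "1/2 < \<alpha>"
  shows "ennreal ((hilbert_schmidt_norm (lifted_diffusion T (fractional_kernel \<alpha>) s
        - (lifted_diffusion T (fractional_kernel \<alpha>) r :: (real ^ 'd) \<Rightarrow>\<^sub>L (real ^ 'd) l2)))\<^sup>2)
    = of_nat CARD('d) * (\<integral>\<^sup>+\<xi>\<in>{0..T}. ennreal ((causal_kernel (fractional_kernel \<alpha>) (\<xi> - s)
      - causal_kernel (fractional_kernel \<alpha>) (\<xi> - r))\<^sup>2) \<partial>lborel)" (is "?l = _ * ?I")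
proof -
  let ?k = "causal_kernel (fractional_kernel \<alpha>)"
  note sq = square_integrable_causal_fractional_kernel[OF assms]
  have "ennreal ((norm (l2_on T (\<lambda>\<xi>. ?k (\<xi> - s) *\<^sub>R axis i 1) - l2_on T (\<lambda>\<xi>. ?k (\<xi> - r) *\<^sub>R (axis i 1 :: real ^ 'd))))\<^sup>2) = ?I" for i
  proof -
    have sqd: "square_integrable (\<lambda>\<xi>. if \<xi> \<in> {0..T} then ?k (\<xi> - s) *\<^sub>R axis i 1 - ?k (\<xi> - r) *\<^sub>R (axis i 1 :: real ^ 'd) else 0)"
      using square_integrable_diff[OF sq sq, of T s "axis i 1" T r "axis i 1"]
      by (rule back_subst[of square_integrable]) auto
    show ?thesis
      unfolding l2_on_diff[OF sq sq, symmetric] nn_integral_l2_on[OF sqd]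
      by (simp add: scaleR_left_diff_distrib[symmetric])
  qed
  then show ?thesis
    unfolding hilbert_schmidt_norm_square blinfun.diff_left lifted_diffusion_causal[OF assms]
    by (simp add: sum_ennreal[symmetric])
qed

lemma hilbert_schmidt_norm_scaleR_id:
  "(hilbert_schmidt_norm (c *\<^sub>R (id_blinfun :: (real ^ 'd) \<Rightarrow>\<^sub>L (real ^ 'd))))\<^sup>2 = real CARD('d) * c\<^sup>2"
  unfolding hilbert_schmidt_norm_square by (simp add: blinfun.scaleR_left)

text \<open>The translation estimate depends only on the shift, which is at most the mesh
  \<open>t / n\<close>; the bound is thus uniform in \<open>s\<close> and is integrated over an
  interval of length \<open>t\<close>.\<close>

lemma nn_integral_grid_translation:
  assumes "1/2 < \<alpha>" "\<alpha> < 1" "0 \<le> t" "t \<le> T" "0 < n"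
  shows "(\<integral>\<^sup>+s\<in>{0..t}. (\<integral>\<^sup>+\<xi>\<in>{0..T}. ennreal ((causal_kernel (fractional_kernel \<alpha>) (\<xi> - s)
      - causal_kernel (fractional_kernel \<alpha>) (\<xi> - grid_left t n s))\<^sup>2) \<partial>lborel) \<partial>lborel)
    \<le> ennreal (2 * fractional_energy \<alpha> (t / n) * t)"
proof -
  have "(\<integral>\<^sup>+s\<in>{0..t}. (\<integral>\<^sup>+\<xi>\<in>{0..T}. ennreal ((causal_kernel (fractional_kernel \<alpha>) (\<xi> - s)
      - causal_kernel (fractional_kernel \<alpha>) (\<xi> - grid_left t n s))\<^sup>2) \<partial>lborel) \<partial>lborel)
    \<le> (\<integral>\<^sup>+s\<in>{0..t}. ennreal (2 * fractional_energy \<alpha> (t / n)) \<partial>lborel)"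
  proof (rule nn_integral_mono_AE)
    show "AE s in lborel. (\<integral>\<^sup>+\<xi>\<in>{0..T}. ennreal ((causal_kernel (fractional_kernel \<alpha>) (\<xi> - s)
      - causal_kernel (fractional_kernel \<alpha>) (\<xi> - grid_left t n s))\<^sup>2) \<partial>lborel) * indicator {0..t} s
      \<le> ennreal (2 * fractional_energy \<alpha> (t / n)) * indicator {0..t} s"
      using AE_lborel_singleton[of 0]
    proof (rule eventually_mono)
      fix s :: real assume "s \<noteq> 0"
      show "(\<integral>\<^sup>+\<xi>\<in>{0..T}. ennreal ((causal_kernel (fractional_kernel \<alpha>) (\<xi> - s)
        - causal_kernel (fractional_kernel \<alpha>) (\<xi> - grid_left t n s))\<^sup>2) \<partial>lborel) * indicator {0..t} s
        \<le> ennreal (2 * fractional_energy \<alpha> (t / n)) * indicator {0..t} s"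
      proof (cases "s \<in> {0..t}")
        case True
        with \<open>s \<noteq> 0\<close> have s: "0 < s" "s \<le> t" by auto
        note g = grid_left[OF assms(5) s]
        have "(\<integral>\<^sup>+\<xi>\<in>{0..T}. ennreal ((causal_kernel (fractional_kernel \<alpha>) (\<xi> - s)
          - causal_kernel (fractional_kernel \<alpha>) (\<xi> - grid_left t n s))\<^sup>2) \<partial>lborel)
          \<le> ennreal (2 * fractional_energy \<alpha> (s - grid_left t n s))"
          using assms s g by (intro fractional_kernel_translation) auto
        also have "\<dots> \<le> ennreal (2 * fractional_energy \<alpha> (t / n))"
          using assms g by (intro ennreal_leI mult_left_mono fractional_energy_mono) auto
        finally show ?thesis using True by simp
      qed simp
    qed
  qed
  also have "\<dots> = ennreal (2 * fractional_energy \<alpha> (t / n) * t)"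
    using assms by (subst nn_integral_cmult_indicator) (auto simp: ennreal_mult fractional_energy_nonneg)
  finally show ?thesis .
qed

text \<open>The mesh enters through a power with the positive exponent
  \<open>2 * \<alpha> - 1\<close>; \<open>c\<close> leaves room for the dimension factors.\<close>

lemma fractional_energy_grid_tendsto_0:
  assumes "1/2 < \<alpha>" "0 \<le> t"
  shows "(\<lambda>k. ennreal (c * (2 * fractional_energy \<alpha> (t / real (Suc k)) * t))) \<longlonglongrightarrow> 0"
proof -
  have "(\<lambda>k. t / real (Suc k)) \<longlonglongrightarrow> 0"
    using tendsto_mult[OF tendsto_const[of t] LIMSEQ_inverse_real_of_nat] by (simp add: divide_inverse)
  then have "(\<lambda>k. (t / real (Suc k)) powr (2 * \<alpha> - 1)) \<longlonglongrightarrow> 0"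
    using assms by (intro tendsto_zero_powrI[OF _ tendsto_const]) (auto intro!: always_eventually)
  then have "(\<lambda>k. c * (2 * fractional_energy \<alpha> (t / real (Suc k)) * t)) \<longlonglongrightarrow>
      c * (2 * (0 / ((Gamma \<alpha>)\<^sup>2 * (2 * \<alpha> - 1))) * t)"
    unfolding fractional_energy_def divide_inverse[of "_ powr _"] divide_inverse[of 0] by (intro tendsto_intros)
  then have "(\<lambda>k. ennreal (c * (2 * fractional_energy \<alpha> (t / real (Suc k)) * t))) \<longlonglongrightarrow> ennreal 0"
    by (intro tendsto_ennrealI) simp
  then show ?thesis by simp
qed

section \<open>From integrals at fixed positions to the integral with values in L^2\<close>

context brownian_basis
begin

lemma has_ito_integral_lifted_diffusion:
  fixes G :: "real \<Rightarrow> 'a \<Rightarrow> real ^ 'd"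
  assumes \<alpha>: "1/2 < \<alpha>" "\<alpha> < 1" and t: "0 \<le> t" "t \<le> T"
    and G [measurable]: "(\<lambda>(\<xi>, \<omega>). G \<xi> \<omega>) \<in> borel_measurable (lborel \<Otimes>\<^sub>M M)"
    and I: "\<And>\<xi>. \<xi> \<in> {0..T} \<Longrightarrow>
      has_ito_integral M F W t (\<lambda>s _. causal_kernel (fractional_kernel \<alpha>) (\<xi> - s) *\<^sub>R id_blinfun) (G \<xi>)"
  shows "has_ito_integral M F W t (\<lambda>s _. lifted_diffusion T (fractional_kernel \<alpha>) s) (\<lambda>\<omega>. l2_on T (\<lambda>\<xi>. G \<xi> \<omega>))"
proof -
  let ?k = "causal_kernel (fractional_kernel \<alpha>)"
  let ?\<sigma> = "lifted_diffusion T (fractional_kernel \<alpha>) :: real \<Rightarrow> (real ^ 'd) \<Rightarrow>\<^sub>L (real ^ 'd) l2"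
  let ?N = "restrict_space lborel {0..t}"
  define \<tau> where "\<tau> k i = real i * t / real (Suc k)" for k i
  \<comment> \<open>The operators and the scalar kernels are frozen at the same grid points. As a
    function of \<xi>, \<open>S k \<xi> \<omega>\<close> is then a representative of the elementary
    integral of \<open>A k\<close>, which is the link between the two kinds of integrals.\<close>
  define A where "A k i \<omega> = ?\<sigma> (\<tau> k i)" for k i and \<omega> :: 'a
  define c where "c \<xi> k i \<omega> = ?k (\<xi> - \<tau> k i) *\<^sub>R (id_blinfun :: (real ^ 'd) \<Rightarrow>\<^sub>L (real ^ 'd))" for \<xi> k i and \<omega> :: 'a
  define S where "S k \<xi> \<omega> = elementary_integral W (Suc k) (\<tau> k) (c \<xi> k) \<omega>" for k \<xi> \<omega>
  define e where "e k = 2 * fractional_energy \<alpha> (t / real (Suc k)) * t" for k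
  have W [measurable]: "W (\<tau> k i) \<in> borel_measurable M" for k i
    using t by (intro measurable_W) (simp add: \<tau>_def)
  have eA: "elementary_integrand F t (Suc k) (\<tau> k) (A k)" for k
    unfolding \<tau>_def[abs_def] A_def[abs_def] by (rule elementary_integrand_grid) (use t in auto)
  have ec: "elementary_integrand F t (Suc k) (\<tau> k) (c \<xi> k)" for \<xi> k
    unfolding \<tau>_def[abs_def] c_def[abs_def] by (rule elementary_integrand_grid) (use t in auto)
  have pA: "elementary_process (Suc k) (\<tau> k) (A k) s \<omega> = ?\<sigma> (grid_left t (Suc k) s)" if "0 < s" "s \<le> t" for k s \<omega>
    unfolding \<tau>_def[abs_def] A_def[abs_def] using that by (intro grid_left(4)) auto
  have pc: "elementary_process (Suc k) (\<tau> k) (c \<xi> k) s \<omega> = ?k (\<xi> - grid_left t (Suc k) s) *\<^sub>R id_blinfun"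
    if "0 < s" "s \<le> t" for k s \<omega> \<xi>
    unfolding \<tau>_def[abs_def] c_def[abs_def] using that by (intro grid_left(4)) auto
  note grid = nn_integral_grid_translation[OF \<alpha> t, of "Suc _", folded e_def]
  have e0: "0 \<le> e k" for k
    using t \<alpha> by (simp add: e_def fractional_energy_nonneg)
  have \<sigma>_meas: "(\<lambda>(s, \<omega>). blinfun_apply (?\<sigma> s) x) \<in> borel_measurable (?N \<Otimes>\<^sub>M M)" for x
  proof -
    have "(\<lambda>s. l2_class (\<lambda>\<xi>. if \<xi> \<in> {0..T} then ?k (\<xi> - s) *\<^sub>R x else 0)) \<in> borel_measurable borel"
      by (rule measurable_l2_class) measurable
    then have "(\<lambda>s. blinfun_apply (?\<sigma> s) x) \<in> borel_measurable ?N"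
      unfolding lifted_diffusion_causal[OF \<alpha>(1)] l2_on_def by (intro measurable_restrict_space1) simp
    then show ?thesis by measurable
  qed
  have Z_meas: "(\<lambda>\<omega>. l2_on T (\<lambda>\<xi>. G \<xi> \<omega>)) \<in> borel_measurable M"
    unfolding l2_on_def by (rule measurable_l2_class) measurable
  have approx: "(\<integral>\<^sup>+\<omega>. (\<integral>\<^sup>+s\<in>{0..t}. ennreal ((hilbert_schmidt_norm
      (?\<sigma> s - elementary_process (Suc k) (\<tau> k) (A k) s \<omega>))\<^sup>2) \<partial>lborel) \<partial>M) \<le> ennreal (real CARD('d) * e k)" for k
  proof -
    have "(\<integral>\<^sup>+s\<in>{0..t}. ennreal ((hilbert_schmidt_norm (?\<sigma> s - elementary_process (Suc k) (\<tau> k) (A k) s \<omega>))\<^sup>2) \<partial>lborel)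
      \<le> ennreal (real CARD('d) * e k)" for \<omega>
    proof -
      have "(\<integral>\<^sup>+s\<in>{0..t}. ennreal ((hilbert_schmidt_norm (?\<sigma> s - elementary_process (Suc k) (\<tau> k) (A k) s \<omega>))\<^sup>2) \<partial>lborel)
        = (\<integral>\<^sup>+s. of_nat CARD('d) * ((\<integral>\<^sup>+\<xi>\<in>{0..T}. ennreal ((?k (\<xi> - s) - ?k (\<xi> - grid_left t (Suc k) s))\<^sup>2) \<partial>lborel)
          * indicator {0..t} s) \<partial>lborel)"
      proof (rule nn_integral_cong_AE, rule eventually_mono[OF AE_lborel_singleton[of 0]])
        fix s :: real assume "s \<noteq> 0"
        then show "ennreal ((hilbert_schmidt_norm (?\<sigma> s - elementary_process (Suc k) (\<tau> k) (A k) s \<omega>))\<^sup>2) * indicator {0..t} s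
          = of_nat CARD('d) * ((\<integral>\<^sup>+\<xi>\<in>{0..T}. ennreal ((?k (\<xi> - s) - ?k (\<xi> - grid_left t (Suc k) s))\<^sup>2) \<partial>lborel)
            * indicator {0..t} s)"
          using pA[of s k \<omega>]
          by (cases "s \<in> {0..t}") (simp_all add: hilbert_schmidt_norm_lifted_diffusion_diff[OF \<alpha>(1)])
      qed
      also have "\<dots> = of_nat CARD('d) * (\<integral>\<^sup>+s\<in>{0..t}. (\<integral>\<^sup>+\<xi>\<in>{0..T}. ennreal ((?k (\<xi> - s) - ?k (\<xi> - grid_left t (Suc k) s))\<^sup>2) \<partial>lborel) \<partial>lborel)"
        by (rule nn_integral_cmult) measurable
      also have "\<dots> \<le> of_nat CARD('d) * ennreal (e k)"
        by (intro mult_left_mono grid) auto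
      finally show ?thesis using e0 by (simp add: ennreal_mult ennreal_of_nat_eq_real_of_nat)
    qed
    then have "(\<integral>\<^sup>+\<omega>. (\<integral>\<^sup>+s\<in>{0..t}. ennreal ((hilbert_schmidt_norm
      (?\<sigma> s - elementary_process (Suc k) (\<tau> k) (A k) s \<omega>))\<^sup>2) \<partial>lborel) \<partial>M) \<le> (\<integral>\<^sup>+\<omega>. ennreal (real CARD('d) * e k) \<partial>M)"
      by (intro nn_integral_mono)
    then show ?thesis by (simp add: emeasure_space_1)
  qed
  have S_sum: "S k \<xi> \<omega> = (\<Sum>i<Suc k. ?k (\<xi> - \<tau> k i) *\<^sub>R (W (\<tau> k (Suc i)) \<omega> - W (\<tau> k i) \<omega>))" for k \<xi> \<omega>
    unfolding S_def elementary_integral_def c_def by (simp add: blinfun.scaleR_left)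
  have S_meas [measurable]: "(\<lambda>(\<xi>, \<omega>). S k \<xi> \<omega>) \<in> borel_measurable (lborel \<Otimes>\<^sub>M M)" for k
    unfolding S_sum by measurable
  have sqS: "square_integrable (\<lambda>\<xi>. if \<xi> \<in> {0..T} then S k \<xi> \<omega> else 0)" for k \<omega>
    unfolding S_sum by (intro l2_on_sum(1) square_integrable_causal_fractional_kernel \<alpha>) auto
  have IS: "elementary_integral W (Suc k) (\<tau> k) (A k) \<omega> = l2_on T (\<lambda>\<xi>. S k \<xi> \<omega>)" for k \<omega>
    unfolding S_sum elementary_integral_def A_def lifted_diffusion_causal[OF \<alpha>(1)]
    by (intro l2_on_sum(2)[symmetric] square_integrable_causal_fractional_kernel \<alpha>) auto
  \<comment> \<open>The factor 4 comes from the comparison bound, the dimension from the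
    Hilbert-Schmidt norm of a multiple of the identity. The right side is deterministic but has no
    convenient bound for a single \<xi>.\<close>
  have GS: "(\<integral>\<^sup>+\<omega>. ennreal ((norm (G \<xi> \<omega> - S k \<xi> \<omega>))\<^sup>2) \<partial>M)
      \<le> of_nat (4 * CARD('d)) * (\<integral>\<^sup>+s\<in>{0..t}. ennreal ((?k (\<xi> - s) - ?k (\<xi> - grid_left t (Suc k) s))\<^sup>2) \<partial>lborel)"
    if \<xi>: "\<xi> \<in> {0..T}" for \<xi> k
  proof -
    have "(\<integral>\<^sup>+\<omega>. ennreal ((norm (G \<xi> \<omega> - S k \<xi> \<omega>))\<^sup>2) \<partial>M) \<le> 4 * (\<integral>\<^sup>+\<omega>. (\<integral>\<^sup>+s\<in>{0..t}. ennreal ((hilbert_schmidt_norm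
        (?k (\<xi> - s) *\<^sub>R id_blinfun - elementary_process (Suc k) (\<tau> k) (c \<xi> k) s \<omega>))\<^sup>2) \<partial>lborel) \<partial>M)"
      unfolding S_def by (rule has_ito_integral_bound[OF I[OF \<xi>] ec t(2)])
    also have "\<dots> = 4 * (\<integral>\<^sup>+\<omega>. (\<integral>\<^sup>+s. of_nat CARD('d) *
        (ennreal ((?k (\<xi> - s) - ?k (\<xi> - grid_left t (Suc k) s))\<^sup>2) * indicator {0..t} s) \<partial>lborel) \<partial>M)"
    proof (rule arg_cong[where f="\<lambda>x. 4 * x"], rule nn_integral_cong)
      fix \<omega>
      show "(\<integral>\<^sup>+s\<in>{0..t}. ennreal ((hilbert_schmidt_norm
        (?k (\<xi> - s) *\<^sub>R id_blinfun - elementary_process (Suc k) (\<tau> k) (c \<xi> k) s \<omega>))\<^sup>2) \<partial>lborel)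
        = (\<integral>\<^sup>+s. of_nat CARD('d) *
        (ennreal ((?k (\<xi> - s) - ?k (\<xi> - grid_left t (Suc k) s))\<^sup>2) * indicator {0..t} s) \<partial>lborel)"
      proof (rule nn_integral_cong_AE, rule eventually_mono[OF AE_lborel_singleton[of 0]])
        fix s :: real assume "s \<noteq> 0"
        then show "ennreal ((hilbert_schmidt_norm (?k (\<xi> - s) *\<^sub>R id_blinfun
            - elementary_process (Suc k) (\<tau> k) (c \<xi> k) s \<omega>))\<^sup>2) * indicator {0..t} s
          = of_nat CARD('d) * (ennreal ((?k (\<xi> - s) - ?k (\<xi> - grid_left t (Suc k) s))\<^sup>2) * indicator {0..t} s)"
          using pc[of s k \<xi> \<omega>]
          by (cases "s \<in> {0..t}")
            (simp_all add: scaleR_left_diff_distrib[symmetric] hilbert_schmidt_norm_scaleR_id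
              ennreal_mult ennreal_of_nat_eq_real_of_nat)
      qed
    qed
    also have "\<dots> = 4 * (of_nat CARD('d) * (\<integral>\<^sup>+s\<in>{0..t}. ennreal ((?k (\<xi> - s) - ?k (\<xi> - grid_left t (Suc k) s))\<^sup>2) \<partial>lborel))"
      by (subst nn_integral_cmult) (measurable, simp add: emeasure_space_1)
    finally show ?thesis by (simp add: mult.assoc)
  qed
  interpret P: pair_sigma_finite lborel M by standard
  have bound: "(\<integral>\<^sup>+\<omega>. ennreal ((norm (l2_on T (\<lambda>\<xi>. G \<xi> \<omega>) - elementary_integral W (Suc k) (\<tau> k) (A k) \<omega>))\<^sup>2) \<partial>M)
      \<le> ennreal (real (4 * CARD('d)) * e k)" for k
  proof -
    have "(\<integral>\<^sup>+\<omega>. ennreal ((norm (l2_on T (\<lambda>\<xi>. G \<xi> \<omega>) - elementary_integral W (Suc k) (\<tau> k) (A k) \<omega>))\<^sup>2) \<partial>M)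
      \<le> (\<integral>\<^sup>+\<omega>. (\<integral>\<^sup>+\<xi>\<in>{0..T}. ennreal ((norm (G \<xi> \<omega> - S k \<xi> \<omega>))\<^sup>2) \<partial>lborel) \<partial>M)"
      unfolding IS by (intro nn_integral_mono norm_l2_on_diff_le sqS) measurable
    also have "\<dots> = (\<integral>\<^sup>+\<xi>. (\<integral>\<^sup>+\<omega>. ennreal ((norm (G \<xi> \<omega> - S k \<xi> \<omega>))\<^sup>2) * indicator {0..T} \<xi> \<partial>M) \<partial>lborel)"
      by (rule P.Fubini') measurable
    also have "\<dots> = (\<integral>\<^sup>+\<xi>\<in>{0..T}. (\<integral>\<^sup>+\<omega>. ennreal ((norm (G \<xi> \<omega> - S k \<xi> \<omega>))\<^sup>2) \<partial>M) \<partial>lborel)"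
      by (intro nn_integral_cong nn_integral_multc) measurable
    also have "\<dots> \<le> (\<integral>\<^sup>+\<xi>. (\<integral>\<^sup>+s. of_nat (4 * CARD('d)) *
        (ennreal ((?k (\<xi> - s) - ?k (\<xi> - grid_left t (Suc k) s))\<^sup>2) * indicator {0..T} \<xi> * indicator {0..t} s) \<partial>lborel) \<partial>lborel)"
    proof (rule nn_integral_mono)
      fix \<xi>
      show "(\<integral>\<^sup>+\<omega>. ennreal ((norm (G \<xi> \<omega> - S k \<xi> \<omega>))\<^sup>2) \<partial>M) * indicator {0..T} \<xi> \<le> (\<integral>\<^sup>+s. of_nat (4 * CARD('d)) *
        (ennreal ((?k (\<xi> - s) - ?k (\<xi> - grid_left t (Suc k) s))\<^sup>2) * indicator {0..T} \<xi> * indicator {0..t} s) \<partial>lborel)"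
      proof (cases "\<xi> \<in> {0..T}")
        case True
        then show ?thesis using GS[OF True, of k]
          by (simp add: nn_integral_cmult del: of_nat_mult)
      qed simp
    qed
    \<comment> \<open>The order is exchanged so that the inner integral runs over \<xi>: it becomes
      the L^2 distance of two translates, for which a bound uniform in \<open>s\<close> is
      available.\<close>
    also have "\<dots> = (\<integral>\<^sup>+s. (\<integral>\<^sup>+\<xi>. of_nat (4 * CARD('d)) *
        (ennreal ((?k (\<xi> - s) - ?k (\<xi> - grid_left t (Suc k) s))\<^sup>2) * indicator {0..T} \<xi> * indicator {0..t} s) \<partial>lborel) \<partial>lborel)"
      by (rule lborel_pair.Fubini') measurable
    also have "\<dots> = of_nat (4 * CARD('d)) * (\<integral>\<^sup>+s\<in>{0..t}. (\<integral>\<^sup>+\<xi>\<in>{0..T}.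
        ennreal ((?k (\<xi> - s) - ?k (\<xi> - grid_left t (Suc k) s))\<^sup>2) \<partial>lborel) \<partial>lborel)"
      by (simp add: nn_integral_cmult nn_integral_multc del: of_nat_mult)
    also have "\<dots> \<le> of_nat (4 * CARD('d)) * ennreal (e k)"
      by (intro mult_left_mono grid) auto
    finally show ?thesis using e0 by (simp add: ennreal_mult ennreal_of_nat_eq_real_of_nat del: of_nat_mult)
  qed
  have lim: "(\<lambda>k. ennreal (C * e k)) \<longlonglongrightarrow> 0" for C
    unfolding e_def by (rule fractional_energy_grid_tendsto_0[OF \<alpha>(1) t(1)])
  have "(\<lambda>k. \<integral>\<^sup>+\<omega>. (\<integral>\<^sup>+s\<in>{0..t}. ennreal ((hilbert_schmidt_norm
      (?\<sigma> s - elementary_process (Suc k) (\<tau> k) (A k) s \<omega>))\<^sup>2) \<partial>lborel) \<partial>M) \<longlonglongrightarrow> 0"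
    by (rule tendsto_sandwich[OF _ _ tendsto_const lim]) (auto intro!: always_eventually approx)
  moreover have "(\<lambda>k. \<integral>\<^sup>+\<omega>. ennreal ((norm (l2_on T (\<lambda>\<xi>. G \<xi> \<omega>)
      - elementary_integral W (Suc k) (\<tau> k) (A k) \<omega>))\<^sup>2) \<partial>M) \<longlonglongrightarrow> 0"
    by (rule tendsto_sandwich[OF _ _ tendsto_const lim]) (auto intro!: always_eventually bound)
  ultimately show ?thesis
    unfolding has_ito_integral_def using \<sigma>_meas Z_meas eA
    by (intro conjI allI exI[of _ Suc] exI[of _ \<tau>] exI[of _ A]) auto
qed

end

section \<open>Joint measurability and convolutions\<close>

text \<open>Rounding the time down to a multiple of \<open>1 / Suc n\<close> gives a process with
  countably many time values, which is jointly measurable; continuity of the trajectories yields the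
  pointwise limit.\<close>

lemma borel_measurable_continuous_process:
  fixes f :: "real \<Rightarrow> 'a \<Rightarrow> 'b::{metric_space, second_countable_topology}"
  assumes meas: "\<And>s. f s \<in> borel_measurable M"
    and cont: "\<And>\<omega>. \<omega> \<in> space M \<Longrightarrow> continuous_on UNIV (\<lambda>s. f s \<omega>)"
  shows "(\<lambda>(s, \<omega>). f s \<omega>) \<in> borel_measurable (borel \<Otimes>\<^sub>M M)"
proof (rule borel_measurable_LIMSEQ_metric)
  let ?g = "\<lambda>n (s, \<omega>). f (real_of_int \<lfloor>s * real (Suc n)\<rfloor> / real (Suc n)) \<omega>"
  show "?g n \<in> borel_measurable (borel \<Otimes>\<^sub>M M)" for n
  proof -
    have "(\<lambda>z. f (real_of_int \<lfloor>fst z * real (Suc n)\<rfloor> / real (Suc n)) (snd z)) \<in> borel_measurable (borel \<Otimes>\<^sub>M M)"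
    proof (rule measurable_compose_countable[where f="\<lambda>i z. f (real_of_int i / real (Suc n)) (snd z)"])
      show "(\<lambda>z. f (real_of_int i / real (Suc n)) (snd z)) \<in> borel_measurable (borel \<Otimes>\<^sub>M M)" for i
        using meas by measurable
    qed measurable
    then show ?thesis by (simp add: case_prod_unfold)
  qed
  fix z assume "z \<in> space ((borel :: real measure) \<Otimes>\<^sub>M M)"
  then obtain s \<omega> where z: "z = (s, \<omega>)" "\<omega> \<in> space M" by (auto simp: space_pair_measure)
  have "(\<lambda>n. real_of_int \<lfloor>s * real (Suc n)\<rfloor> / real (Suc n)) \<longlonglongrightarrow> s"
  proof (rule tendsto_sandwich)
    show "\<forall>\<^sub>F n in sequentially. s - 1 / real (Suc n) \<le> real_of_int \<lfloor>s * real (Suc n)\<rfloor> / real (Suc n)"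
    proof (intro always_eventually allI)
      fix n
      have "s * real (Suc n) - 1 \<le> real_of_int \<lfloor>s * real (Suc n)\<rfloor>" by linarith
      from divide_right_mono[OF this, of "real (Suc n)"]
      show "s - 1 / real (Suc n) \<le> real_of_int \<lfloor>s * real (Suc n)\<rfloor> / real (Suc n)"
        by (simp add: diff_divide_distrib)
    qed
    show "\<forall>\<^sub>F n in sequentially. real_of_int \<lfloor>s * real (Suc n)\<rfloor> / real (Suc n) \<le> s"
      by (intro always_eventually allI) (simp add: divide_le_eq)
    show "(\<lambda>n. s - 1 / real (Suc n)) \<longlonglongrightarrow> s"
      using tendsto_diff[OF tendsto_const[of s] LIMSEQ_inverse_real_of_nat] by (simp add: divide_inverse)
  qed simp
  then have "(\<lambda>n. f (real_of_int \<lfloor>s * real (Suc n)\<rfloor> / real (Suc n)) \<omega>) \<longlonglongrightarrow> f s \<omega>"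
    using cont[OF z(2)] by (intro continuous_on_tendsto_compose[of UNIV "\<lambda>s. f s \<omega>"]) auto
  then show "(\<lambda>n. ?g n z) \<longlonglongrightarrow> (case z of (s, \<omega>) \<Rightarrow> f s \<omega>)"
    by (simp add: z)
qed

lemma jointly_measurable_version:
  fixes f :: "real \<Rightarrow> 'a \<Rightarrow> real ^ 'd"
  assumes "a \<le> b" and meas: "\<And>s. s \<in> {a..b} \<Longrightarrow> f s \<in> borel_measurable M"
    and cont: "AE \<omega> in M. continuous_on {a..b} (\<lambda>s. f s \<omega>)"
  obtains g where "(\<lambda>(s, \<omega>). g s \<omega>) \<in> borel_measurable (borel \<Otimes>\<^sub>M M)"
    and "\<And>\<omega>. \<omega> \<in> space M \<Longrightarrow> continuous_on UNIV (\<lambda>s. g s \<omega>)"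
    and "AE \<omega> in M. \<forall>s\<in>{a..b}. g s \<omega> = f s \<omega>"
proof -
  obtain N where N: "N \<in> null_sets M" "{\<omega> \<in> space M. \<not> continuous_on {a..b} (\<lambda>s. f s \<omega>)} \<subseteq> N"
    using cont by (auto elim!: AE_E simp: null_sets_def)
  \<comment> \<open>On the exceptional null set the trajectory is replaced by 0, and outside the
    interval it is continued by its end values. So every trajectory is continuous on the whole line,
    and agreement with \<open>f\<close> holds at all times simultaneously off one null set.\<close>
  define g where "g s \<omega> = (if \<omega> \<in> N then 0 else f (max a (min b s)) \<omega>)" for s \<omega>
  have [measurable]: "N \<in> sets M" using N by auto
  have cont_g: "continuous_on UNIV (\<lambda>s. g s \<omega>)" if "\<omega> \<in> space M" for \<omega>
  proof (cases "\<omega> \<in> N")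
    case False
    then have "continuous_on {a..b} (\<lambda>s. f s \<omega>)" using N that by auto
    then have "continuous_on UNIV (\<lambda>s. f (max a (min b s)) \<omega>)"
      by (rule continuous_on_compose2) (use assms(1) in \<open>auto intro!: continuous_intros\<close>)
    with False show ?thesis by (simp add: g_def)
  qed (simp add: g_def)
  have "g s \<in> borel_measurable M" for s
  proof -
    have [measurable]: "f (max a (min b s)) \<in> borel_measurable M" using assms(1) by (intro meas) auto
    show ?thesis unfolding g_def[abs_def] by measurable
  qed
  then have "(\<lambda>(s, \<omega>). g s \<omega>) \<in> borel_measurable (borel \<Otimes>\<^sub>M M)"
    using cont_g by (rule borel_measurable_continuous_process)
  moreover have "AE \<omega> in M. \<forall>s\<in>{a..b}. g s \<omega> = f s \<omega>"
    using AE_not_in[OF N(1)] by (rule eventually_mono) (auto simp: g_def max_def min_def)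
  ultimately show ?thesis using cont_g that by blast
qed

lemma square_integrable_continuous_on:
  fixes w :: "real \<Rightarrow> 'b::euclidean_space"
  assumes "continuous_on {0..T} w"
  shows "square_integrable (\<lambda>\<xi>. if \<xi> \<in> {0..T} then w \<xi> else 0)"
proof -
  have "(\<lambda>\<xi>. indicator {0..T} \<xi> *\<^sub>R w \<xi>) \<in> borel_measurable borel"
    using assms by (intro borel_measurable_continuous_on_indicator) auto
  moreover have "set_integrable lborel {0..T} (\<lambda>\<xi>. (norm (w \<xi>))\<^sup>2)"
    using assms by (intro borel_integrable_atLeastAtMost' continuous_intros)
  moreover have "(\<lambda>\<xi>. if \<xi> \<in> {0..T} then w \<xi> else 0) = (\<lambda>\<xi>. indicator {0..T} \<xi> *\<^sub>R w \<xi>)"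
    "(\<lambda>\<xi>. (norm (indicator {0..T} \<xi> *\<^sub>R w \<xi>))\<^sup>2) = (\<lambda>\<xi>. indicator {0..T} \<xi> *\<^sub>R (norm (w \<xi>))\<^sup>2)"
    by (auto simp: indicator_def)
  ultimately show ?thesis by (simp add: square_integrable_def set_integrable_def)
qed

section \<open>Convolutions of the drift kernel with bounded functions\<close>

locale convolution_kernel =
  fixes k :: "real \<Rightarrow> real" and T :: real
  assumes continuous_kernel: "continuous_on {0<..} k"
    and kernel_square_integrable: "set_integrable lborel {0<..T} (\<lambda>s. (k s)\<^sup>2)"
begin

lemma measurable_kernel [measurable]: "causal_kernel k \<in> borel_measurable borel"
proof -
  have "(\<lambda>u. if u \<in> {0<..} then k u else 0) \<in> borel_measurable borel"
    by (rule borel_measurable_continuous_on_if) (auto intro: continuous_kernel)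
  then show ?thesis by (simp add: causal_kernel_def[abs_def])
qed

definition energy :: real where
  "energy = (LINT s:{0<..T}|lborel. (k s)\<^sup>2)"

text \<open>Shifting the kernel to the right only pushes mass out of \<open>{0..T}\<close>, so the
  bound does not depend on \<open>s\<close>.\<close>

lemma nn_integral_kernel_square_le:
  assumes "0 \<le> s"
  shows "(\<integral>\<^sup>+\<xi>\<in>{0..T}. ennreal ((causal_kernel k (\<xi> - s))\<^sup>2) \<partial>lborel) \<le> ennreal energy"
proof -
  have "(\<integral>\<^sup>+\<xi>\<in>{0..T}. ennreal ((causal_kernel k (\<xi> - s))\<^sup>2) \<partial>lborel)
    = (\<integral>\<^sup>+x. ennreal ((causal_kernel k (s + 1 * x - s))\<^sup>2) * indicator {0..T} (s + 1 * x) \<partial>lborel)"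
    by (subst nn_integral_real_affine[where c=1 and t=s]) auto
  also have "\<dots> \<le> (\<integral>\<^sup>+x. ennreal (indicator {0<..T} x *\<^sub>R (k x)\<^sup>2) \<partial>lborel)"
    using assms by (intro nn_integral_mono) (auto simp: causal_kernel_def indicator_def)
  also have "\<dots> = ennreal energy"
    using kernel_square_integrable unfolding energy_def set_lebesgue_integral_def set_integrable_def
    by (intro nn_integral_eq_integral) auto
  finally show ?thesis .
qed

text \<open>On a bounded interval integrability follows from square-integrability by
  \<open>\<bar>k u\<bar> \<le> 1 + (k u)\<^sup>2\<close>. The extension by zero already takes care
  of negative arguments.\<close>

lemma integrable_kernel: "integrable lborel (\<lambda>u. indicator {..T} u * \<bar>causal_kernel k u\<bar>)"
proof (rule Bochner_Integration.integrable_bound)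
  show "integrable lborel (\<lambda>u. indicator {0<..T} u + indicator {0<..T} u *\<^sub>R (k u)\<^sup>2)"
  proof (rule Bochner_Integration.integrable_add)
    show "integrable lborel (indicator {0<..T} :: real \<Rightarrow> real)"
      by (cases "0 \<le> T") (auto intro!: integrable_real_indicator)
  qed (use kernel_square_integrable in \<open>simp add: set_integrable_def\<close>)
  show "AE u in lborel. norm (indicator {..T} u * \<bar>causal_kernel k u\<bar>)
      \<le> norm (indicator {0<..T} u + indicator {0<..T} u *\<^sub>R (k u)\<^sup>2)"
  proof (rule AE_I2)
    fix u :: real
    have "\<bar>k u\<bar> \<le> 1 + (k u)\<^sup>2"
      using sum_squares_bound[of 1 "\<bar>k u\<bar>"] abs_ge_zero[of "k u"] by simp
    then show "norm (indicator {..T} u * \<bar>causal_kernel k u\<bar>)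
      \<le> norm (indicator {0<..T} u + indicator {0<..T} u *\<^sub>R (k u)\<^sup>2)"
      by (auto simp: indicator_def causal_kernel_def)
  qed
qed measurable

context
  fixes \<beta> :: "real \<Rightarrow> real ^ 'd" and K t :: real
  assumes meas_\<beta> [measurable]: "\<beta> \<in> borel_measurable borel"
    and bound: "\<And>s. s \<in> {0..t} \<Longrightarrow> norm (\<beta> s) \<le> K"
    and t: "0 \<le> t"
begin

abbreviation "N \<equiv> restrict_space lborel {0..t}"

lemma finite_measure_N: "finite_measure N"
  by (intro finite_measureI) (simp add: emeasure_restrict_space space_restrict_space emeasure_lborel_Icc_eq)

lemma K_nonneg: "0 \<le> K"
  using bound[of 0] t by (auto intro: order_trans[OF norm_ge_zero])

text \<open>Cutting the kernel off at distance \<open>\<delta>\<close> from its singularity gives continuous convolutions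
  (the integrand jumps only at the single point \<open>s = \<xi> - \<delta>\<close>), with an error that is uniform in \<open>\<xi>\<close>.\<close>

lemma continuous_on_truncated_convolution:
  assumes "0 < \<delta>"
  shows "continuous_on {..T} (\<lambda>\<xi>. LINT s|N. (if \<delta> < \<xi> - s then causal_kernel k (\<xi> - s) else 0) *\<^sub>R \<beta> s)"
proof -
  interpret N: finite_measure N by (rule finite_measure_N)
  let ?h = "\<lambda>u. if \<delta> < u then causal_kernel k u else 0"
  have "continuous_on {\<delta>..T} k"
    using assms by (intro continuous_on_subset[OF continuous_kernel]) auto
  then have "bounded (k ` {\<delta>..T})"
    by (intro compact_imp_bounded compact_continuous_image) auto
  then obtain C where "\<forall>x\<in>k ` {\<delta>..T}. norm x \<le> C" unfolding bounded_iff by blast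
  then have C: "\<And>u. u \<in> {\<delta>..T} \<Longrightarrow> \<bar>k u\<bar> \<le> C" by simp
  \<comment> \<open>The interval \<open>{\<delta>..T}\<close> may be empty, in which case
    \<open>C\<close> may be negative; \<open>max 0 C\<close> also covers the zero values of the
    truncation.\<close>
  have h_bound: "\<bar>?h u\<bar> \<le> max 0 C" if "u \<le> T" for u
    using C[of u] assms that by (auto simp: causal_kernel_def)
  show ?thesis
    unfolding continuous_on_sequentially
  proof (intro allI ballI impI)
    fix x a assume "a \<in> {..T}" and x: "(\<forall>n. x n \<in> {..T}) \<and> x \<longlonglongrightarrow> a"
    show "((\<lambda>\<xi>. LINT s|N. ?h (\<xi> - s) *\<^sub>R \<beta> s) \<circ> x) \<longlonglongrightarrow> (LINT s|N. ?h (a - s) *\<^sub>R \<beta> s)"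
      unfolding comp_def
    proof (rule integral_dominated_convergence[where w="\<lambda>_. max 0 C * K"])
      show "(\<lambda>s. ?h (a - s) *\<^sub>R \<beta> s) \<in> borel_measurable N"
        by (rule measurable_restrict_space1) measurable
      show "(\<lambda>s. ?h (x n - s) *\<^sub>R \<beta> s) \<in> borel_measurable N" for n
        by (rule measurable_restrict_space1) measurable
      show "integrable N (\<lambda>_. max 0 C * K)" by simp
      show "AE s in N. norm (?h (x n - s) *\<^sub>R \<beta> s) \<le> max 0 C * K" for n
      proof (rule AE_I2)
        fix s assume "s \<in> space N"
        then have s: "s \<in> {0..t}" by (simp add: space_restrict_space)
        have "x n \<le> T" using x by auto
        then have "x n - s \<le> T" using s by simp
        then show "norm (?h (x n - s) *\<^sub>R \<beta> s) \<le> max 0 C * K"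
          unfolding norm_scaleR using h_bound bound[OF s] by (intro mult_mono) auto
      qed
      have "AE s in lborel. s \<in> {0..t} \<longrightarrow> (\<lambda>n. ?h (x n - s) *\<^sub>R \<beta> s) \<longlonglongrightarrow> ?h (a - s) *\<^sub>R \<beta> s"
        using AE_lborel_singleton[of "a - \<delta>"]
      proof (rule eventually_mono, intro impI)
        fix s assume "s \<noteq> a - \<delta>"
        have lim: "(\<lambda>n. x n - s) \<longlonglongrightarrow> a - s" using x by (intro tendsto_intros) auto
        have "(\<lambda>n. ?h (x n - s)) \<longlonglongrightarrow> ?h (a - s)"
        proof (cases "\<delta> < a - s")
          case True
          have "isCont k (a - s)"
            using continuous_kernel True assms
            by (simp add: continuous_on_eq_continuous_at open_greaterThan)
          then have "(\<lambda>n. k (x n - s)) \<longlonglongrightarrow> k (a - s)" using lim by (rule isCont_tendsto_compose)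
          moreover have "\<forall>\<^sub>F n in sequentially. \<delta> < x n - s"
            using order_tendstoD(1)[OF lim True] .
          then have "\<forall>\<^sub>F n in sequentially. k (x n - s) = ?h (x n - s)"
            by (rule eventually_mono) (use assms in \<open>auto simp: causal_kernel_def\<close>)
          ultimately have "(\<lambda>n. ?h (x n - s)) \<longlonglongrightarrow> k (a - s)"
            by (rule Lim_transform_eventually)
          then show ?thesis using True assms by (simp add: causal_kernel_def)
        next
          case False
          then have "a - s < \<delta>" using \<open>s \<noteq> a - \<delta>\<close> by simp
          then have "\<forall>\<^sub>F n in sequentially. x n - s < \<delta>"
            using order_tendstoD(2)[OF lim] by blast
          then have "\<forall>\<^sub>F n in sequentially. ?h (x n - s) = ?h (a - s)"
            by (rule eventually_mono) (use False in auto)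
          then show ?thesis by (rule tendsto_eventually)
        qed
        then show "(\<lambda>n. ?h (x n - s) *\<^sub>R \<beta> s) \<longlonglongrightarrow> ?h (a - s) *\<^sub>R \<beta> s"
          by (intro tendsto_scaleR tendsto_const)
      qed
      then show "AE s in N. (\<lambda>n. ?h (x n - s) *\<^sub>R \<beta> s) \<longlonglongrightarrow> ?h (a - s) *\<^sub>R \<beta> s"
        by (subst AE_restrict_space_iff) auto
    qed
  qed
qed

text \<open>The reflection sending \<open>s\<close> to \<open>\<xi> - s\<close> turns the integrals
  into integrals of one fixed function, so the second bound is independent of \<xi>. It provides the
  uniformity in the limit that follows.\<close>

lemma integrable_shifted_kernel:
  assumes "\<xi> \<le> T"
  shows "integrable N (\<lambda>s. \<bar>causal_kernel k (\<xi> - s)\<bar>)"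
    and "(LINT s|N. (if \<xi> - s \<le> \<delta> then \<bar>causal_kernel k (\<xi> - s)\<bar> else 0))
      \<le> (LINT u|lborel. indicator {..\<delta>} u * (indicator {..T} u * \<bar>causal_kernel k u\<bar>))"
proof -
  define q where "q u = indicator {..T} u * \<bar>causal_kernel k u\<bar>" for u
  have q: "integrable lborel q" using integrable_kernel by (simp add: q_def[abs_def])
  have [measurable]: "q \<in> borel_measurable borel" unfolding q_def[abs_def] by measurable
  have "integrable lborel (\<lambda>s. q (\<xi> + (-1) * s))"
    using lborel_integrable_real_affine[OF q, of "-1" \<xi>] by simp
  then have "integrable lborel (\<lambda>s. indicator {0..t} s *\<^sub>R q (\<xi> + (-1) * s))"
    by (intro integrable_mult_indicator) auto
  also have "(\<lambda>s. indicator {0..t} s *\<^sub>R q (\<xi> + (-1) * s)) = (\<lambda>s. indicator {0..t} s *\<^sub>R \<bar>causal_kernel k (\<xi> - s)\<bar>)"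
    using assms by (auto simp: q_def indicator_def)
  finally show "integrable N (\<lambda>s. \<bar>causal_kernel k (\<xi> - s)\<bar>)"
    by (subst integrable_restrict_space) auto
  have q': "integrable lborel (\<lambda>u. indicator {..\<delta>} u * q u)"
    using integrable_mult_indicator[OF _ q, of "{..\<delta>}"] by simp
  have "(LINT s|N. (if \<xi> - s \<le> \<delta> then \<bar>causal_kernel k (\<xi> - s)\<bar> else 0))
    = (LINT s|lborel. indicator {0..t} s *\<^sub>R (if \<xi> - s \<le> \<delta> then \<bar>causal_kernel k (\<xi> - s)\<bar> else 0))"
    by (subst integral_restrict_space) auto
  also have "\<dots> \<le> (LINT s|lborel. indicator {..\<delta>} (\<xi> + (-1) * s) * q (\<xi> + (-1) * s))"
  proof (rule integral_mono')
    show "integrable lborel (\<lambda>s. indicator {..\<delta>} (\<xi> + (-1) * s) * q (\<xi> + (-1) * s))"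
      using lborel_integrable_real_affine[OF q', of "-1" \<xi>] by simp
  qed (use assms in \<open>auto simp: q_def indicator_def\<close>)
  also have "\<dots> = (LINT u|lborel. indicator {..\<delta>} u * q u)"
    using lborel_integral_real_affine[of "-1" "\<lambda>u. indicator {..\<delta>} u * q u" \<xi>] by simp
  finally show "(LINT s|N. (if \<xi> - s \<le> \<delta> then \<bar>causal_kernel k (\<xi> - s)\<bar> else 0))
      \<le> (LINT u|lborel. indicator {..\<delta>} u * (indicator {..T} u * \<bar>causal_kernel k u\<bar>))"
    by (simp add: q_def)
qed

text \<open>A uniform limit of the truncated convolutions is continuous. For \<xi> beyond
  \<open>t\<close> the singularity of the kernel lies outside \<open>{0..t}\<close>, but joining the
  two branches of the path requires continuity up to \<xi> = \<open>t\<close>, where the singularity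
  sits at the end point of integration.\<close>

lemma continuous_on_convolution: "continuous_on {..T} (\<lambda>\<xi>. LINT s|N. causal_kernel k (\<xi> - s) *\<^sub>R \<beta> s)"
proof (rule uniform_limit_theorem)
  define \<delta> where "\<delta> n = 1 / real (Suc n)" for n
  let ?D = "\<lambda>n \<xi>. LINT s|N. (if \<delta> n < \<xi> - s then causal_kernel k (\<xi> - s) else 0) *\<^sub>R \<beta> s"
  let ?D' = "\<lambda>\<xi>. LINT s|N. causal_kernel k (\<xi> - s) *\<^sub>R \<beta> s"
  \<comment> \<open>This is the mass of the kernel up to distance \<open>\<delta> n\<close> from its
    singularity; multiplied by the bound \<open>K\<close> it dominates the truncation error for all
    \<xi> in \<open>{..T}\<close>.\<close>
  define E where "E n = (LINT u|lborel. indicator {..\<delta> n} u * (indicator {..T} u * \<bar>causal_kernel k u\<bar>))" for n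
  show "\<forall>\<^sub>F n in sequentially. continuous_on {..T} (?D n)"
    by (intro always_eventually allI continuous_on_truncated_convolution) (simp add: \<delta>_def)
  have \<delta>0: "\<delta> \<longlonglongrightarrow> 0"
    using LIMSEQ_inverse_real_of_nat by (simp add: \<delta>_def[abs_def] divide_inverse)
  have "E \<longlonglongrightarrow> (LINT u|(lborel :: real measure). 0 :: real)"
    unfolding E_def
  proof (rule integral_dominated_convergence[OF _ _ integrable_kernel])
    show "AE u in lborel. (\<lambda>n. indicator {..\<delta> n} u * (indicator {..T} u * \<bar>causal_kernel k u\<bar>)) \<longlonglongrightarrow> 0"
    proof (rule AE_I2)
      fix u :: real
      show "(\<lambda>n. indicator {..\<delta> n} u * (indicator {..T} u * \<bar>causal_kernel k u\<bar>)) \<longlonglongrightarrow> 0"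
      proof (cases "0 < u")
        case True
        have "\<forall>\<^sub>F n in sequentially. \<delta> n < u" using order_tendstoD(2)[OF \<delta>0 True] .
        then have "\<forall>\<^sub>F n in sequentially. indicator {..\<delta> n} u * (indicator {..T} u * \<bar>causal_kernel k u\<bar>) = 0"
          by (rule eventually_mono) auto
        then show ?thesis by (rule tendsto_eventually)
      qed (simp add: causal_kernel_def)
    qed
    show "AE u in lborel. norm (indicator {..\<delta> n} u * (indicator {..T} u * \<bar>causal_kernel k u\<bar>))
      \<le> indicator {..T} u * \<bar>causal_kernel k u\<bar>" for n
      by (intro AE_I2) (auto simp: indicator_def)
  qed measurable
  then have "(\<lambda>n. K * E n) \<longlonglongrightarrow> 0"
    using tendsto_mult_right_zero[of E sequentially K] by simp
  show "uniform_limit {..T} ?D ?D' sequentially"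
  proof (rule uniform_limitI)
    fix e :: real assume "0 < e"
    from order_tendstoD(2)[OF \<open>(\<lambda>n. K * E n) \<longlonglongrightarrow> 0\<close> this]
    show "\<forall>\<^sub>F n in sequentially. \<forall>\<xi>\<in>{..T}. dist (?D n \<xi>) (?D' \<xi>) < e"
    proof (rule eventually_mono, intro ballI)
      fix n \<xi> assume n: "K * E n < e" and "\<xi> \<in> {..T}"
      then have \<xi>: "\<xi> \<le> T" by simp
      let ?c = "\<lambda>s. causal_kernel k (\<xi> - s)"
      have m [measurable]: "?c \<in> borel_measurable N" "\<beta> \<in> borel_measurable N"
        by (rule measurable_restrict_space1, measurable)+
      have [measurable]: "(\<lambda>s. s) \<in> borel_measurable N" by (rule measurable_restrict_space1) simp
      have dom: "integrable N (\<lambda>s. K * \<bar>?c s\<bar>)"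
        using integrable_shifted_kernel(1)[OF \<xi>] by simp
      have nb: "norm (\<beta> s) \<le> K" if "s \<in> space N" for s
        using that bound by (simp add: space_restrict_space)
      have i1: "integrable N (\<lambda>s. ?c s *\<^sub>R \<beta> s)"
        by (rule Bochner_Integration.integrable_bound[OF dom])
          (use nb K_nonneg in \<open>auto simp: abs_mult mult.commute[of K] intro!: AE_I2 mult_left_mono\<close>)
      have i2: "integrable N (\<lambda>s. (if \<delta> n < \<xi> - s then ?c s else 0) *\<^sub>R \<beta> s)"
        by (rule Bochner_Integration.integrable_bound[OF dom])
          (use nb K_nonneg in \<open>auto simp: abs_mult mult.commute[of K] intro!: AE_I2 mult_left_mono\<close>)
      have "dist (?D n \<xi>) (?D' \<xi>) = norm (?D' \<xi> - ?D n \<xi>)"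
        by (simp only: dist_norm norm_minus_commute)
      also have "\<dots> = norm (LINT s|N. (if \<xi> - s \<le> \<delta> n then ?c s else 0) *\<^sub>R \<beta> s)"
        unfolding Bochner_Integration.integral_diff[OF i1 i2, symmetric]
        by (intro arg_cong[where f=norm] Bochner_Integration.integral_cong) auto
      also have "\<dots> \<le> (LINT s|N. K * (if \<xi> - s \<le> \<delta> n then \<bar>?c s\<bar> else 0))"
      proof (rule order_trans[OF integral_norm_bound integral_mono], rule integrable_norm)
        show "integrable N (\<lambda>s. (if \<xi> - s \<le> \<delta> n then ?c s else 0) *\<^sub>R \<beta> s)"
          by (rule Bochner_Integration.integrable_bound[OF dom])
            (use nb K_nonneg in \<open>auto simp: abs_mult mult.commute[of K] intro!: AE_I2 mult_left_mono\<close>)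
        show "integrable N (\<lambda>s. K * (if \<xi> - s \<le> \<delta> n then \<bar>?c s\<bar> else 0))"
          by (rule Bochner_Integration.integrable_bound[OF dom])
            (use K_nonneg in \<open>auto simp: abs_mult intro!: AE_I2\<close>)
      qed (use nb in \<open>auto simp: mult.commute intro!: mult_right_mono mult_left_mono\<close>)
      also have "\<dots> = K * (LINT s|N. (if \<xi> - s \<le> \<delta> n then \<bar>?c s\<bar> else 0))" by simp
      also have "\<dots> \<le> K * E n"
        unfolding E_def by (intro mult_left_mono integrable_shifted_kernel(2)[OF \<xi>] K_nonneg)
      finally show "dist (?D n \<xi>) (?D' \<xi>) < e" using n by simp
    qed
  qed
qed simp

text \<open>The sections are bounded in L^2 uniformly in \<open>s\<close>, with square at most
  \<open>K\<^sup>2 * energy\<close>, so the interchange of Bochner and pointwise integrals applies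
  on the finite measure \<open>N\<close>.\<close>

lemma l2_convolution:
  defines "f \<equiv> (\<lambda>s \<xi>. if \<xi> \<in> {0..T} then causal_kernel k (\<xi> - s) *\<^sub>R \<beta> s else 0)"
  shows "square_integrable (\<lambda>\<xi>. if \<xi> \<in> {0..T} then (LINT s|N. causal_kernel k (\<xi> - s) *\<^sub>R \<beta> s) else 0)"
    and "set_integrable lborel {0..t} (\<lambda>s. l2_class (f s))"
    and "(LINT s:{0..t}|lborel. l2_class (f s)) = l2_on T (\<lambda>\<xi>. LINT s|N. causal_kernel k (\<xi> - s) *\<^sub>R \<beta> s)"
proof -
  have meas: "(\<lambda>(s, \<xi>). f s \<xi>) \<in> borel_measurable (N \<Otimes>\<^sub>M lborel)"
  proof -
    have [measurable]: "fst \<in> borel_measurable (N \<Otimes>\<^sub>M lborel)"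
      by (rule measurable_compose[OF measurable_fst]) (rule measurable_restrict_space1, simp)
    show ?thesis unfolding f_def case_prod_unfold by measurable
  qed
  have bnd: "(\<integral>\<^sup>+\<xi>. ennreal ((norm (f s \<xi>))\<^sup>2) \<partial>lborel) \<le> ennreal (K\<^sup>2 * energy)" if "s \<in> space N" for s
  proof -
    have s: "s \<in> {0..t}" using that by (simp add: space_restrict_space)
    have "(\<integral>\<^sup>+\<xi>. ennreal ((norm (f s \<xi>))\<^sup>2) \<partial>lborel)
      \<le> (\<integral>\<^sup>+\<xi>. ennreal (K\<^sup>2) * (ennreal ((causal_kernel k (\<xi> - s))\<^sup>2) * indicator {0..T} \<xi>) \<partial>lborel)"
    proof (rule nn_integral_mono)
      fix \<xi>
      have "(norm (\<beta> s))\<^sup>2 \<le> K\<^sup>2" using bound[OF s] by (intro power_mono) auto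
      then have "(causal_kernel k (\<xi> - s))\<^sup>2 * (norm (\<beta> s))\<^sup>2 \<le> K\<^sup>2 * (causal_kernel k (\<xi> - s))\<^sup>2"
        by (subst mult.commute) (rule mult_right_mono, simp_all)
      then show "ennreal ((norm (f s \<xi>))\<^sup>2)
        \<le> ennreal (K\<^sup>2) * (ennreal ((causal_kernel k (\<xi> - s))\<^sup>2) * indicator {0..T} \<xi>)"
        by (auto simp: f_def indicator_def power_mult_distrib ennreal_mult[symmetric])
    qed
    also have "\<dots> = ennreal (K\<^sup>2) * (\<integral>\<^sup>+\<xi>\<in>{0..T}. ennreal ((causal_kernel k (\<xi> - s))\<^sup>2) \<partial>lborel)"
      by (rule nn_integral_cmult) measurable
    also have "\<dots> \<le> ennreal (K\<^sup>2) * ennreal energy"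
      using s by (intro mult_left_mono nn_integral_kernel_square_le) auto
    finally show ?thesis by (simp add: ennreal_mult')
  qed
  have eq: "(\<lambda>\<xi>. LINT s|N. f s \<xi>) = (\<lambda>\<xi>. if \<xi> \<in> {0..T} then (LINT s|N. causal_kernel k (\<xi> - s) *\<^sub>R \<beta> s) else 0)"
  proof
    show "(LINT s|N. f s \<xi>) = (if \<xi> \<in> {0..T} then (LINT s|N. causal_kernel k (\<xi> - s) *\<^sub>R \<beta> s) else 0)" for \<xi>
      by (cases "\<xi> \<in> {0..T}") (simp_all only: f_def if_True if_False Bochner_Integration.integral_zero)
  qed
  have r: "square_integrable (\<lambda>\<xi>. LINT s|N. f s \<xi>)" "integrable N (\<lambda>s. l2_class (f s))"
    "(LINT s|N. l2_class (f s)) = l2_class (\<lambda>\<xi>. LINT s|N. f s \<xi>)"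
    by (rule square_integrable_integral[OF finite_measure_N meas bnd], assumption)+
  show "square_integrable (\<lambda>\<xi>. if \<xi> \<in> {0..T} then (LINT s|N. causal_kernel k (\<xi> - s) *\<^sub>R \<beta> s) else 0)"
    using r(1) unfolding eq .
  show "set_integrable lborel {0..t} (\<lambda>s. l2_class (f s))"
    using r(2) unfolding set_integrable_def by (subst (asm) integrable_restrict_space) auto
  have "(LINT s:{0..t}|lborel. l2_class (f s)) = (LINT s|N. l2_class (f s))"
    unfolding set_lebesgue_integral_def by (subst integral_restrict_space) auto
  also have "\<dots> = l2_on T (\<lambda>\<xi>. LINT s|N. causal_kernel k (\<xi> - s) *\<^sub>R \<beta> s)"
    unfolding r(3) eq l2_on_def ..
  finally show "(LINT s:{0..t}|lborel. l2_class (f s)) = l2_on T (\<lambda>\<xi>. LINT s|N. causal_kernel k (\<xi> - s) *\<^sub>R \<beta> s)" .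
qed

text \<open>The upper limit \<open>min \<xi> t\<close> unites the drift of the Volterra equation,
  for \<xi> \<le> \<open>t\<close>, with that of \<open>volterra_theta\<close>, for \<xi> beyond
  \<open>t\<close>.\<close>

lemma set_integral_convolution_causal:
  "(LINT s:{0..min \<xi> t}|lborel. k (\<xi> - s) *\<^sub>R \<beta> s) = (LINT s|N. causal_kernel k (\<xi> - s) *\<^sub>R \<beta> s)"
proof -
  have "(LINT s:{0..min \<xi> t}|lborel. k (\<xi> - s) *\<^sub>R \<beta> s)
    = (LINT s|lborel. indicator {0..min \<xi> t} s *\<^sub>R (if s = \<xi> then k 0 else causal_kernel k (\<xi> - s)) *\<^sub>R \<beta> s)"
    unfolding set_lebesgue_integral_def
    by (intro Bochner_Integration.integral_cong) (auto simp: indicator_def causal_kernel_def)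
  also have "\<dots> = (LINT s|lborel. indicator {0..t} s *\<^sub>R causal_kernel k (\<xi> - s) *\<^sub>R \<beta> s)"
  proof (rule integral_cong_AE)
    show "AE s in lborel. indicator {0..min \<xi> t} s *\<^sub>R (if s = \<xi> then k 0 else causal_kernel k (\<xi> - s)) *\<^sub>R \<beta> s
      = indicator {0..t} s *\<^sub>R causal_kernel k (\<xi> - s) *\<^sub>R \<beta> s"
      using AE_lborel_singleton[of \<xi>]
      by (rule eventually_mono) (auto simp: indicator_def causal_kernel_def)
  qed measurable
  also have "\<dots> = (LINT s|N. causal_kernel k (\<xi> - s) *\<^sub>R \<beta> s)"
    by (subst integral_restrict_space) auto
  finally show ?thesis .
qed

end
end

section \<open>The lifted equation\<close>

lemma has_ito_integral_AE_cong:
  fixes Z Z' :: "'a \<Rightarrow> 'h::{real_inner, banach, second_countable_topology}"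
  assumes "has_ito_integral M F W t \<Phi> Z" "Z' \<in> borel_measurable M" "AE \<omega> in M. Z \<omega> = Z' \<omega>"
  shows "has_ito_integral M F W t \<Phi> Z'"
proof -
  have "(\<integral>\<^sup>+\<omega>. ennreal ((norm (Z' \<omega> - E \<omega>))\<^sup>2) \<partial>M) = (\<integral>\<^sup>+\<omega>. ennreal ((norm (Z \<omega> - E \<omega>))\<^sup>2) \<partial>M)" for E
    using assms(3) by (intro nn_integral_cong_AE) (auto elim: eventually_mono)
  with assms show ?thesis unfolding has_ito_integral_def by simp
qed

text \<open>Both \<open>ito_integral\<close> and \<open>LINT\<close> are total, so an identity
  between them is informative only together with existence of the integrals; hence the conclusion
  also asserts integrability. The hypothesis on \<open>J\<close> at \<xi> = \<open>t\<close>
  likewise guarantees that the integral occurring in \<open>volterra_solution\<close> exists.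
  Continuity of the path is stated because it is what makes the drift at the path
  meaningful.\<close>

theorem proposition2:
  fixes M :: "'a measure" and F :: "real \<Rightarrow> 'a measure"
    and W X :: "real \<Rightarrow> 'a \<Rightarrow> real ^ 'd"
    and J :: "real \<Rightarrow> real \<Rightarrow> 'a \<Rightarrow> real ^ 'd"
    and b :: "real \<Rightarrow> real ^ 'd \<Rightarrow> real ^ 'd" and k1 :: "real \<Rightarrow> real"
    and x0 :: "real ^ 'd" and T \<alpha> L :: real
  assumes "0 < T"
    and "prob_space M" and "complete_measure M"
    and "usual_filtration M T F"
    and "brownian_motion M T F W"
    and "1/2 < \<alpha>" and "\<alpha> < 1"
    and "continuous_on {0<..} k1"
    and "\<And>r. 0 < r \<Longrightarrow> set_integrable lborel {0<..r} (\<lambda>s. (k1 s)\<^sup>2)"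
    and "(\<lambda>(t, x). b t x) \<in> borel_measurable (restrict_space borel ({0..T} \<times> UNIV))"
    and "0 < L"
    and "\<And>t x. t \<in> {0..T} \<Longrightarrow> norm (b t x) \<le> L * (1 + norm x)"
    and "\<And>t x y. t \<in> {0..T} \<Longrightarrow> norm (b t x - b t y) \<le> L * norm (x - y)"
    and "volterra_solution M F W T x0 b k1 (fractional_kernel \<alpha>) X"
    and "\<And>t \<xi>. t \<in> {0..T} \<Longrightarrow> \<xi> \<in> {t..T} \<Longrightarrow>
      has_ito_integral M F W t (\<lambda>s _. fractional_kernel \<alpha> (\<xi> - s) *\<^sub>R id_blinfun) (J t \<xi>)"
    and "\<And>t. t \<in> {0..T} \<Longrightarrow> AE \<omega> in M. continuous_on {t..T} (\<lambda>\<xi>. J t \<xi> \<omega>)"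
  shows "\<forall>t\<in>{0..T}.
    ito_integrable M F W t (\<lambda>s _. lifted_diffusion T (fractional_kernel \<alpha>) s) \<and>
    (AE \<omega> in M. let w = volterra_path x0 b k1 X J t \<omega> in
      continuous_on {0..T} w \<and>
      set_integrable lborel {0..t} (\<lambda>s. lifted_drift T k1 b s w) \<and>
      l2_on T w = l2_on T (\<lambda>_. x0)
        + (LINT s:{0..t}|lborel. lifted_drift T k1 b s w)
        + ito_integral M F W t (\<lambda>s _. lifted_diffusion T (fractional_kernel \<alpha>) s) \<omega>)"
proof
  interpret brownian_basis M T F W
    using assms(2,4,5) by (simp add: brownian_basis_def brownian_basis_axioms_def)
  interpret convolution_kernel k1 T
    using assms(1,8,9) by unfold_locales auto
  let ?k2 = "fractional_kernel \<alpha>"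
  let ?\<kappa> = "causal_kernel (fractional_kernel \<alpha>)"
  note J_ito = assms(15) and J_cont = assms(16)
  have X_cont: "AE \<omega> in M. continuous_on {0..T} (\<lambda>t. X t \<omega>)"
    and X_eq: "\<And>t. t \<in> {0..T} \<Longrightarrow> AE \<omega> in M. X t \<omega> = x0 + (LINT s:{0..t}|lborel. k1 (t - s) *\<^sub>R b s (X s \<omega>))
        + ito_integral M F W t (\<lambda>s _. ?k2 (t - s) *\<^sub>R id_blinfun) \<omega>"
    and "\<And>t. t \<in> {0..T} \<Longrightarrow> X t \<in> borel_measurable (F t)"
    using assms(14) by (auto simp: volterra_solution_def)
  then have X_meas: "\<And>t. t \<in> {0..T} \<Longrightarrow> X t \<in> borel_measurable M"
    by (blast intro: measurable_F_M)
  obtain Y where Y [measurable]: "(\<lambda>(s, \<omega>). Y s \<omega>) \<in> borel_measurable (borel \<Otimes>\<^sub>M M)"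
    and Y_cont: "\<And>\<omega>. \<omega> \<in> space M \<Longrightarrow> continuous_on UNIV (\<lambda>s. Y s \<omega>)"
    and YX: "AE \<omega> in M. \<forall>s\<in>{0..T}. Y s \<omega> = X s \<omega>"
    using jointly_measurable_version[of 0 T X M] X_meas X_cont assms(1) by (auto intro: less_imp_le)
  \<comment> \<open>The drift coefficient along the trajectory. Measurability of \<open>b\<close> is
    given only on \<open>{0..T} \<times> UNIV\<close>, so it is extended by zero before being
    composed with the jointly measurable \<open>Y\<close>.\<close>
  define \<beta> where "\<beta> \<omega> s = (if s \<in> {0..T} then b s (Y s \<omega>) else 0)" for \<omega> s
  have \<beta>_meas [measurable]: "(\<lambda>(s, \<omega>). \<beta> \<omega> s) \<in> borel_measurable (borel \<Otimes>\<^sub>M M)"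
  proof -
    have "(\<lambda>z. if z \<in> {0..T} \<times> UNIV then (case z of (s, x) \<Rightarrow> b s x) else 0) \<in> borel_measurable borel"
      using assms(10) by (subst (asm) measurable_restrict_space_iff[where c=0]) (auto simp: borel_Times)
    also have "(\<lambda>z. if z \<in> {0..T} \<times> UNIV then (case z of (s, x) \<Rightarrow> b s x) else 0)
      = (\<lambda>(s, x). if s \<in> {0..T} then b s x else 0)" by auto
    finally have "(\<lambda>(s, x). if s \<in> {0..T} then b s x else 0) \<in> borel_measurable (borel \<Otimes>\<^sub>M borel)"
      by (simp only: borel_prod)
    then have "(\<lambda>z. case (fst z, (case z of (s, \<omega>) \<Rightarrow> Y s \<omega>)) of (s, x) \<Rightarrow> if s \<in> {0..T} then b s x else 0)
        \<in> borel_measurable (borel \<Otimes>\<^sub>M M)"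
      by (rule measurable_compose[rotated]) measurable
    also have "(\<lambda>z. case (fst z, (case z of (s, \<omega>) \<Rightarrow> Y s \<omega>)) of (s, x) \<Rightarrow> if s \<in> {0..T} then b s x else 0)
        = (\<lambda>(s, \<omega>). \<beta> \<omega> s)" by (auto simp: \<beta>_def)
    finally show ?thesis .
  qed
  have \<beta>_meas' [measurable]: "\<beta> \<omega> \<in> borel_measurable borel" if "\<omega> \<in> space M" for \<omega>
    using that by measurable
  \<comment> \<open>Linear growth along a trajectory that is bounded on a compact interval. The
    bound depends on \<omega>, which is harmless as the drift is treated pathwise.\<close>
  have \<beta>_bound: "\<exists>K. \<forall>s\<in>{0..T}. norm (\<beta> \<omega> s) \<le> K" if "\<omega> \<in> space M" for \<omega>
  proof -
    have "bounded ((\<lambda>s. Y s \<omega>) ` {0..T})"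
      using continuous_on_subset[OF Y_cont[OF that]]
      by (intro compact_imp_bounded compact_continuous_image) auto
    then obtain C where "\<forall>x\<in>(\<lambda>s. Y s \<omega>) ` {0..T}. norm x \<le> C" unfolding bounded_iff by blast
    then have C: "\<And>s. s \<in> {0..T} \<Longrightarrow> norm (Y s \<omega>) \<le> C" by simp
    have "norm (\<beta> \<omega> s) \<le> L * (1 + C)" if "s \<in> {0..T}" for s
      using order_trans[OF assms(12)[OF that] mult_left_mono[of "1 + norm (Y s \<omega>)" "1 + C" L]]
        that assms(11) C[OF that] by (simp add: \<beta>_def)
    then show ?thesis by blast
  qed
  fix t assume t: "t \<in> {0..T}"
  define N where "N = restrict_space lborel {0..t}"
  define D where "D \<xi> \<omega> = (LINT s|N. causal_kernel k1 (\<xi> - s) *\<^sub>R \<beta> \<omega> s)" for \<xi> \<omega>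
  have D_eq: "(LINT s:{0..min \<xi> t}|lborel. k1 (\<xi> - s) *\<^sub>R b s (X s \<omega>)) = D \<xi> \<omega>"
    if "\<omega> \<in> space M" "\<forall>s\<in>{0..T}. Y s \<omega> = X s \<omega>" for \<xi> \<omega>
  proof -
    have "(LINT s:{0..min \<xi> t}|lborel. k1 (\<xi> - s) *\<^sub>R b s (X s \<omega>)) = (LINT s:{0..min \<xi> t}|lborel. k1 (\<xi> - s) *\<^sub>R \<beta> \<omega> s)"
      using that t by (intro set_lebesgue_integral_cong) (auto simp: \<beta>_def)
    also have "\<dots> = D \<xi> \<omega>"
      unfolding D_def N_def using \<beta>_bound[OF that(1)] t that(1)
      by (elim exE, intro set_integral_convolution_causal) auto
    finally show ?thesis .
  qed
  obtain I where I [measurable]: "(\<lambda>(\<xi>, \<omega>). I \<xi> \<omega>) \<in> borel_measurable (borel \<Otimes>\<^sub>M M)"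
    and I_cont: "\<And>\<omega>. \<omega> \<in> space M \<Longrightarrow> continuous_on UNIV (\<lambda>\<xi>. I \<xi> \<omega>)"
    and IJ: "AE \<omega> in M. \<forall>\<xi>\<in>{t..T}. I \<xi> \<omega> = J t \<xi> \<omega>"
    using jointly_measurable_version[of t T "J t" M] J_ito[OF t] J_cont[OF t] t
    by (auto simp: has_ito_integral_def)
  have D_meas [measurable]: "(\<lambda>(\<xi>, \<omega>). D \<xi> \<omega>) \<in> borel_measurable (borel \<Otimes>\<^sub>M M)"
  proof -
    interpret N: finite_measure N unfolding N_def by (rule finite_measureI)
        (simp add: emeasure_restrict_space space_restrict_space emeasure_lborel_Icc_eq)
    have [measurable]: "(\<lambda>s. s) \<in> borel_measurable N" unfolding N_def by (rule measurable_restrict_space1) simp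
    have "(\<lambda>z. case (snd z, snd (fst z)) of (s, \<omega>) \<Rightarrow> \<beta> \<omega> s) \<in> borel_measurable ((borel \<Otimes>\<^sub>M M) \<Otimes>\<^sub>M N)"
      by (rule measurable_compose[OF _ \<beta>_meas]) measurable
    then have [measurable]: "(\<lambda>z. \<beta> (snd (fst z)) (snd z)) \<in> borel_measurable ((borel \<Otimes>\<^sub>M M) \<Otimes>\<^sub>M N)"
      by simp
    show ?thesis unfolding D_def case_prod_unfold by measurable
  qed
  \<comment> \<open>Written with \<open>Y\<close>, \<open>D\<close> and \<open>I\<close> instead of
    the path itself, so that joint measurability holds for all outcomes rather than off a null
    set.\<close>
  define G where "G \<xi> \<omega> = (if \<xi> \<le> t then Y \<xi> \<omega> - x0 - D \<xi> \<omega> else I \<xi> \<omega>)" for \<xi> \<omega>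
  have G_meas [measurable]: "(\<lambda>(\<xi>, \<omega>). G \<xi> \<omega>) \<in> borel_measurable (lborel \<Otimes>\<^sub>M M)"
    unfolding G_def by measurable
  \<comment> \<open>The chosen version in the Volterra equation is exchanged for
    \<open>J \<xi> \<xi>\<close>. The null set depends on \<xi>, so this is used for one \<xi> at a
    time only.\<close>
  have XJ: "AE \<omega> in M. X \<xi> \<omega> = x0 + D \<xi> \<omega> + J \<xi> \<xi> \<omega>" if \<xi>: "\<xi> \<in> {0..t}" for \<xi>
  proof -
    have \<xi>T: "\<xi> \<in> {0..T}" using \<xi> t by auto
    then have "has_ito_integral M F W \<xi> (\<lambda>s _. ?k2 (\<xi> - s) *\<^sub>R id_blinfun) (J \<xi> \<xi>)"
      by (intro J_ito) auto
    then have "AE \<omega> in M. ito_integral M F W \<xi> (\<lambda>s _. ?k2 (\<xi> - s) *\<^sub>R id_blinfun) \<omega> = J \<xi> \<xi> \<omega>"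
      by (rule ito_integral_eq) (use \<xi>T in auto)
    with X_eq[OF \<xi>T] YX AE_space show ?thesis
    proof eventually_elim
      case (elim \<omega>)
      then show ?case using D_eq[of \<omega> \<xi>] \<xi> by (simp add: min_absorb1)
    qed
  qed
  have "has_ito_integral M F W t (\<lambda>s _. ?\<kappa> (\<xi> - s) *\<^sub>R id_blinfun) (G \<xi>)" if \<xi>: "\<xi> \<in> {0..T}" for \<xi>
  proof -
    have G\<xi>: "G \<xi> \<in> borel_measurable M" by measurable
    show ?thesis
    proof (cases "\<xi> \<le> t")
      case True
      have "has_ito_integral M F W \<xi> (\<lambda>s _. ?k2 (\<xi> - s) *\<^sub>R id_blinfun) (J \<xi> \<xi>)"
        using \<xi> by (intro J_ito) auto
      from has_ito_integral_extend[OF this True]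
      \<comment> \<open>At \<open>s = \<xi>\<close> the integrands agree because
        \<open>fractional_kernel \<alpha> 0\<close> is 0.\<close>
      have "has_ito_integral M F W t (\<lambda>s _. ?\<kappa> (\<xi> - s) *\<^sub>R id_blinfun) (J \<xi> \<xi>)"
        by (rule has_ito_integral_cong) (auto simp: causal_kernel_def fractional_kernel_def)
      then show ?thesis
      proof (rule has_ito_integral_AE_cong[OF _ G\<xi>])
        have "\<xi> \<in> {0..t}" using \<xi> True by simp
        from XJ[OF this] YX show "AE \<omega> in M. J \<xi> \<xi> \<omega> = G \<xi> \<omega>"
          by eventually_elim (use True \<xi> in \<open>simp add: G_def\<close>)
      qed
    next
      case False
      have "has_ito_integral M F W t (\<lambda>s _. ?k2 (\<xi> - s) *\<^sub>R id_blinfun) (J t \<xi>)"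
        using \<xi> t False by (intro J_ito) auto
      then have "has_ito_integral M F W t (\<lambda>s _. ?\<kappa> (\<xi> - s) *\<^sub>R id_blinfun) (J t \<xi>)"
        by (rule has_ito_integral_cong) (use False in \<open>auto simp: causal_kernel_def\<close>)
      then show ?thesis
      proof (rule has_ito_integral_AE_cong[OF _ G\<xi>])
        show "AE \<omega> in M. J t \<xi> \<omega> = G \<xi> \<omega>"
          using IJ by eventually_elim (use False \<xi> in \<open>simp add: G_def\<close>)
      qed
    qed
  qed
  then have Z: "has_ito_integral M F W t (\<lambda>s _. lifted_diffusion T ?k2 s) (\<lambda>\<omega>. l2_on T (\<lambda>\<xi>. G \<xi> \<omega>))"
    using assms(6,7) t by (intro has_ito_integral_lifted_diffusion) auto
  then have "AE \<omega> in M. ito_integral M F W t (\<lambda>s _. lifted_diffusion T ?k2 s) \<omega> = l2_on T (\<lambda>\<xi>. G \<xi> \<omega>)"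
    by (rule ito_integral_eq) (use t in auto)
  \<comment> \<open>This single instance glues the two branches of the path continuously at time
    \<open>t\<close>.\<close>
  moreover have "AE \<omega> in M. X t \<omega> = x0 + D t \<omega> + J t t \<omega>"
    using XJ[of t] t by auto
  ultimately have "AE \<omega> in M. let w = volterra_path x0 b k1 X J t \<omega> in
      continuous_on {0..T} w \<and>
      set_integrable lborel {0..t} (\<lambda>s. lifted_drift T k1 b s w) \<and>
      l2_on T w = l2_on T (\<lambda>_. x0)
        + (LINT s:{0..t}|lborel. lifted_drift T k1 b s w)
        + ito_integral M F W t (\<lambda>s _. lifted_diffusion T ?k2 s) \<omega>"
    using YX IJ AE_space
  \<comment> \<open>None of the remaining almost sure statements is indexed by \<xi>, so the rest
    concerns one fixed trajectory.\<close>
  proof eventually_elim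
    case (elim \<omega>)
    note \<omega> = \<open>\<omega> \<in> space M\<close>
    define w where "w = volterra_path x0 b k1 X J t \<omega>"
    obtain K where "\<And>s. s \<in> {0..T} \<Longrightarrow> norm (\<beta> \<omega> s) \<le> K" using \<beta>_bound[OF \<omega>] by blast
    then have K: "\<And>s. s \<in> {0..t} \<Longrightarrow> norm (\<beta> \<omega> s) \<le> K" using t by auto
    have t0: "0 \<le> t" using t by simp
    have w_eq: "w \<xi> = (if \<xi> \<le> t then Y \<xi> \<omega> else x0 + D \<xi> \<omega> + I \<xi> \<omega>)" if "\<xi> \<in> {0..T}" for \<xi>
      using that elim D_eq[OF \<omega>, of \<xi>]
      by (auto simp: w_def volterra_path_def volterra_theta_def min_absorb2)
    have D_cont: "continuous_on {..T} (\<lambda>\<xi>. D \<xi> \<omega>)"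
      unfolding D_def N_def by (rule continuous_on_convolution[OF \<beta>_meas'[OF \<omega>] K t0])
    have "continuous_on {0..T} (\<lambda>\<xi>. if \<xi> \<le> t then Y \<xi> \<omega> else x0 + D \<xi> \<omega> + I \<xi> \<omega>)"
    proof (rule continuous_on_cases_le[where h="\<lambda>\<xi>. \<xi>"])
      show "continuous_on {\<xi> \<in> {0..T}. \<xi> \<le> t} (\<lambda>\<xi>. Y \<xi> \<omega>)"
        by (rule continuous_on_subset[OF Y_cont[OF \<omega>]]) simp
      show "continuous_on {\<xi> \<in> {0..T}. t \<le> \<xi>} (\<lambda>\<xi>. x0 + D \<xi> \<omega> + I \<xi> \<omega>)"
        by (intro continuous_intros continuous_on_subset[OF D_cont] continuous_on_subset[OF I_cont[OF \<omega>]]) auto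
      show "Y \<xi> \<omega> = x0 + D \<xi> \<omega> + I \<xi> \<omega>" if "\<xi> \<in> {0..T}" "\<xi> = t" for \<xi>
        using that elim by simp
    qed simp
    then have w_cont: "continuous_on {0..T} w"
      using w_eq by (subst continuous_on_cong) auto
    define f where "f s = (\<lambda>\<xi>. if \<xi> \<in> {0..T} then causal_kernel k1 (\<xi> - s) *\<^sub>R \<beta> \<omega> s else 0)" for s
    have conv: "square_integrable (\<lambda>\<xi>. if \<xi> \<in> {0..T} then D \<xi> \<omega> else 0)"
      "set_integrable lborel {0..t} (\<lambda>s. l2_class (f s))"
      "(LINT s:{0..t}|lborel. l2_class (f s)) = l2_on T (\<lambda>\<xi>. D \<xi> \<omega>)"
      unfolding D_def N_def f_def by (rule l2_convolution[OF \<beta>_meas'[OF \<omega>] K t0], assumption)+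
    \<comment> \<open>For \<open>s \<le> t\<close> the path at time \<open>s\<close> is the solution
      itself, so the path-dependent drift reduces to the coefficient already contained in
      \<beta>.\<close>
    have drift: "lifted_drift T k1 b s w = l2_class (f s)" if "s \<in> {0..t}" for s
    proof -
      have "w s = Y s \<omega>" "s \<in> {0..T}" using that t w_eq[of s] by auto
      then show ?thesis
        unfolding lifted_drift_def l2_on_def f_def
        by (intro arg_cong[where f=l2_class]) (auto simp: causal_kernel_def \<beta>_def)
    qed
    have "set_integrable lborel {0..t} (\<lambda>s. lifted_drift T k1 b s w)"
      using conv(2) by (subst set_integrable_cong[OF refl refl drift])
    moreover have drift_int: "(LINT s:{0..t}|lborel. lifted_drift T k1 b s w) = l2_on T (\<lambda>\<xi>. D \<xi> \<omega>)"
      unfolding conv(3)[symmetric] by (intro set_lebesgue_integral_cong) (auto simp: drift)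
    moreover have "l2_on T w = l2_on T (\<lambda>_. x0) + l2_on T (\<lambda>\<xi>. D \<xi> \<omega>) + l2_on T (\<lambda>\<xi>. G \<xi> \<omega>)"
    proof -
      note sq_w = square_integrable_continuous_on[OF w_cont]
      have sq_x0: "square_integrable (\<lambda>\<xi>. if \<xi> \<in> {0..T} then x0 else 0)"
        by (rule square_integrable_continuous_on) (rule continuous_on_const)
      have eq1: "(\<lambda>\<xi>. if \<xi> \<in> {0..T} then x0 + D \<xi> \<omega> else 0)
        = (\<lambda>\<xi>. (if \<xi> \<in> {0..T} then x0 else 0) + (if \<xi> \<in> {0..T} then D \<xi> \<omega> else 0))" by auto
      have sq1: "square_integrable (\<lambda>\<xi>. if \<xi> \<in> {0..T} then x0 + D \<xi> \<omega> else 0)"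
        unfolding eq1 by (rule square_integrable_add[OF sq_x0 conv(1)])
      \<comment> \<open>Only here does the trajectory of \<open>G\<close> become square-integrable,
        as a difference of the continuous path and the drift part. Its class is thereby no longer a
        possible default value, and additivity may be applied.\<close>
      have "(\<lambda>\<xi>. if \<xi> \<in> {0..T} then G \<xi> \<omega> else 0)
        = (\<lambda>\<xi>. (if \<xi> \<in> {0..T} then w \<xi> else 0) - (if \<xi> \<in> {0..T} then x0 + D \<xi> \<omega> else 0))"
        by (auto simp: w_eq G_def)
      then have sqG: "square_integrable (\<lambda>\<xi>. if \<xi> \<in> {0..T} then G \<xi> \<omega> else 0)"
        using square_integrable_diff[OF sq_w sq1] by simp
      have "l2_on T w = l2_on T (\<lambda>\<xi>. (x0 + D \<xi> \<omega>) + G \<xi> \<omega>)"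
        unfolding l2_on_def by (intro arg_cong[where f=l2_class]) (auto simp: w_eq G_def)
      also have "\<dots> = l2_on T (\<lambda>\<xi>. x0 + D \<xi> \<omega>) + l2_on T (\<lambda>\<xi>. G \<xi> \<omega>)"
        by (rule l2_on_add[OF sq1 sqG])
      also have "l2_on T (\<lambda>\<xi>. x0 + D \<xi> \<omega>) = l2_on T (\<lambda>_. x0) + l2_on T (\<lambda>\<xi>. D \<xi> \<omega>)"
        by (rule l2_on_add[OF sq_x0 conv(1)])
      finally show ?thesis .
    qed
    ultimately show ?case
      using w_cont elim unfolding Let_def w_def[symmetric] by simp
  qed
  with Z show "ito_integrable M F W t (\<lambda>s _. lifted_diffusion T ?k2 s) \<and>
    (AE \<omega> in M. let w = volterra_path x0 b k1 X J t \<omega> in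
      continuous_on {0..T} w \<and>
      set_integrable lborel {0..t} (\<lambda>s. lifted_drift T k1 b s w) \<and>
      l2_on T w = l2_on T (\<lambda>_. x0)
        + (LINT s:{0..t}|lborel. lifted_drift T k1 b s w)
        + ito_integral M F W t (\<lambda>s _. lifted_diffusion T ?k2 s) \<omega>)"
    unfolding ito_integrable_def by blast
qed

end
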